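(* For $k=1,2,3$ let $A_k=(a_k,b_k,c_k,d_k)\in\mathbb R^{2\times2}$ with $\det A_k=1$ and $b_k\neq0$. Let $\phi\in L^2(\mathbb R^3)$ be a non-zero real-valued window function. Then every real-valued signal $f\in L^2(\mathbb R^3)$ (where, as a standing assumption on signals, $f$ is continuous and both $f$ and its octonion linear canonical transform $\mathcal L^{A_1,A_2,A_3}_{\mu_1,\mu_2,\mu_4}\{f\}$ are Lebesgue integrable) can be fully reconstructed by the formula $$f(x)=\frac1{\|\phi\|^2_{L^2(\mathbb R^3)}}\int_{\mathbb R^3}\int_{\mathbb R^3}\mathcal G^{A_1,A_2,A_3}_\phi\{f\}(w,u)\,K^{\mu_4}_{A_3^{-1}}(w_3,x_3)\,K^{\mu_2}_{A_2^{-1}}(w_2,x_2)\,K^{\mu_1}_{A_1^{-1}}(w_1,x_1)\,\phi(x-u)\,dw\,du,$$ where $A_k^{-1}=(d_k,-b_k,-c_k,a_k)$ and the octonion products are performed from left to right.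
   Context: Octonions: $\mathbb H$ denotes the quaternions with basis $1,\mu_1,\mu_2,\mu_3$, where $\mu_1^2=\mu_2^2=\mu_3^2=-1$ and $\mu_1\mu_2=\mu_3=-\mu_2\mu_1$. The octonion algebra is $\mathbb O=\{a+b\mu_4: a,b\in\mathbb H\}$ with product $(a+b\mu_4)(c+d\mu_4)=(ac-\overline d\,b)+(da+b\,\overline c)\mu_4$. It is non-commutative and non-associative; all unbracketed products are evaluated from left to right, e.g. $pqrs=((pq)r)s$. For $\theta\in\mathbb R$ and an imaginary unit $\mu_j$, $e^{\mu_j\theta}=\cos\theta+\mu_j\sin\theta$. Kernels: for a real matrix $A=(a,b,c,d)$ (rows $(a,b)$ and $(c,d)$) with $\det A=1$, $b\neq0$, an imaginary unit $\mu\in\{\mu_1,\mu_2,\mu_4\}$ and $s,t\in\mathbb R$, $$K^{\mu}_A(s,t)=\frac1{\sqrt{2\pi|b|}}\,e^{\frac{\mu}{2b}\left[as^2-2st+dt^2-\frac{\pi}{2}\right]}.$$ The octonion linear canonical transform (OLCT) of a real-valued function $f$ on $\mathbb R^3$ is $$\mathcal L^{A_1,A_2,A_3}_{\mu_1,\mu_2,\mu_4}\{f\}(w)=\int_{\mathbb R^3}f(x)K^{\mu_1}_{A_1}(x_1,w_1)K^{\mu_2}_{A_2}(x_2,w_2)K^{\mu_4}_{A_3}(x_3,w_3)\,dx,\quad w\in\mathbb R^3.$$ The short-time octonion linear canonical transform (STOLCT) of a real-valued signal $f\in L^2(\mathbb R^3)$ with respect to a non-zero real-valued window $\phi\in L^2(\mathbb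 R^3)$ is $$\mathcal G^{A_1,A_2,A_3}_\phi\{f\}(w,u)=\int_{\mathbb R^3}f(x)\overline{\phi(x-u)}K^{\mu_1}_{A_1}(x_1,w_1)K^{\mu_2}_{A_2}(x_2,w_2)K^{\mu_4}_{A_3}(x_3,w_3)\,dx,\quad w,u\in\mathbb R^3.$$
   Formalization: In the printed order dw du the inner integral may fail to exist (φ a cube's indicator, f Gaussian), so that order is proved whenever the inner w-integral exists for almost every u; with the u-integral taken first, the formula is proved with no extra condition. *)

theory Defs
  imports "HOL-Analysis.Analysis"
begin

section \<open>Quaternions and octonions\<close>

text \<open>
  Both algebras are carried by nested products of real lines, so that addition, scalar
  multiplication, the (Euclidean) norm and hence the Bochner integral are those of the library
  product types; only the algebra products have to be introduced.  The quadruple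
  \<open>(p, q, r, s)\<close> is the quaternion p + q mu1 + r mu2 + s mu3, and the pair \<open>(a, b)\<close> of
  quaternions is the octonion a + b mu4.
\<close>

type_synonym quat = "real \<times> real \<times> real \<times> real"

type_synonym oct = "quat \<times> quat"

fun qmul :: "quat \<Rightarrow> quat \<Rightarrow> quat" where
  "qmul (p, q, r, s) (p', q', r', s') =
     (p * p' - q * q' - r * r' - s * s',
      p * q' + q * p' + r * s' - s * r',
      p * r' - q * s' + r * p' + s * q',
      p * s' + q * r' - r * q' + s * p')"

fun qcnj :: "quat \<Rightarrow> quat" where
  "qcnj (p, q, r, s) = (p, - q, - r, - s)"

text \<open>Left associative: \<open>p \<odot> q \<odot> r \<odot> s\<close> is \<open>((p \<odot> q) \<odot> r) \<odot> s\<close>.\<close>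

fun omul :: "oct \<Rightarrow> oct \<Rightarrow> oct" (infixl \<open>\<odot>\<close> 70) where
  "omul (a, b) (c, d) =
     (qmul a c - qmul (qcnj d) b, qmul d a + qmul b (qcnj c))"

definition oreal :: "real \<Rightarrow> oct" where
  "oreal r = ((r, 0, 0, 0), (0, 0, 0, 0))"

definition mu1 :: oct where "mu1 = ((0, 1, 0, 0), (0, 0, 0, 0))"
definition mu2 :: oct where "mu2 = ((0, 0, 1, 0), (0, 0, 0, 0))"
definition mu3 :: oct where "mu3 = ((0, 0, 0, 1), (0, 0, 0, 0))"
definition mu4 :: oct where "mu4 = ((0, 0, 0, 0), (1, 0, 0, 0))"

lemma octonion_unit_products:
  "mu1 \<odot> mu1 = oreal (- 1)" "mu2 \<odot> mu2 = oreal (- 1)"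
  "mu3 \<odot> mu3 = oreal (- 1)" "mu4 \<odot> mu4 = oreal (- 1)"
  "mu1 \<odot> mu2 = mu3" "mu2 \<odot> mu1 = - mu3"
  by (simp_all add: zero_prod_def mu1_def mu2_def mu3_def mu4_def oreal_def)

lemma oreal_omul: "oreal r \<odot> z = r *\<^sub>R z" "z \<odot> oreal r = r *\<^sub>R z"
proof -
  obtain p q r' s p' q' r'' s' where "z = ((p, q, r', s), (p', q', r'', s'))"
    by (metis prod.exhaust)
  then show "oreal r \<odot> z = r *\<^sub>R z" "z \<odot> oreal r = r *\<^sub>R z"
    by (simp_all add: oreal_def zero_prod_def)
qed

lemma octonion_decomposition: "(a, b) = (a, 0) + (b, 0) \<odot> mu4"
  by (cases a, cases b) (simp add: mu4_def zero_prod_def)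

text \<open>The exponential of \<open>\<theta> \<mu>\<close>, for an imaginary unit \<open>\<mu>\<close>.\<close>

definition oexp :: "oct \<Rightarrow> real \<Rightarrow> oct" where
  "oexp \<mu> \<theta> = oreal (cos \<theta>) + sin \<theta> *\<^sub>R \<mu>"


section \<open>Linear canonical transforms\<close>

text \<open>The kernel of the matrix with rows \<open>(a, b)\<close> and \<open>(c, d)\<close>; it is only meaningful when
  the entry \<open>b\<close> is nonzero.\<close>

definition lct_kernel :: "oct \<Rightarrow> real^2^2 \<Rightarrow> real \<Rightarrow> real \<Rightarrow> oct" where
  "lct_kernel \<mu> A s t =
     (let a = A $ 1 $ 1; b = A $ 1 $ 2; d = A $ 2 $ 2
      in (1 / sqrt (2 * pi * \<bar>b\<bar>)) *\<^sub>R
           oexp \<mu> (1 / (2 * b) * (a * s\<^sup>2 - 2 * s * t + d * t\<^sup>2 - pi / 2)))"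

definition lct_inv :: "real^2^2 \<Rightarrow> real^2^2" where
  "lct_inv A = vector [vector [A $ 2 $ 2, - A $ 1 $ 2], vector [- A $ 2 $ 1, A $ 1 $ 1]]"

lemma lct_inv_is_inverse:
  assumes "det A = 1"
  shows "A ** lct_inv A = mat 1" "lct_inv A ** A = mat 1"
  using assms
  by (simp_all add: lct_inv_def matrix_matrix_mult_def mat_def vec_eq_iff forall_2 sum_2 det_2
      mult.commute)

text \<open>Signals and windows are real valued, so complex conjugation of the window is the identity
  and multiplication by their values is \<open>*\<^sub>R\<close>, on either side.\<close>

definition olct :: "real^2^2 \<Rightarrow> real^2^2 \<Rightarrow> real^2^2 \<Rightarrow> (real^3 \<Rightarrow> real) \<Rightarrow> real^3 \<Rightarrow> oct" where
  "olct A1 A2 A3 f w =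
     (LINT x|lebesgue. (f x *\<^sub>R lct_kernel mu1 A1 (x $ 1) (w $ 1))
        \<odot> lct_kernel mu2 A2 (x $ 2) (w $ 2) \<odot> lct_kernel mu4 A3 (x $ 3) (w $ 3))"

definition stolct ::
  "real^2^2 \<Rightarrow> real^2^2 \<Rightarrow> real^2^2 \<Rightarrow> (real^3 \<Rightarrow> real) \<Rightarrow> (real^3 \<Rightarrow> real) \<Rightarrow> real^3 \<Rightarrow> real^3 \<Rightarrow> oct"
where
  "stolct A1 A2 A3 \<phi> f w u =
     (LINT x|lebesgue. ((f x * \<phi> (x - u)) *\<^sub>R lct_kernel mu1 A1 (x $ 1) (w $ 1))
        \<odot> lct_kernel mu2 A2 (x $ 2) (w $ 2) \<odot> lct_kernel mu4 A3 (x $ 3) (w $ 3))"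

definition stolct_inv_integrand ::
  "real^2^2 \<Rightarrow> real^2^2 \<Rightarrow> real^2^2 \<Rightarrow> (real^3 \<Rightarrow> real) \<Rightarrow> (real^3 \<Rightarrow> real) \<Rightarrow> real^3 \<Rightarrow>
   real^3 \<Rightarrow> real^3 \<Rightarrow> oct"
where
  "stolct_inv_integrand A1 A2 A3 \<phi> f x w u =
     \<phi> (x - u) *\<^sub>R
       (stolct A1 A2 A3 \<phi> f w u
         \<odot> lct_kernel mu4 (lct_inv A3) (w $ 3) (x $ 3)
         \<odot> lct_kernel mu2 (lct_inv A2) (w $ 2) (x $ 2)
         \<odot> lct_kernel mu1 (lct_inv A1) (w $ 1) (x $ 1))"


section \<open>Square integrable real-valued functions\<close>

definition in_L2 :: "(real^3 \<Rightarrow> real) \<Rightarrow> bool" where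
  "in_L2 f \<longleftrightarrow> f \<in> borel_measurable lebesgue \<and> integrable lebesgue (\<lambda>x. (f x)\<^sup>2)"

definition L2_norm_fun :: "(real^3 \<Rightarrow> real) \<Rightarrow> real" where
  "L2_norm_fun f = sqrt (LINT x|lebesgue. (f x)\<^sup>2)"

end

theory Submission
  imports Defs "HOL-Probability.Probability"
begin

text \<open>
  Right multiplication by an imaginary unit \<open>\<mu>\<close> is a complex structure \<open>J\<close> on the octonions, and
  multiplication by \<open>e\<^bsup>\<mu>\<theta>\<^esup>\<close> from the right is the rotation \<open>cos \<theta> + sin \<theta> J\<close>.  A product performed
  from left to right is therefore a composition of rotations, and no further associativity is needed:
  the inverse kernels undo the kernels from the outside in, one coordinate at a time.  In each
  coordinate, testing against a bounded continuous \<open>\<psi>\<close> and regularising the frequency integral by a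
  Gaussian gives a weak inversion formula; integrating the signal against \<open>\<psi>\<close> reduces the dimension
  by one.  Shrinking the test functions gives pointwise inversion wherever the signal is the limit of its averages.

  Integrating over the window position \<open>u\<close> first turns the transform of \<open>f \<cdot> \<phi>(\<cdot> - u)\<close> into that of
  \<open>f\<close> times the autocorrelation of \<open>\<phi>\<close>.  The autocorrelation is a limit of superpositions of cosines with
  nonnegative density of bounded mass; multiplying \<open>f\<close> by a cosine only shifts the frequencies, so the
  product again has an integrable transform and the inversion applies at \<open>x\<close>.  If the frequency
  integral is performed first, the inversion is applied to \<open>f \<cdot> \<phi>(\<cdot> - u)\<close> itself, whose averages at \<open>x\<close>
  converge for almost every \<open>u\<close> along a suitable sequence of radii.
\<close>

section \<open>Weak inversion in one coordinate\<close>

text \<open>Right multiplications by distinct units do not commute, so the three phases cannot be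
  merged into one exponential, and only the outermost coordinate is accessible to an inversion.
  Integrability of the full transform does not directly control the transform of a marginal signal;
  that has to come out of the weak inversion of the coordinate just removed.

  The main obstacle is the window. The product of \<open>f\<close> with a translate of
  \<open>\<phi>\<close> may have a non-integrable transform: an integrable one makes the product
  almost everywhere equal to a continuous function, which a window with a jump can prevent.
  Averaging over \<open>u\<close> repairs this, because an autocorrelation has a nonnegative
  spectrum whose mass is read off at the origin, where the autocorrelation is the squared L2 norm of
  the window. The bounds involve only that norm and survive the approximation of the window by
  integrable ones.

  A modulation cannot be moved through the rotations as a single phase. Its effect is computed in
  the eight real coordinates, where the kernel entries are products of cosines and sines.\<close>

lemma gaussian_integrals:
  fixes \<sigma> s :: real
  assumes "\<sigma> > 0"
  shows integrable_gaussian: "integrable lborel (\<lambda>w. exp (- (w / \<sigma>)\<^sup>2 / 2))"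
    and integral_gaussian_cos: "(LBINT w. exp (- (w / \<sigma>)\<^sup>2 / 2) * cos (s * w)) = \<sigma> * sqrt (2 * pi) * exp (- (\<sigma> * s)\<^sup>2 / 2)"
    and integral_gaussian_sin: "(LBINT w. exp (- (w / \<sigma>)\<^sup>2 / 2) * sin (s * w)) = 0"
proof -
  let ?n = "std_normal_density"
  have n: "exp (- (w / \<sigma>)\<^sup>2 / 2) = sqrt (2 * pi) * ?n (w / \<sigma>)" for w
    by (simp add: std_normal_density_def)
  have int: "integrable lborel (\<lambda>x. ?n (0 + (1 / \<sigma>) * x))"
    using assms by (intro lborel_integrable_real_affine) auto
  then show "integrable lborel (\<lambda>w. exp (- (w / \<sigma>)\<^sup>2 / 2))"
    unfolding n by simp
  \<comment> \<open>This is the characteristic function of the standard normal law; its real and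
    imaginary parts give the cosine and the sine integral, up to scaling.\<close>
  have char: "complex_of_real (exp (- (t^2) / 2)) = (CLBINT x. ?n x *\<^sub>R iexp (t * x))" for t
    using fun_cong[OF char_std_normal_distribution, of t] unfolding char_def
    by (subst (asm) integral_density) (auto simp: normal_density_nonneg)
  have ic: "integrable lborel (\<lambda>x. ?n x *\<^sub>R iexp (t * x))" for t
    by (rule Bochner_Integration.integrable_bound[OF integrable_normal_density[where \<mu> = 0 and \<sigma> = 1]])
       (auto simp: normal_density_nonneg)
  have re: "(LBINT x. ?n x * cos (t * x)) = exp (- (t^2) / 2)" for t
    using arg_cong[OF char[of t], of Re] ic[of t]
    by (subst (asm) integral_Re[symmetric]) (auto simp: Re_exp)
  have im: "(LBINT x. ?n x * sin (t * x)) = 0" for t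
    using arg_cong[OF char[of t], of Im] ic[of t]
    by (subst (asm) integral_Im[symmetric]) (auto simp: Im_exp)
  have "(LBINT w. exp (- (w / \<sigma>)\<^sup>2 / 2) * cos (s * w)) = \<bar>\<sigma>\<bar> *\<^sub>R (LBINT w. exp (- ((0 + \<sigma> * w) / \<sigma>)\<^sup>2 / 2) * cos (s * (0 + \<sigma> * w)))"
    using assms by (intro lborel_integral_real_affine) auto
  also have "\<dots> = \<bar>\<sigma>\<bar> *\<^sub>R (LBINT w. sqrt (2 * pi) * (?n w * cos ((\<sigma> * s) * w)))"
    using assms by (simp add: std_normal_density_def mult_ac)
  also have "\<dots> = \<sigma> * sqrt (2 * pi) * exp (- (\<sigma> * s)\<^sup>2 / 2)"
    using assms re[of "\<sigma> * s"] by (simp add: power_mult_distrib)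
  finally show "(LBINT w. exp (- (w / \<sigma>)\<^sup>2 / 2) * cos (s * w)) = \<sigma> * sqrt (2 * pi) * exp (- (\<sigma> * s)\<^sup>2 / 2)" .
  have "(LBINT w. exp (- (w / \<sigma>)\<^sup>2 / 2) * sin (s * w)) = \<bar>\<sigma>\<bar> *\<^sub>R (LBINT w. exp (- ((0 + \<sigma> * w) / \<sigma>)\<^sup>2 / 2) * sin (s * (0 + \<sigma> * w)))"
    using assms by (intro lborel_integral_real_affine) auto
  also have "\<dots> = \<bar>\<sigma>\<bar> *\<^sub>R (LBINT w. sqrt (2 * pi) * (?n w * sin ((\<sigma> * s) * w)))"
    using assms by (simp add: std_normal_density_def mult_ac)
  also have "\<dots> = 0"
    using im[of "\<sigma> * s"] by simp
  finally show "(LBINT w. exp (- (w / \<sigma>)\<^sup>2 / 2) * sin (s * w)) = 0" .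
qed

lemma (in pair_sigma_finite) integrable_times:
  fixes f g :: "_ \<Rightarrow> real"
  assumes f: "integrable M1 f" and g: "integrable M2 g"
  shows "integrable (M1 \<Otimes>\<^sub>M M2) (\<lambda>p. f (fst p) * g (snd p))"
proof (rule Fubini_integrable)
  have [measurable]: "f \<in> borel_measurable M1" "g \<in> borel_measurable M2"
    using f g by auto
  show "(\<lambda>p. f (fst p) * g (snd p)) \<in> borel_measurable (M1 \<Otimes>\<^sub>M M2)"
    by measurable
qed (use f g in \<open>auto simp: abs_mult\<close>)

definition rot :: "('a::real_vector \<Rightarrow> 'a) \<Rightarrow> real \<Rightarrow> 'a \<Rightarrow> 'a" where
  "rot J \<theta> v = cos \<theta> *\<^sub>R v + sin \<theta> *\<^sub>R J v"

lemma rot_0 [simp]: "rot J 0 v = v"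
  by (simp add: rot_def)

locale complex_structure = bounded_linear J
  for J :: "'a::{banach, second_countable_topology} \<Rightarrow> 'a" +
  assumes square: "J (J v) = - v"
begin

lemma rot_rot: "rot J s (rot J t v) = rot J (s + t) v"
  by (simp add: rot_def add scaleR square cos_add sin_add algebra_simps)

lemma bounded_linear_rot: "bounded_linear (rot J t)"
  unfolding rot_def[abs_def]
  by (intro bounded_linear_add bounded_linear_const_scaleR bounded_linear_ident bounded_linear_axioms)

text \<open>\<open>J\<close> is not assumed to be an isometry, so a rotation is controlled only up
  to the factor \<open>1 + onorm J\<close>. A finite factor uniform in the angle is what the
  dominations below require.\<close>

lemma norm_rot_le: "norm (rot J t v) \<le> (1 + onorm J) * norm v"
proof -
  have "norm (rot J t v) \<le> \<bar>cos t\<bar> * norm v + \<bar>sin t\<bar> * norm (J v)"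
    unfolding rot_def by (rule order.trans[OF norm_triangle_ineq]) simp
  also have "\<dots> \<le> 1 * norm v + 1 * (onorm J * norm v)"
    by (intro add_mono mult_mono onorm bounded_linear_axioms) auto
  finally show ?thesis by (simp add: algebra_simps)
qed

lemma norm_rot_le_imp: "norm v \<le> C \<Longrightarrow> norm (rot J t v) \<le> (1 + onorm J) * C"
  using onorm_pos_le[OF bounded_linear_axioms]
  by (intro order.trans[OF norm_rot_le] mult_left_mono) auto

lemma borel_measurable_J [measurable]: "J \<in> borel_measurable borel"
  by (intro borel_measurable_continuous_onI linear_continuous_on bounded_linear_axioms)

lemma borel_measurable_rot [measurable (raw)]:
  assumes [measurable]: "\<theta> \<in> borel_measurable M" "h \<in> borel_measurable M"
  shows "(\<lambda>p. rot J (\<theta> p) (h p)) \<in> borel_measurable M"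
  unfolding rot_def by measurable

lemma tendsto_rot:
  assumes "(\<theta> \<longlongrightarrow> t) F" "(h \<longlongrightarrow> v) F"
  shows "((\<lambda>p. rot J (\<theta> p) (h p)) \<longlongrightarrow> rot J t v) F"
  unfolding rot_def using assms
  by (intro tendsto_add tendsto_scaleR tendsto isCont_tendsto_compose[of _ cos]
      isCont_tendsto_compose[of _ sin]) auto

lemma integrable_rot:
  assumes [measurable]: "\<theta> \<in> borel_measurable M" and h: "integrable M h"
  shows "integrable M (\<lambda>p. rot J (\<theta> p) (h p))"
proof (rule Bochner_Integration.integrable_bound)
  show "integrable M (\<lambda>p. (1 + onorm J) * norm (h p))" using h by simp
  show "(\<lambda>p. rot J (\<theta> p) (h p)) \<in> borel_measurable M" using h by measurable
  have "0 \<le> (1 + onorm J) * norm (h x)" for x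
    using onorm_pos_le[OF bounded_linear_axioms] by simp
  then show "AE x in M. norm (rot J (\<theta> x) (h x)) \<le> norm ((1 + onorm J) * norm (h x))"
    using norm_rot_le by (intro AE_I2) (simp only: real_norm_def abs_of_nonneg)
qed

lemma integral_rot: "integrable M h \<Longrightarrow> (LINT p|M. rot J t (h p)) = rot J t (LINT p|M. h p)"
  by (rule integral_bounded_linear[OF bounded_linear_rot])

text \<open>The sine part, which carries \<open>J\<close>, vanishes by parity. The Gaussian thus
  turns an oscillating rotation into a scalar weight on the fixed rotation by
  \<open>c\<close>.\<close>

lemma integral_gaussian_rot:
  assumes "\<sigma> > 0"
  shows "(LBINT w. exp (- (w / \<sigma>)\<^sup>2 / 2) *\<^sub>R rot J (c - s * w) v) =
    (\<sigma> * sqrt (2 * pi) * exp (- (\<sigma> * s)\<^sup>2 / 2)) *\<^sub>R rot J c v"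
proof -
  let ?G = "\<lambda>w. exp (- (w / \<sigma>)\<^sup>2 / 2)"
  have i: "integrable lborel (\<lambda>w. ?G w * cos (s * w))" "integrable lborel (\<lambda>w. ?G w * sin (s * w))"
    by (rule Bochner_Integration.integrable_bound[OF integrable_gaussian[OF assms]];
        simp add: abs_mult mult_left_le)+
  have "?G w *\<^sub>R rot J (c - s * w) v = (?G w * cos (s * w)) *\<^sub>R rot J c v + (?G w * sin (s * w)) *\<^sub>R (- J (rot J c v))" for w
    by (simp add: rot_def add scaleR square cos_diff sin_diff algebra_simps)
  then show ?thesis
    using i integral_gaussian_cos[OF assms, of s] integral_gaussian_sin[OF assms, of s] by simp
qed

text \<open>After Fubini the damped frequency integral is a Gaussian in \<open>x - y\<close> whose
  width shrinks like \<open>1 / Suc n\<close>, hence an approximate identity that acts on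
  \<open>\<psi>\<close>. Only \<open>\<psi>\<close> has to be continuous, and \<open>h\<close> is
  never evaluated at a point. In the constant, the modulus of \<open>b\<close> comes from rescaling
  \<open>x\<close>; one factor \<open>sqrt (2 * pi)\<close> comes from the Fourier transform of the
  Gaussian and the other from the mass of the limiting Gaussian.\<close>

lemma LCT_inversion_weak_1D:
  fixes h :: "real \<Rightarrow> 'a" and a b d :: real
  defines "\<theta> \<equiv> \<lambda>s t. 1 / (2 * b) * (a * s\<^sup>2 - 2 * s * t + d * t\<^sup>2 - pi / 2)"
  defines "K \<equiv> \<lambda>w. LBINT y. rot J (\<theta> y w) (h y)"
  assumes b: "b \<noteq> 0" and h: "integrable lborel h" and K: "integrable lborel K"
    and \<psi>: "continuous_on UNIV \<psi>" "integrable lborel \<psi>" "\<And>x::real. \<bar>\<psi> x\<bar> \<le> M"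
  shows "(LBINT x. \<psi> x *\<^sub>R (LBINT w. rot J (- \<theta> x w) (K w))) =
    (2 * pi * \<bar>b\<bar>) *\<^sub>R (LBINT x. \<psi> x *\<^sub>R h x)"
proof -
  define B where "B = 1 + onorm J"
  have B: "norm (rot J t v) \<le> B * norm v" "B \<ge> 0" for t v
    using norm_rot_le onorm_pos_le[OF bounded_linear_axioms] by (auto simp: B_def)
  have [measurable]: "\<psi> \<in> borel_measurable borel" "h \<in> borel_measurable borel" "K \<in> borel_measurable borel"
    using \<psi>(2) h K by auto
  have [measurable]: "(\<lambda>p. \<theta> (f p) (g p)) \<in> borel_measurable N"
    if [measurable]: "f \<in> borel_measurable N" "g \<in> borel_measurable N" for f g and N :: "'z measure"
    unfolding \<theta>_def by measurable
  have M: "M \<ge> 0" using \<psi>(3)[of 0] by simp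
  define G where "G = (\<lambda>n w. exp (- (w / real (Suc n))\<^sup>2 / 2))"
  have [measurable]: "G n \<in> borel_measurable borel" for n
    unfolding G_def by measurable
  have G: "integrable lborel (G n)" "0 \<le> G n w" "G n w \<le> 1" for n w
    using integrable_gaussian[of "real (Suc n)"] by (auto simp: G_def)
  have G_lim: "(\<lambda>n. G n w) \<longlonglongrightarrow> 1" for w
  proof -
    have "(\<lambda>n. w * (1 / real (Suc n))) \<longlonglongrightarrow> w * 0"
      by (intro tendsto_intros LIMSEQ_Suc lim_1_over_n)
    then have "(\<lambda>n. exp (- (w * (1 / real (Suc n)))\<^sup>2 / 2)) \<longlonglongrightarrow> exp (- (w * 0)\<^sup>2 / 2)"
      by (intro isCont_tendsto_compose[of "w * 0" "\<lambda>x. exp (- x\<^sup>2 / 2)"]) (auto intro!: continuous_intros)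
    then show ?thesis by (simp add: G_def)
  qed
  define L where "L = (\<lambda>n. LBINT x. \<psi> x *\<^sub>R (LBINT w. G n w *\<^sub>R rot J (- \<theta> x w) (K w)))"
  have L_lim: "L \<longlonglongrightarrow> (LBINT x. \<psi> x *\<^sub>R (LBINT w. rot J (- \<theta> x w) (K w)))"
    unfolding L_def
  proof (rule integral_dominated_convergence)
    show "integrable lborel (\<lambda>x. \<bar>\<psi> x\<bar> * (LBINT w. B * norm (K w)))"
      using \<psi>(2) by simp
    show "AE x in lborel. (\<lambda>n. \<psi> x *\<^sub>R (LBINT w. G n w *\<^sub>R rot J (- \<theta> x w) (K w))) \<longlonglongrightarrow>
       \<psi> x *\<^sub>R (LBINT w. rot J (- \<theta> x w) (K w))"
    proof (intro AE_I2 tendsto_scaleR tendsto_const)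
      fix x
      show "(\<lambda>n. LBINT w. G n w *\<^sub>R rot J (- \<theta> x w) (K w)) \<longlonglongrightarrow> (LBINT w. rot J (- \<theta> x w) (K w))"
      proof (rule integral_dominated_convergence)
        show "integrable lborel (\<lambda>w. B * norm (K w))" using K by simp
        show "AE w in lborel. (\<lambda>n. G n w *\<^sub>R rot J (- \<theta> x w) (K w)) \<longlonglongrightarrow> rot J (- \<theta> x w) (K w)"
          using tendsto_scaleR[OF G_lim tendsto_const] by (intro AE_I2) fastforce
        show "AE w in lborel. norm (G n w *\<^sub>R rot J (- \<theta> x w) (K w)) \<le> B * norm (K w)" for n
          using mult_mono[OF G(3) B(1)] G(2) by (intro AE_I2) simp
      qed measurable
    qed
    show "AE x in lborel. norm (\<psi> x *\<^sub>R (LBINT w. G n w *\<^sub>R rot J (- \<theta> x w) (K w)))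
      \<le> \<bar>\<psi> x\<bar> * (LBINT w. B * norm (K w))" for n
    proof (intro AE_I2)
      fix x
      have "norm (LBINT w. G n w *\<^sub>R rot J (- \<theta> x w) (K w)) \<le> (LBINT w. B * norm (K w))"
      proof (rule Bochner_Integration.integral_norm_bound_integral)
        show i: "integrable lborel (\<lambda>w. B * norm (K w))" using K by simp
        show *: "norm (G n w *\<^sub>R rot J (- \<theta> x w) (K w)) \<le> B * norm (K w)" for w
          using mult_mono[OF G(3) B(1)] G(2) by simp
        show "integrable lborel (\<lambda>w. G n w *\<^sub>R rot J (- \<theta> x w) (K w))"
          by (rule Bochner_Integration.integrable_bound[OF i])
            (measurable, intro AE_I2 order.trans[OF *], simp)
      qed
      then show "norm (\<psi> x *\<^sub>R (LBINT w. G n w *\<^sub>R rot J (- \<theta> x w) (K w)))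
        \<le> \<bar>\<psi> x\<bar> * (LBINT w. B * norm (K w))"
        by (simp add: mult_left_mono)
    qed
  qed measurable
  \<comment> \<open>This is the integrand after the substitution
    \<open>x = y - (b / Suc n) * t\<close>. The index now occurs only in the argument of
    \<open>\<psi>\<close> and in the residual angle, and both converge as \<open>n\<close>
    grows.\<close>
  let ?I = "\<lambda>n y t. (\<bar>b\<bar> * sqrt (2 * pi) * exp (- t\<^sup>2 / 2) * \<psi> (y + (- b / Suc n) * t)) *\<^sub>R
      rot J (a * (y\<^sup>2 - (y + (- b / Suc n) * t)\<^sup>2) / (2 * b)) (h y)"
  have L_eq: "L n = (LBINT y. LBINT t. ?I n y t)" for n
  proof -
    define c where "c = (\<lambda>x y. a * (y\<^sup>2 - x\<^sup>2) / (2 * b))"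
    \<comment> \<open>The terms in \<open>d * w\<^sup>2\<close> and in \<open>pi\<close> cancel, so
      the angle is affine in \<open>w\<close>, as \<open>integral_gaussian_rot\<close> requires. The
      leftover chirp \<open>c x y\<close> vanishes on the diagonal.\<close>
    have \<theta>_diff: "- \<theta> x w + \<theta> y w = c x y - ((y - x) / b) * w" for x y w
      using b by (simp add: \<theta>_def c_def field_simps)
    define H where "H = (\<lambda>s. real (Suc n) * sqrt (2 * pi) * exp (- (real (Suc n) * s)\<^sup>2 / 2))"
    have step1: "(LBINT w. G n w *\<^sub>R rot J (- \<theta> x w) (K w)) = (LBINT y. H ((y - x) / b) *\<^sub>R rot J (c x y) (h y))" for x
    proof -
      have "G n w *\<^sub>R rot J (- \<theta> x w) (K w) = (LBINT y. G n w *\<^sub>R rot J (c x y - ((y - x) / b) * w) (h y))" for w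
      proof -
        have "rot J (- \<theta> x w) (rot J (\<theta> y w) (h y)) = rot J (c x y - ((y - x) / b) * w) (h y)" for y
          by (simp only: rot_rot \<theta>_diff)
        with integral_rot[OF integrable_rot[OF _ h, of "\<lambda>y. \<theta> y w"], of "- \<theta> x w"]
        have "rot J (- \<theta> x w) (K w) = (LBINT y. rot J (c x y - ((y - x) / b) * w) (h y))"
          by (simp only: K_def) measurable
        then show ?thesis by simp
      qed
      then have "(LBINT w. G n w *\<^sub>R rot J (- \<theta> x w) (K w)) =
          (LBINT w. LBINT y. G n w *\<^sub>R rot J (c x y - ((y - x) / b) * w) (h y))" by (simp only:)
      also have "\<dots> = (LBINT y. LBINT w. G n w *\<^sub>R rot J (c x y - ((y - x) / b) * w) (h y))"
      proof (rule lborel_pair.Fubini_integral, rule Bochner_Integration.integrable_bound)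
        show "integrable (lborel \<Otimes>\<^sub>M lborel) (\<lambda>(y, w). B * (norm (h y) * G n w))"
          using h G(1)[of n] by (auto simp: split_beta' intro!: lborel_pair.integrable_times)
        have "norm (G n w *\<^sub>R rot J t (h y)) \<le> B * (norm (h y) * G n w)" for y w t
          using mult_left_mono[OF B(1)[of t "h y"] G(2)[of n w]] G(2)[of n w] by (simp add: mult_ac)
        then show "AE p in lborel \<Otimes>\<^sub>M lborel. norm (case p of (y, w) \<Rightarrow> G n w *\<^sub>R rot J (c x y - ((y - x) / b) * w) (h y))
          \<le> norm (case p of (y, w) \<Rightarrow> B * (norm (h y) * G n w))"
          using B(2) G(2) by (intro AE_I2) (auto simp: split_beta')
      qed (simp add: c_def)
      also have "\<dots> = (LBINT y. H ((y - x) / b) *\<^sub>R rot J (c x y) (h y))"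
        unfolding G_def H_def by (subst integral_gaussian_rot) auto
      finally show ?thesis .
    qed
    have "L n = (LBINT x. LBINT y. (\<psi> x * H ((y - x) / b)) *\<^sub>R rot J (c x y) (h y))"
      unfolding L_def step1 scaleR_scaleR[symmetric] Bochner_Integration.integral_scaleR_right ..
    also have "\<dots> = (LBINT y. LBINT x. (\<psi> x * H ((y - x) / b)) *\<^sub>R rot J (c x y) (h y))"
    proof (rule lborel_pair.Fubini_integral, rule Bochner_Integration.integrable_bound)
      let ?C = "real (Suc n) * sqrt (2 * pi) * B"
      show "integrable (lborel \<Otimes>\<^sub>M lborel) (\<lambda>(y, x). ?C * (norm (h y) * \<bar>\<psi> x\<bar>))"
        using h \<psi>(2) by (auto simp: split_beta' intro!: lborel_pair.integrable_times)
      have H: "0 \<le> H s" "H s \<le> real (Suc n) * sqrt (2 * pi)" for s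
        by (auto simp: H_def mult_left_le)
      have "norm ((\<psi> x * H s) *\<^sub>R rot J t (h y)) \<le> ?C * (norm (h y) * \<bar>\<psi> x\<bar>)" for y x s t
        using mult_left_mono[OF mult_mono[OF H(2)[of s] B(1)[of t "h y"]], of "\<bar>\<psi> x\<bar>"] H(1)[of s]
        by (simp add: abs_mult mult_ac)
      then show "AE p in lborel \<Otimes>\<^sub>M lborel. norm (case p of (y, x) \<Rightarrow> (\<psi> x * H ((y - x) / b)) *\<^sub>R rot J (c x y) (h y))
          \<le> norm (case p of (y, x) \<Rightarrow> ?C * (norm (h y) * \<bar>\<psi> x\<bar>))"
        by (intro AE_I2) (auto simp: split_beta' intro!: order.trans[OF _ abs_ge_self])
    qed (simp add: c_def H_def)
    also have "\<dots> = (LBINT y. LBINT t. ?I n y t)"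
    proof (rule Bochner_Integration.integral_cong[OF refl])
      fix y
      let ?F = "\<lambda>t. (\<psi> (y + (- b / Suc n) * t) * H ((y - (y + (- b / Suc n) * t)) / b)) *\<^sub>R
        rot J (c (y + (- b / Suc n) * t) y) (h y)"
      have "(LBINT x. (\<psi> x * H ((y - x) / b)) *\<^sub>R rot J (c x y) (h y)) =
        \<bar>- b / Suc n\<bar> *\<^sub>R (LBINT t. ?F t)"
        using b by (intro lborel_integral_real_affine) auto
      also have "\<dots> = (LBINT t. \<bar>- b / Suc n\<bar> *\<^sub>R (?F t))"
        by (rule Bochner_Integration.integral_scaleR_right[symmetric])
      also have "\<dots> = (LBINT t. ?I n y t)"
      proof (rule Bochner_Integration.integral_cong[OF refl])
        fix t
        have "(y - (y + (- b / Suc n) * t)) / b = t / Suc n" using b by (simp del: of_nat_Suc)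
        then show "\<bar>- b / Suc n\<bar> *\<^sub>R (?F t) = ?I n y t"
          by (simp add: H_def c_def abs_divide del: of_nat_Suc)
      qed
      finally show "(LBINT x. (\<psi> x * H ((y - x) / b)) *\<^sub>R rot J (c x y) (h y)) =
        (LBINT t. ?I n y t)" .
    qed
    finally show ?thesis .
  qed
  have R_lim: "(\<lambda>n. LBINT y. LBINT t. ?I n y t) \<longlonglongrightarrow>
      (LBINT y. LBINT t. (\<bar>b\<bar> * sqrt (2 * pi) * exp (- t\<^sup>2 / 2) * \<psi> y) *\<^sub>R h y)"
  proof -
    let ?C = "\<bar>b\<bar> * sqrt (2 * pi) * M * B"
    let ?E = "\<lambda>t::real. exp (- t\<^sup>2 / 2)"
    have E: "integrable lborel ?E" using integrable_gaussian[of 1] by simp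
    have bnd: "norm ((\<bar>b\<bar> * sqrt (2 * pi) * exp (- t\<^sup>2 / 2) * \<psi> x) *\<^sub>R rot J s (h y)) \<le> (?C * norm (h y)) * ?E t" for t x s y
    proof -
      have "\<bar>\<psi> x\<bar> * norm (rot J s (h y)) \<le> M * (B * norm (h y))"
        using \<psi>(3) B M by (intro mult_mono) auto
      from mult_left_mono[OF this, of "\<bar>b\<bar> * sqrt (2 * pi) * ?E t"] show ?thesis
        by (simp add: abs_mult mult_ac)
    qed
    have eps: "(\<lambda>n. y + (- b / Suc n) * t) \<longlonglongrightarrow> y" for y t
    proof -
      have "(\<lambda>n. y + (- b * (1 / real (Suc n))) * t) \<longlonglongrightarrow> y + (- b * 0) * t"
        by (intro tendsto_intros LIMSEQ_Suc lim_1_over_n)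
      then show ?thesis by simp
    qed
    have lim: "(\<lambda>n. ?I n y t) \<longlonglongrightarrow> (\<bar>b\<bar> * sqrt (2 * pi) * exp (- t\<^sup>2 / 2) * \<psi> y) *\<^sub>R h y" for y t
    proof -
      have "isCont \<psi> y" using \<psi>(1) by (simp add: continuous_on_eq_continuous_at)
      then have "(\<lambda>n. ?I n y t) \<longlonglongrightarrow>
        (\<bar>b\<bar> * sqrt (2 * pi) * exp (- t\<^sup>2 / 2) * \<psi> y) *\<^sub>R rot J (a * (y\<^sup>2 - y\<^sup>2) / (2 * b)) (h y)"
        using b by (intro tendsto_intros tendsto_rot isCont_tendsto_compose[of _ \<psi>] eps) auto
      then show ?thesis by simp
    qed
    show ?thesis
    proof (rule integral_dominated_convergence)
      show "integrable lborel (\<lambda>y. ?C * norm (h y) * (LBINT t. ?E t))"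
        using h by simp
      show "AE y in lborel. (\<lambda>n. LBINT t. ?I n y t) \<longlonglongrightarrow>
        (LBINT t. (\<bar>b\<bar> * sqrt (2 * pi) * exp (- t\<^sup>2 / 2) * \<psi> y) *\<^sub>R h y)"
      proof (intro AE_I2)
        fix y
        show "(\<lambda>n. LBINT t. ?I n y t) \<longlonglongrightarrow>
          (LBINT t. (\<bar>b\<bar> * sqrt (2 * pi) * exp (- t\<^sup>2 / 2) * \<psi> y) *\<^sub>R h y)"
        proof (rule integral_dominated_convergence)
          show "integrable lborel (\<lambda>t. (?C * norm (h y)) * ?E t)" using E by simp
        qed (use lim bnd in auto)
      qed
      show "AE y in lborel. norm (LBINT t. ?I n y t) \<le> ?C * norm (h y) * (LBINT t. ?E t)" for n
      proof (intro AE_I2)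
        fix y
        have i: "integrable lborel (\<lambda>t. (?C * norm (h y)) * ?E t)" using E by simp
        have "norm (LBINT t. ?I n y t) \<le> (LBINT t. (?C * norm (h y)) * ?E t)"
        proof (rule Bochner_Integration.integral_norm_bound_integral[OF _ i bnd])
          show "integrable lborel (\<lambda>t. ?I n y t)"
          proof (rule Bochner_Integration.integrable_bound[OF i])
            show "AE t in lborel. norm (?I n y t) \<le> norm ((?C * norm (h y)) * ?E t)"
              by (intro AE_I2 order.trans[OF bnd]) simp
          qed measurable
        qed
        then show "norm (LBINT t. ?I n y t) \<le> ?C * norm (h y) * (LBINT t. ?E t)" by simp
      qed
    qed measurable
  qed
  have t_eq: "(LBINT t. (\<bar>b\<bar> * sqrt (2 * pi) * exp (- t\<^sup>2 / 2) * \<psi> y) *\<^sub>R h y) = (2 * pi * \<bar>b\<bar>) *\<^sub>R (\<psi> y *\<^sub>R h y)" for y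
  proof -
    have "(LBINT t. (\<bar>b\<bar> * sqrt (2 * pi) * exp (- t\<^sup>2 / 2) * \<psi> y) *\<^sub>R h y) =
      (LBINT t. exp (- (t / 1)\<^sup>2 / 2) * cos (0 * t)) *\<^sub>R ((\<bar>b\<bar> * sqrt (2 * pi) * \<psi> y) *\<^sub>R h y)"
      using integrable_gaussian[of 1]
      by (subst integral_scaleR_left[symmetric]) (auto simp: mult_ac)
    also have "\<dots> = (2 * pi * \<bar>b\<bar>) *\<^sub>R (\<psi> y *\<^sub>R h y)"
      by (subst integral_gaussian_cos) (auto simp: real_sqrt_mult[symmetric] mult_ac)
    finally show ?thesis .
  qed
  show ?thesis
    using LIMSEQ_unique[OF L_lim R_lim[folded L_eq]]
    unfolding t_eq Bochner_Integration.integral_scaleR_right .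
qed

end

section \<open>Weak inversion in three coordinates\<close>

context complex_structure
begin

text \<open>For a fixed inner frequency the slice of \<open>H\<close> in the outer frequency is a
  one-dimensional transform, of the signal integrated against the inner kernel \<open>k\<close>.
  Fubini makes almost every slice integrable, so the one-dimensional inversion applies slice by
  slice and produces \<open>H'\<close>. The same identity shows that \<open>H'\<close> is
  integrable, which the next coordinate requires. \<open>L\<close> stands for the inverse rotations
  still to be applied; its linearity lets it pass through the integrals.\<close>

lemma LCT_inversion_weak_step:
  fixes g :: "real \<times> 'y::euclidean_space \<Rightarrow> real" and k :: "'y \<Rightarrow> 'w::euclidean_space \<Rightarrow> 'a"
    and L :: "'x::euclidean_space \<Rightarrow> 'w \<Rightarrow> 'a \<Rightarrow> 'a" and a b d :: real
    and \<psi> :: "real \<Rightarrow> real" and \<psi>' :: "'x \<Rightarrow> real"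
  defines "\<theta> \<equiv> \<lambda>s t. 1 / (2 * b) * (a * s\<^sup>2 - 2 * s * t + d * t\<^sup>2 - pi / 2)"
  defines "H \<equiv> \<lambda>w. LBINT y. g y *\<^sub>R rot J (\<theta> (fst y) (fst w)) (k (snd y) (snd w))"
  defines "g' \<equiv> \<lambda>y. LBINT t. \<psi> t * g (t, y)"
  defines "H' \<equiv> \<lambda>w. LBINT y. g' y *\<^sub>R k y w"
  assumes b: "b \<noteq> 0" and g: "integrable lborel g" and H: "integrable lborel H"
    and k: "(\<lambda>p. k (fst p) (snd p)) \<in> borel_measurable borel" "\<And>y w. norm (k y w) \<le> C"
    and \<psi>: "continuous_on UNIV \<psi>" "integrable lborel \<psi>" "\<And>x::real. \<bar>\<psi> x\<bar> \<le> M"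
    and L: "(\<lambda>p. L (fst p) (fst (snd p)) (snd (snd p))) \<in> borel_measurable borel"
      "\<And>x w. bounded_linear (L x w)" "\<And>x w z. norm (L x w z) \<le> D * norm z"
    and \<psi>': "integrable lborel \<psi>'"
  shows LCT_inversion_weak_step_marginal: "integrable lborel g'"
    and LCT_inversion_weak_step_transform: "integrable lborel H'"
    and LCT_inversion_weak_step_eq: "(LBINT x. (\<psi> (fst x) * \<psi>' (snd x)) *\<^sub>R
        (LBINT w. L (snd x) (snd w) (rot J (- \<theta> (fst x) (fst w)) (H w)))) =
      (2 * pi * \<bar>b\<bar>) *\<^sub>R (LBINT x. \<psi>' x *\<^sub>R (LBINT w. L x w (H' w)))"
proof -
  define B where "B = 1 + onorm J"
  have B: "norm (rot J t v) \<le> B * norm v" "B \<ge> 0" for t v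
    using norm_rot_le onorm_pos_le[OF bounded_linear_axioms] by (auto simp: B_def)
  have C: "C \<ge> 0" using k(2) norm_ge_zero order.trans by blast
  have [measurable]: "\<psi> \<in> borel_measurable borel" "g \<in> borel_measurable borel" "H \<in> borel_measurable borel"
      "\<psi>' \<in> borel_measurable borel"
    using \<psi>(2) g H \<psi>' by auto
  have [measurable]: "(\<lambda>p. \<theta> (f p) (g p)) \<in> borel_measurable N"
    if [measurable]: "f \<in> borel_measurable N" "g \<in> borel_measurable N" for f g and N :: "'z measure"
    unfolding \<theta>_def by measurable
  have [measurable]: "(\<lambda>p. k (f p) (m p)) \<in> borel_measurable N"
    if [measurable]: "f \<in> borel_measurable N" "m \<in> borel_measurable N" for f m and N :: "'z measure"
    using measurable_compose[OF borel_measurable_Pair[OF that] k(1)] by simp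
  have [measurable]: "(\<lambda>p. L (f p) (m p) (z p)) \<in> borel_measurable N"
    if [measurable]: "f \<in> borel_measurable N" "m \<in> borel_measurable N" "z \<in> borel_measurable N" for f m z and N :: "'z measure"
    using measurable_compose[OF borel_measurable_Pair[OF that(1) borel_measurable_Pair[OF that(2,3)]] L(1)] by simp
  have M: "M \<ge> 0" using \<psi>(3)[of 0] by simp
  have gp: "integrable (lborel \<Otimes>\<^sub>M lborel) g" and Hp: "integrable (lborel \<Otimes>\<^sub>M lborel) H"
    using g H by (simp_all add: lborel_prod)
  have gn: "integrable (lborel \<Otimes>\<^sub>M lborel) (\<lambda>p. c * \<bar>g p\<bar>)" for c
    using gp by auto
  have \<psi>g: "integrable (lborel \<Otimes>\<^sub>M lborel) (\<lambda>(t, y). \<psi> t * g (t, y))"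
  proof (rule Bochner_Integration.integrable_bound[OF gn[of M]])
    show "AE p in lborel \<Otimes>\<^sub>M lborel. norm (case p of (t, y) \<Rightarrow> \<psi> t * g (t, y)) \<le> norm (M * \<bar>g p\<bar>)"
      using \<psi>(3) M by (intro AE_I2) (auto simp: abs_mult mult_right_mono)
  qed measurable
  show g': "integrable lborel g'"
    unfolding g'_def by (rule lborel_pair.integrable_snd[OF \<psi>g])
  then have [measurable]: "g' \<in> borel_measurable borel" by auto
  have [measurable]: "H' \<in> borel_measurable borel"
    unfolding H'_def by measurable
  have gk: "integrable (lborel \<Otimes>\<^sub>M lborel) (\<lambda>(t, y). g (t, y) *\<^sub>R k y w)" for w
  proof (rule Bochner_Integration.integrable_bound[OF gn[of C]])
    show "AE p in lborel \<Otimes>\<^sub>M lborel. norm (case p of (t, y) \<Rightarrow> g (t, y) *\<^sub>R k y w) \<le> norm (C * \<bar>g p\<bar>)"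
      using k(2) C by (intro AE_I2) (auto simp: abs_mult mult.commute[of "\<bar>g _\<bar>"] intro!: mult_right_mono)
  qed measurable
  \<comment> \<open>The vector-valued signal in the outer variable alone, with the inner kernel at
    frequency \<open>w\<close> already integrated.\<close>
  define h where "h = (\<lambda>w t. LBINT y. g (t, y) *\<^sub>R k y w)"
  have h: "integrable lborel (h w)" for w
    unfolding h_def by (rule lborel_pair.integrable_fst[OF gk])
  have K_eq: "(LBINT t. rot J (\<theta> t s) (h w t)) = H (s, w)" for s w
  proof -
    have "(LBINT t. rot J (\<theta> t s) (h w t)) = (LBINT t. LBINT y. g (t, y) *\<^sub>R rot J (\<theta> t s) (k y w))"
    proof (rule integral_cong_AE)
      show "AE t in lborel. rot J (\<theta> t s) (h w t) = (LBINT y. g (t, y) *\<^sub>R rot J (\<theta> t s) (k y w))"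
        using lborel_pair.AE_integrable_fst[OF gk[of w]]
      proof eventually_elim
        case (elim t)
        have "rot J (\<theta> t s) (g (t, y) *\<^sub>R k y w) = g (t, y) *\<^sub>R rot J (\<theta> t s) (k y w)" for y
          by (simp add: rot_def scaleR algebra_simps)
        with integral_rot[OF elim, of "\<theta> t s"] show ?case
          by (simp only: h_def)
      qed
    qed (unfold h_def, measurable)
    also have "\<dots> = H (s, w)"
    proof -
      have "integrable (lborel \<Otimes>\<^sub>M lborel) (\<lambda>(t, y). g (t, y) *\<^sub>R rot J (\<theta> t s) (k y w))"
      proof (rule Bochner_Integration.integrable_bound[OF gn[of "B * C"]])
        have "norm (rot J t (k y w)) \<le> B * C" for t y
          using order.trans[OF B(1) mult_left_mono[OF k(2) B(2)]] .
        then show "AE p in lborel \<Otimes>\<^sub>M lborel. norm (case p of (t, y) \<Rightarrow> g (t, y) *\<^sub>R rot J (\<theta> t s) (k y w)) \<le> norm (B * C * \<bar>g p\<bar>)"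
          using C B by (intro AE_I2) (auto simp: abs_mult mult.commute[of "B * C"] intro!: mult_left_mono)
      qed measurable
      from lborel_pair.integral_fst[OF this] show ?thesis
        unfolding H_def by (simp add: split_beta' lborel_prod)
    qed
    finally show ?thesis .
  qed
  have int_h: "(LBINT t. \<psi> t *\<^sub>R h w t) = H' w" for w
  proof -
    have *: "integrable (lborel \<Otimes>\<^sub>M lborel) (\<lambda>(t, y). (\<psi> t * g (t, y)) *\<^sub>R k y w)"
    proof (rule Bochner_Integration.integrable_bound[OF gn[of "M * C"]])
      show "AE p in lborel \<Otimes>\<^sub>M lborel. norm (case p of (t, y) \<Rightarrow> (\<psi> t * g (t, y)) *\<^sub>R k y w) \<le> norm (M * C * \<bar>g p\<bar>)"
      proof (intro AE_I2, clarify)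
        fix t y
        have "\<bar>\<psi> t\<bar> * norm (k y w) \<le> M * C"
          using \<psi>(3) k(2) M by (intro mult_mono) auto
        from mult_right_mono[OF this, of "\<bar>g (t, y)\<bar>"] show "norm ((\<psi> t * g (t, y)) *\<^sub>R k y w) \<le> norm (M * C * \<bar>g (t, y)\<bar>)"
          using M C by (simp add: abs_mult mult_ac)
      qed
    qed measurable
    have "(LBINT t. \<psi> t *\<^sub>R h w t) = (LBINT t. LBINT y. (\<psi> t * g (t, y)) *\<^sub>R k y w)"
      unfolding h_def scaleR_scaleR[symmetric] Bochner_Integration.integral_scaleR_right ..
    also have "\<dots> = (LBINT y. LBINT t. (\<psi> t * g (t, y)) *\<^sub>R k y w)"
      using lborel_pair.Fubini_integral[OF *] by simp
    also have "\<dots> = (LBINT y. g' y *\<^sub>R k y w)"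
    proof (rule integral_cong_AE)
      show "AE y in lborel. (LBINT t. (\<psi> t * g (t, y)) *\<^sub>R k y w) = g' y *\<^sub>R k y w"
        using lborel_pair.AE_integrable_snd[OF \<psi>g]
        by eventually_elim (simp add: g'_def)
    qed measurable
    finally show ?thesis by (simp add: H'_def)
  qed
  \<comment> \<open>Integrability of a slice is known only outside a null set of \<open>w\<close>,
    so the identities that rest on it are stated almost everywhere.\<close>
  have AEH: "AE w in lborel. integrable lborel (\<lambda>s. H (s, w))"
    using lborel_pair.AE_integrable_snd[of "\<lambda>s w. H (s, w)"] Hp by simp
  have inv: "AE w in lborel. (LBINT x. \<psi> x *\<^sub>R (LBINT s. rot J (- \<theta> x s) (H (s, w)))) = (2 * pi * \<bar>b\<bar>) *\<^sub>R H' w"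
    using AEH
  proof eventually_elim
    case (elim w)
    have "(LBINT x. \<psi> x *\<^sub>R (LBINT s. rot J (- \<theta> x s) (LBINT t. rot J (\<theta> t s) (h w t)))) = (2 * pi * \<bar>b\<bar>) *\<^sub>R (LBINT t. \<psi> t *\<^sub>R h w t)"
      unfolding \<theta>_def
    proof (rule LCT_inversion_weak_1D[OF b h _ \<psi>])
      show "integrable lborel (\<lambda>s. LBINT t. rot J (1 / (2 * b) * (a * t\<^sup>2 - 2 * t * s + d * s\<^sup>2 - pi / 2)) (h w t))"
        using elim K_eq[of _ w] unfolding \<theta>_def by simp
    qed
    then show ?case unfolding K_eq int_h .
  qed
  define N where "N = (\<lambda>w. LBINT s. norm (H (s, w)))"
  have N: "integrable lborel N"
    unfolding N_def using lborel_pair.integrable_snd[of "\<lambda>s w. norm (H (s, w))"] integrable_norm[OF Hp]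
    by (simp add: split_beta')
  then have [measurable]: "N \<in> borel_measurable borel" by auto
  have N0: "N w \<ge> 0" for w by (simp add: N_def)
  define R where "R = (\<lambda>x w. LBINT s. rot J (- \<theta> x s) (H (s, w)))"
  have [measurable]: "(\<lambda>p. R (fst p) (snd p)) \<in> borel_measurable (lborel \<Otimes>\<^sub>M lborel)"
    unfolding R_def by measurable
  \<comment> \<open>The bound is wanted for every \<open>w\<close>. A rotated slice is integrable
    exactly when the slice is, since rotations are invertible; otherwise \<open>R\<close> is 0 by
    the convention for the Bochner integral.\<close>
  have R_le: "norm (R x w) \<le> B * N w" for x w
  proof (cases "integrable lborel (\<lambda>s. rot J (- \<theta> x s) (H (s, w)))")
    case True
    have i: "integrable lborel (\<lambda>s. B * norm (H (s, w)))"
    proof -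
      have "integrable lborel (\<lambda>s. rot J (\<theta> x s) (rot J (- \<theta> x s) (H (s, w))))"
        by (rule integrable_rot[OF _ True]) measurable
      then show ?thesis by (simp add: rot_rot)
    qed
    have "norm (R x w) \<le> (LBINT s. B * norm (H (s, w)))"
      unfolding R_def using True i B(1) by (rule Bochner_Integration.integral_norm_bound_integral)
    then show ?thesis by (simp add: N_def)
  next
    case False
    then show ?thesis using N0 B(2) by (simp add: R_def not_integrable_integral_eq)
  qed
  have \<psi>R: "integrable (lborel \<Otimes>\<^sub>M lborel) (\<lambda>(x, w). \<psi> x *\<^sub>R R x w)"
  proof (rule Bochner_Integration.integrable_bound)
    show "integrable (lborel \<Otimes>\<^sub>M lborel) (\<lambda>p. \<bar>\<psi> (fst p)\<bar> * (B * N (snd p)))"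
      using \<psi>(2) N by (intro lborel_pair.integrable_times) auto
    show "AE p in lborel \<Otimes>\<^sub>M lborel. norm (case p of (x, w) \<Rightarrow> \<psi> x *\<^sub>R R x w) \<le> norm (\<bar>\<psi> (fst p)\<bar> * (B * N (snd p)))"
      using R_le N0 B(2) by (intro AE_I2) (auto simp: abs_mult intro!: mult_left_mono)
    show "(\<lambda>(x, w). \<psi> x *\<^sub>R R x w) \<in> borel_measurable (lborel \<Otimes>\<^sub>M lborel)"
      unfolding split_beta' by measurable
  qed
  \<comment> \<open>\<open>H'\<close> is, up to the nonzero constant and a null set, a partial
    integral of the jointly integrable function \<open>\<psi> x *\<^sub>R R x w\<close>; this is
    where its integrability is gained.\<close>
  have "integrable lborel (\<lambda>w. (2 * pi * \<bar>b\<bar>) *\<^sub>R H' w)"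
  proof (rule integrable_cong_AE_imp[OF lborel_pair.integrable_snd[OF \<psi>R]])
    show "AE w in lborel. (LBINT x. \<psi> x *\<^sub>R R x w) = (2 * pi * \<bar>b\<bar>) *\<^sub>R H' w"
      using inv by eventually_elim (simp add: R_def)
  qed measurable
  then have "integrable lborel (\<lambda>w. (1 / (2 * pi * \<bar>b\<bar>)) *\<^sub>R ((2 * pi * \<bar>b\<bar>) *\<^sub>R H' w))"
    by (rule integrable_scaleR_right)
  then show H': "integrable lborel H'"
    using b by simp
  have L_lin: "(LBINT s. L x w (f s)) = L x w (LBINT s. f s)" if "integrable lborel f" for x w and f :: "real \<Rightarrow> 'a"
    by (rule integral_bounded_linear[OF L(2) that])
  have D: "norm (L x w z) \<le> \<bar>D\<bar> * norm z" for x w z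
    using order.trans[OF L(3)] mult_right_mono[OF abs_ge_self norm_ge_zero] by blast
  have RL: "(LBINT w. L (snd x) (snd w) (rot J (- \<theta> (fst x) (fst w)) (H w))) = (LBINT w. L (snd x) w (R (fst x) w))" for x
  proof -
    have *: "integrable (lborel \<Otimes>\<^sub>M lborel) (\<lambda>(s, w). L (snd x) w (rot J (- \<theta> (fst x) s) (H (s, w))))"
    proof (rule Bochner_Integration.integrable_bound)
      show "integrable (lborel \<Otimes>\<^sub>M lborel) (\<lambda>p. (\<bar>D\<bar> * B) * norm (H p))"
        using Hp by auto
      have "norm (L x w (rot J t z)) \<le> \<bar>D\<bar> * B * norm z" for x w t z
        using order.trans[OF D mult_left_mono[OF B(1) abs_ge_zero]] by (simp add: mult_ac)
      then show "AE p in lborel \<Otimes>\<^sub>M lborel. norm (case p of (s, w) \<Rightarrow> L (snd x) w (rot J (- \<theta> (fst x) s) (H (s, w)))) \<le> norm ((\<bar>D\<bar> * B) * norm (H p))"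
        using B(2) by (intro AE_I2) auto
    qed measurable
    have "(LBINT w. L (snd x) (snd w) (rot J (- \<theta> (fst x) (fst w)) (H w))) = (LBINT w. LBINT s. L (snd x) w (rot J (- \<theta> (fst x) s) (H (s, w))))"
      using lborel_pair.integral_snd[OF *] by (simp add: split_beta' lborel_prod)
    also have "\<dots> = (LBINT w. L (snd x) w (R (fst x) w))"
    proof (rule integral_cong_AE)
      show "AE w in lborel. (LBINT s. L (snd x) w (rot J (- \<theta> (fst x) s) (H (s, w)))) = L (snd x) w (R (fst x) w)"
        using AEH
      proof eventually_elim
        case (elim w)
        show ?case unfolding R_def
          by (rule L_lin, rule integrable_rot[OF _ elim]) measurable
      qed
    qed (unfold R_def, measurable)
    finally show ?thesis .
  qed
  have outer: "integrable (lborel \<Otimes>\<^sub>M lborel) (\<lambda>(t, x). (\<psi> t * \<psi>' x) *\<^sub>R (LBINT w. L x w (R t w)))"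
  proof (rule Bochner_Integration.integrable_bound)
    let ?I = "LBINT w. \<bar>D\<bar> * (B * N w)"
    show "integrable (lborel \<Otimes>\<^sub>M lborel) (\<lambda>p. \<psi> (fst p) * (\<psi>' (snd p) * ?I))"
      using \<psi>(2) \<psi>' by (intro lborel_pair.integrable_times) auto
    have le: "norm (LBINT w. L x w (R t w)) \<le> ?I" for x t
    proof -
      have i: "integrable lborel (\<lambda>w. \<bar>D\<bar> * (B * N w))" using N by simp
      have *: "norm (L x w (R t w)) \<le> \<bar>D\<bar> * (B * N w)" for w
        by (rule order.trans[OF D mult_left_mono[OF R_le abs_ge_zero]])
      have "integrable lborel (\<lambda>w. L x w (R t w))"
      proof (rule Bochner_Integration.integrable_bound[OF i])
        show "(\<lambda>w. L x w (R t w)) \<in> borel_measurable lborel"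
          unfolding R_def by measurable
      qed (intro AE_I2 order.trans[OF *], simp)
      then show ?thesis using i * by (rule Bochner_Integration.integral_norm_bound_integral)
    qed
    show "AE p in lborel \<Otimes>\<^sub>M lborel. norm (case p of (t, x) \<Rightarrow> (\<psi> t * \<psi>' x) *\<^sub>R (LBINT w. L x w (R t w))) \<le> norm (\<psi> (fst p) * (\<psi>' (snd p) * ?I))"
    proof (intro AE_I2, clarify)
      fix t x
      show "norm ((\<psi> t * \<psi>' x) *\<^sub>R (LBINT w. L x w (R t w))) \<le> norm (\<psi> (fst (t, x)) * (\<psi>' (snd (t, x)) * ?I))"
        using mult_left_mono[OF order.trans[OF le abs_ge_self], of "\<bar>\<psi> t * \<psi>' x\<bar>" x t]
        by (simp add: abs_mult mult_ac)
    qed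
    show "(\<lambda>(t, x). (\<psi> t * \<psi>' x) *\<^sub>R (LBINT w. L x w (R t w))) \<in> borel_measurable (lborel \<Otimes>\<^sub>M lborel)"
      unfolding R_def split_beta' by measurable
  qed
  have "(LBINT x. (\<psi> (fst x) * \<psi>' (snd x)) *\<^sub>R (LBINT w. L (snd x) (snd w) (rot J (- \<theta> (fst x) (fst w)) (H w)))) =
     (LBINT x. LBINT t. (\<psi> t * \<psi>' x) *\<^sub>R (LBINT w. L x w (R t w)))"
    unfolding RL using lborel_pair.integral_snd[OF outer] by (simp add: split_beta' lborel_prod)
  also have "\<dots> = (LBINT x. \<psi>' x *\<^sub>R ((2 * pi * \<bar>b\<bar>) *\<^sub>R (LBINT w. L x w (H' w))))"
  proof (rule Bochner_Integration.integral_cong[OF refl])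
    fix x
    have *: "integrable (lborel \<Otimes>\<^sub>M lborel) (\<lambda>(t, w). L x w (\<psi> t *\<^sub>R R t w))"
    proof (rule Bochner_Integration.integrable_bound)
      show "integrable (lborel \<Otimes>\<^sub>M lborel) (\<lambda>p. \<bar>D\<bar> * norm (case p of (t, w) \<Rightarrow> \<psi> t *\<^sub>R R t w))"
        using \<psi>R by (intro integrable_mult_right integrable_norm)
      show "AE p in lborel \<Otimes>\<^sub>M lborel. norm (case p of (t, w) \<Rightarrow> L x w (\<psi> t *\<^sub>R R t w)) \<le> norm (\<bar>D\<bar> * norm (case p of (t, w) \<Rightarrow> \<psi> t *\<^sub>R R t w))"
        by (intro AE_I2, clarify) (rule order.trans[OF D], simp add: abs_mult)
      show "(\<lambda>(t, w). L x w (\<psi> t *\<^sub>R R t w)) \<in> borel_measurable (lborel \<Otimes>\<^sub>M lborel)"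
        unfolding R_def split_beta' by measurable
    qed
    have "(LBINT t. (\<psi> t * \<psi>' x) *\<^sub>R (LBINT w. L x w (R t w))) = \<psi>' x *\<^sub>R (LBINT t. LBINT w. L x w (\<psi> t *\<^sub>R R t w))"
    proof -
      have "(\<psi> t * \<psi>' x) *\<^sub>R (LBINT w. L x w (R t w)) = \<psi>' x *\<^sub>R (LBINT w. L x w (\<psi> t *\<^sub>R R t w))" for t
      proof -
        have "L x w (\<psi> t *\<^sub>R R t w) = \<psi> t *\<^sub>R L x w (R t w)" for w
          by (rule linear_scale[OF bounded_linear.linear[OF L(2)]])
        then show ?thesis by simp
      qed
      then show ?thesis by (simp only: Bochner_Integration.integral_scaleR_right)
    qed
    also have "(LBINT t. LBINT w. L x w (\<psi> t *\<^sub>R R t w)) = (LBINT w. LBINT t. L x w (\<psi> t *\<^sub>R R t w))"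
      using lborel_pair.Fubini_integral[OF *] by simp
    also have "\<dots> = (LBINT w. (2 * pi * \<bar>b\<bar>) *\<^sub>R L x w (H' w))"
    proof (rule integral_cong_AE)
      show "AE w in lborel. (LBINT t. L x w (\<psi> t *\<^sub>R R t w)) = (2 * pi * \<bar>b\<bar>) *\<^sub>R L x w (H' w)"
        using lborel_pair.AE_integrable_snd[OF \<psi>R] inv
      proof eventually_elim
        case (elim w)
        have "(LBINT t. L x w (\<psi> t *\<^sub>R R t w)) = L x w (LBINT t. \<psi> t *\<^sub>R R t w)"
          by (rule L_lin[OF elim(1)])
        also have "(LBINT t. \<psi> t *\<^sub>R R t w) = (2 * pi * \<bar>b\<bar>) *\<^sub>R H' w"
          using elim(2) by (simp only: R_def)
        finally show ?case
          by (simp only: linear_scale[OF bounded_linear.linear[OF L(2)]])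
      qed
    qed (unfold R_def, measurable)
    finally show "(LBINT t. (\<psi> t * \<psi>' x) *\<^sub>R (LBINT w. L x w (R t w))) = \<psi>' x *\<^sub>R ((2 * pi * \<bar>b\<bar>) *\<^sub>R (LBINT w. L x w (H' w)))"
      by simp
  qed
  also have "\<dots> = (2 * pi * \<bar>b\<bar>) *\<^sub>R (LBINT x. \<psi>' x *\<^sub>R (LBINT w. L x w (H' w)))"
    unfolding scaleR_left_commute[of _ "2 * pi * \<bar>b\<bar>"] Bochner_Integration.integral_scaleR_right ..
  finally show "(LBINT x. (\<psi> (fst x) * \<psi>' (snd x)) *\<^sub>R
        (LBINT w. L (snd x) (snd w) (rot J (- \<theta> (fst x) (fst w)) (H w)))) =
      (2 * pi * \<bar>b\<bar>) *\<^sub>R (LBINT x. \<psi>' x *\<^sub>R (LBINT w. L x w (H' w)))" .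
qed

end

text \<open>The outermost rotation is \<open>J3\<close>, so its variable is the first component of
  the nested pairs and is removed first. Two applications of the step lemma leave a signal in one
  variable with values in the line through \<open>v\<close>, to which the one-dimensional inversion
  applies. Fubini then reassembles the successive marginals into one integral of
  \<open>g\<close>.\<close>

lemma LCT_inversion_weak_3D:
  fixes g :: "real \<times> real \<times> real \<Rightarrow> real" and J1 J2 J3 :: "'a::{banach, second_countable_topology} \<Rightarrow> 'a"
    and a1 b1 d1 a2 b2 d2 a3 b3 d3 :: real and v :: 'a
    and \<psi>1 \<psi>2 \<psi>3 :: "real \<Rightarrow> real"
  defines "\<theta>1 \<equiv> \<lambda>s t. 1 / (2 * b1) * (a1 * s\<^sup>2 - 2 * s * t + d1 * t\<^sup>2 - pi / 2)"
  defines "\<theta>2 \<equiv> \<lambda>s t. 1 / (2 * b2) * (a2 * s\<^sup>2 - 2 * s * t + d2 * t\<^sup>2 - pi / 2)"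
  defines "\<theta>3 \<equiv> \<lambda>s t. 1 / (2 * b3) * (a3 * s\<^sup>2 - 2 * s * t + d3 * t\<^sup>2 - pi / 2)"
  defines "H \<equiv> \<lambda>w. LBINT y. g y *\<^sub>R rot J3 (\<theta>3 (fst y) (fst w)) (rot J2 (\<theta>2 (fst (snd y)) (fst (snd w)))
      (rot J1 (\<theta>1 (snd (snd y)) (snd (snd w))) v))"
  assumes J: "complex_structure J1" "complex_structure J2" "complex_structure J3"
    and b: "b1 \<noteq> 0" "b2 \<noteq> 0" "b3 \<noteq> 0" and g: "integrable lborel g" and H: "integrable lborel H"
    and \<psi>1: "continuous_on UNIV \<psi>1" "integrable lborel \<psi>1" "\<And>x. \<bar>\<psi>1 x\<bar> \<le> M"
    and \<psi>2: "continuous_on UNIV \<psi>2" "integrable lborel \<psi>2" "\<And>x. \<bar>\<psi>2 x\<bar> \<le> M"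
    and \<psi>3: "continuous_on UNIV \<psi>3" "integrable lborel \<psi>3" "\<And>x. \<bar>\<psi>3 x\<bar> \<le> M"
  shows "(LBINT x. (\<psi>3 (fst x) * (\<psi>2 (fst (snd x)) * \<psi>1 (snd (snd x)))) *\<^sub>R
      (LBINT w. rot J1 (- \<theta>1 (snd (snd x)) (snd (snd w))) (rot J2 (- \<theta>2 (fst (snd x)) (fst (snd w)))
        (rot J3 (- \<theta>3 (fst x) (fst w)) (H w))))) =
    ((2 * pi * \<bar>b3\<bar>) * (2 * pi * \<bar>b2\<bar>) * (2 * pi * \<bar>b1\<bar>) *
      (LBINT x. (\<psi>3 (fst x) * (\<psi>2 (fst (snd x)) * \<psi>1 (snd (snd x)))) * g x)) *\<^sub>R v"
proof -
  interpret J1: complex_structure J1 by fact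
  interpret J2: complex_structure J2 by fact
  interpret J3: complex_structure J3 by fact
  have [measurable]: "(\<lambda>p. \<theta>1 (f p) (g p)) \<in> borel_measurable N" "(\<lambda>p. \<theta>2 (f p) (g p)) \<in> borel_measurable N"
    if [measurable]: "f \<in> borel_measurable N" "g \<in> borel_measurable N" for f g and N :: "'z measure"
    unfolding \<theta>1_def \<theta>2_def by measurable
  have [measurable]: "\<psi>1 \<in> borel_measurable borel" "\<psi>2 \<in> borel_measurable borel"  "\<psi>3 \<in> borel_measurable borel"
    "g \<in> borel_measurable borel"
    using \<psi>1(2) \<psi>2(2) \<psi>3(2) g by auto
  let ?B1 = "1 + onorm J1" and ?B2 = "1 + onorm J2"
  have B: "?B1 \<ge> 0" "?B2 \<ge> 0"
    using onorm_pos_le[OF J1.bounded_linear_axioms] onorm_pos_le[OF J2.bounded_linear_axioms] by auto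
  have M: "M \<ge> 0" using \<psi>3(3)[of 0] by simp
  define g' where "g' = (\<lambda>y. LBINT t. \<psi>3 t * g (t, y))"
  define H' where "H' = (\<lambda>w. LBINT y. g' y *\<^sub>R rot J2 (\<theta>2 (fst y) (fst w)) (rot J1 (\<theta>1 (snd y) (snd w)) v))"
  define g'' where "g'' = (\<lambda>y. LBINT t. \<psi>2 t * g' (t, y))"
  define H'' where "H'' = (\<lambda>w. LBINT y. g'' y *\<^sub>R rot J1 (\<theta>1 y w) v)"
  have \<theta>2_eq: "\<theta>2 s t = 1 / (2 * b2) * (a2 * s\<^sup>2 - 2 * s * t + d2 * t\<^sup>2 - pi / 2)"
    and \<theta>3_eq: "\<theta>3 s t = 1 / (2 * b3) * (a3 * s\<^sup>2 - 2 * s * t + d3 * t\<^sup>2 - pi / 2)" for s t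
    by (simp_all add: \<theta>2_def \<theta>3_def)
  note g'_eq = fun_cong[OF g'_def] and H_eq = fun_cong[OF meta_eq_to_obj_eq[OF H_def]]
    and H'_eq = fun_cong[OF H'_def] and g''_eq = fun_cong[OF g''_def] and H''_eq = fun_cong[OF H''_def]
  note step3 = J3.LCT_inversion_weak_step[where a = a3 and b = b3 and d = d3 and g = g and \<psi> = \<psi>3 and M = M
      and C = "?B2 * (?B1 * norm v)" and D = "?B1 * ?B2" and \<psi>' = "\<lambda>x. \<psi>2 (fst x) * \<psi>1 (snd x)"
      and k = "\<lambda>y w. rot J2 (\<theta>2 (fst y) (fst w)) (rot J1 (\<theta>1 (snd y) (snd w)) v)"
      and L = "\<lambda>x w z. rot J1 (- \<theta>1 (snd x) (snd w)) (rot J2 (- \<theta>2 (fst x) (fst w)) z)",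
      OF b(3) g, folded \<theta>3_eq, folded g'_eq, folded H_eq H'_eq, OF H]
  have p3: "integrable lborel (\<lambda>x. \<psi>2 (fst x) * \<psi>1 (snd x))"
    using lborel_pair.integrable_times[OF \<psi>2(2) \<psi>1(2)] by (simp add: lborel_prod)
  have k3: "norm (rot J2 s (rot J1 t v)) \<le> ?B2 * (?B1 * norm v)" for s t
    by (intro J2.norm_rot_le_imp J1.norm_rot_le)
  have L3: "norm (rot J1 s (rot J2 t z)) \<le> ?B1 * ?B2 * norm z" for s t z
    using J1.norm_rot_le_imp[OF J2.norm_rot_le, of s t z] by (simp add: mult.assoc)
  have l3: "bounded_linear (\<lambda>z. rot J1 s (rot J2 t z))" for s t
    using J1.bounded_linear_rot J2.bounded_linear_rot by (rule bounded_linear_compose)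
  have m3: "(\<lambda>p. rot J2 (\<theta>2 (fst (fst p)) (fst (snd p))) (rot J1 (\<theta>1 (snd (fst p)) (snd (snd p))) v)) \<in> borel_measurable borel"
    unfolding borel_prod[symmetric] by measurable
  have n3: "(\<lambda>p. rot J1 (- \<theta>1 (snd (fst p)) (snd (fst (snd p)))) (rot J2 (- \<theta>2 (fst (fst p)) (fst (fst (snd p)))) (snd (snd p)))) \<in> borel_measurable borel"
    unfolding borel_prod[symmetric] by measurable
  have g': "integrable lborel g'" and H': "integrable lborel H'"
    and eq3: "(LBINT x. (\<psi>3 (fst x) * (\<psi>2 (fst (snd x)) * \<psi>1 (snd (snd x)))) *\<^sub>R
      (LBINT w. rot J1 (- \<theta>1 (snd (snd x)) (snd (snd w))) (rot J2 (- \<theta>2 (fst (snd x)) (fst (snd w)))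
        (rot J3 (- \<theta>3 (fst x) (fst w)) (H w))))) =
      (2 * pi * \<bar>b3\<bar>) *\<^sub>R (LBINT x. (\<psi>2 (fst x) * \<psi>1 (snd x)) *\<^sub>R
       (LBINT w. rot J1 (- \<theta>1 (snd x) (snd w)) (rot J2 (- \<theta>2 (fst x) (fst w)) (H' w))))"
    by (rule step3[OF m3 k3 \<psi>3 n3 l3 L3 p3])+
  note step2 = J2.LCT_inversion_weak_step[where a = a2 and b = b2 and d = d2 and g = g' and \<psi> = \<psi>2 and M = M
      and C = "?B1 * norm v" and D = ?B1 and \<psi>' = \<psi>1
      and k = "\<lambda>y w. rot J1 (\<theta>1 y w) v"
      and L = "\<lambda>x w z. rot J1 (- \<theta>1 x w) z",
      OF b(2) g', folded \<theta>2_eq, folded g''_eq, folded H'_eq H''_eq, OF H']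
  have m2: "(\<lambda>p. rot J1 (\<theta>1 (fst p) (snd p)) v) \<in> borel_measurable borel"
    unfolding borel_prod[symmetric] by measurable
  have n2: "(\<lambda>p. rot J1 (- \<theta>1 (fst p) (fst (snd p))) (snd (snd p))) \<in> borel_measurable borel"
    unfolding borel_prod[symmetric] by measurable
  have g'': "integrable lborel g''" and H'': "integrable lborel H''"
    and eq2: "(LBINT x. (\<psi>2 (fst x) * \<psi>1 (snd x)) *\<^sub>R
       (LBINT w. rot J1 (- \<theta>1 (snd x) (snd w)) (rot J2 (- \<theta>2 (fst x) (fst w)) (H' w)))) =
       (2 * pi * \<bar>b2\<bar>) *\<^sub>R (LBINT x. \<psi>1 x *\<^sub>R (LBINT w. rot J1 (- \<theta>1 x w) (H'' w)))"
    by (rule step2[OF m2 J1.norm_rot_le \<psi>2 n2 J1.bounded_linear_rot J1.norm_rot_le \<psi>1(2)])+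
  have H''_alt: "H'' = (\<lambda>w. LBINT y. rot J1 (\<theta>1 y w) (g'' y *\<^sub>R v))"
    unfolding H''_def by (simp add: rot_def J1.scaleR algebra_simps)
  have eq1: "(LBINT x. \<psi>1 x *\<^sub>R (LBINT w. rot J1 (- \<theta>1 x w) (H'' w))) = (2 * pi * \<bar>b1\<bar>) *\<^sub>R (LBINT x. \<psi>1 x *\<^sub>R (g'' x *\<^sub>R v))"
  proof -
    have "\<theta>1 s t = 1 / (2 * b1) * (a1 * s\<^sup>2 - 2 * s * t + d1 * t\<^sup>2 - pi / 2)" for s t
      by (simp add: \<theta>1_def)
    from J1.LCT_inversion_weak_1D[where a = a1 and b = b1 and d = d1 and h = "\<lambda>y. g'' y *\<^sub>R v",
        OF b(1), folded this, folded fun_cong[OF H''_alt], OF _ _ \<psi>1]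
    show ?thesis using g'' H'' by simp
  qed
  have "(LBINT x. \<psi>1 x *\<^sub>R (g'' x *\<^sub>R v)) = (LBINT x. \<psi>1 x * g'' x) *\<^sub>R v"
  proof -
    have "integrable lborel (\<lambda>x. \<psi>1 x * g'' x)"
    proof (rule Bochner_Integration.integrable_bound)
      show "integrable lborel (\<lambda>x. M * g'' x)" using g'' by simp
      show "AE x in lborel. norm (\<psi>1 x * g'' x) \<le> norm (M * g'' x)"
        using \<psi>1(3) M by (intro AE_I2) (auto simp: abs_mult intro!: mult_right_mono)
      show "(\<lambda>x. \<psi>1 x * g'' x) \<in> borel_measurable lborel"
        using g'' by measurable
    qed
    then show ?thesis by simp
  qed
  also have "(LBINT x. \<psi>1 x * g'' x) = (LBINT x. (\<psi>2 (fst x) * \<psi>1 (snd x)) * g' x)"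
  proof -
    have [measurable]: "g' \<in> borel_measurable borel" using g' by auto
    have "integrable (lborel \<Otimes>\<^sub>M lborel) (\<lambda>(t, y). (\<psi>2 t * \<psi>1 y) * g' (t, y))"
    proof (rule Bochner_Integration.integrable_bound)
      show "integrable (lborel \<Otimes>\<^sub>M lborel) (\<lambda>p. M * M * g' p)"
        using g' by (simp add: lborel_prod)
      show "AE p in lborel \<Otimes>\<^sub>M lborel. norm (case p of (t, y) \<Rightarrow> (\<psi>2 t * \<psi>1 y) * g' (t, y)) \<le> norm (M * M * g' p)"
        using \<psi>2(3) \<psi>1(3) M by (intro AE_I2) (auto simp: abs_mult intro!: mult_right_mono mult_mono)
    qed measurable
    from lborel_pair.integral_snd[OF this]
    have "(LBINT x. (\<psi>2 (fst x) * \<psi>1 (snd x)) * g' x) = (LBINT y. LBINT t. \<psi>1 y * (\<psi>2 t * g' (t, y)))"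
      by (simp add: split_beta' lborel_prod mult_ac)
    then show ?thesis by (simp add: g''_def)
  qed
  also have "\<dots> = (LBINT x. (\<psi>3 (fst x) * (\<psi>2 (fst (snd x)) * \<psi>1 (snd (snd x)))) * g x)"
  proof -
    have "integrable (lborel \<Otimes>\<^sub>M lborel) (\<lambda>(t, y). (\<psi>3 t * (\<psi>2 (fst y) * \<psi>1 (snd y))) * g (t, y))"
    proof (rule Bochner_Integration.integrable_bound)
      show "integrable (lborel \<Otimes>\<^sub>M lborel) (\<lambda>p. M * (M * M) * g p)"
        using g by (simp add: lborel_prod)
      show "AE p in lborel \<Otimes>\<^sub>M lborel. norm (case p of (t, y) \<Rightarrow> (\<psi>3 t * (\<psi>2 (fst y) * \<psi>1 (snd y))) * g (t, y)) \<le> norm (M * (M * M) * g p)"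
        using \<psi>3(3) \<psi>2(3) \<psi>1(3) M by (intro AE_I2) (auto simp: abs_mult intro!: mult_right_mono mult_mono)
      have [measurable]: "(\<lambda>y. \<psi>2 (fst y) * \<psi>1 (snd y)) \<in> borel_measurable borel"
        unfolding borel_prod[symmetric] by measurable
      have [measurable]: "g \<in> borel_measurable (lborel \<Otimes>\<^sub>M lborel)"
        by (simp add: lborel_prod)
      show "(\<lambda>(t, y). (\<psi>3 t * (\<psi>2 (fst y) * \<psi>1 (snd y))) * g (t, y)) \<in> borel_measurable (lborel \<Otimes>\<^sub>M lborel)"
        unfolding split_beta' prod.collapse by measurable
    qed
    from lborel_pair.integral_snd[OF this]
    have "(LBINT x. (\<psi>3 (fst x) * (\<psi>2 (fst (snd x)) * \<psi>1 (snd (snd x)))) * g x) =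
      (LBINT y. LBINT t. (\<psi>2 (fst y) * \<psi>1 (snd y)) * (\<psi>3 t * g (t, y)))"
      by (simp add: split_beta' lborel_prod mult_ac)
    then show ?thesis by (simp add: g'_def)
  qed
  finally show ?thesis
    unfolding eq3 eq2 eq1 by simp
qed

text \<open>The order is reversed because the rotation belonging to the third coordinate is the
  outermost one and has to be the first component of the nested pair.\<close>

definition vec3_of :: "real \<times> real \<times> real \<Rightarrow> real^3" where
  "vec3_of p = vector [snd (snd p), fst (snd p), fst p]"

lemma vec3_of_nth [simp]:
  "vec3_of p $ 1 = snd (snd p)" "vec3_of p $ 2 = fst (snd p)" "vec3_of p $ 3 = fst p"
  by (simp_all add: vec3_of_def)

lemma borel_measurable_vec3_of [measurable]: "vec3_of \<in> borel_measurable borel"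
proof (intro borel_measurable_continuous_onI)
  have "continuous_on UNIV (\<lambda>p. vec3_of p $ i)" for i :: 3
    using exhaust_3[of i]
    by (elim disjE) (simp_all add: continuous_on_fst continuous_on_snd continuous_on_id)
  then show "continuous_on UNIV vec3_of"
    unfolding continuous_on_componentwise[of _ vec3_of] Basis_vec_def
    by (auto simp: inner_axis)
qed

text \<open>Lebesgue measure is determined by the volumes of boxes, and the preimage of a box is a
  product of three intervals.\<close>

lemma lborel_distr_vec3_of: "distr lborel borel vec3_of = (lborel :: (real^3) measure)"
proof (rule lborel_eqI[symmetric])
  fix l u :: "real^3"
  assume lu: "\<And>b. b \<in> Basis \<Longrightarrow> l \<bullet> b \<le> u \<bullet> b"
  have "l \<bullet> axis i 1 \<le> u \<bullet> axis i 1" for i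
    by (rule lu) (auto simp: Basis_vec_def)
  then have le: "l $ i \<le> u $ i" for i by (simp add: inner_axis)
  have "vec3_of -` box l u = {l$3<..<u$3} \<times> ({l$2<..<u$2} \<times> {l$1<..<u$1})"
    by (auto simp: box_def Basis_vec_def inner_axis forall_3)
  then have "emeasure (distr lborel borel vec3_of) (box l u) =
    emeasure (lborel \<Otimes>\<^sub>M (lborel :: (real \<times> real) measure)) ({l$3<..<u$3} \<times> ({l$2<..<u$2} \<times> {l$1<..<u$1}))"
    by (subst emeasure_distr) (auto simp: lborel_prod)
  also have "\<dots> = ennreal (u$3 - l$3) * (ennreal (u$2 - l$2) * ennreal (u$1 - l$1))"
  proof -
    have "emeasure lborel ({l$2<..<u$2} \<times> {l$1<..<u$1}) = ennreal (u$2 - l$2) * ennreal (u$1 - l$1)"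
      using le by (simp add: lborel_prod[symmetric] lborel.emeasure_pair_measure_Times)
    then show ?thesis
      using le by (subst lborel.emeasure_pair_measure_Times) (auto simp: borel_prod[symmetric])
  qed
  also have "\<dots> = ennreal ((u$3 - l$3) * ((u$2 - l$2) * (u$1 - l$1)))"
    using le by (simp add: ennreal_mult)
  also have "(u$3 - l$3) * ((u$2 - l$2) * (u$1 - l$1)) = (\<Prod>b\<in>Basis. (u - l) \<bullet> b)"
  proof -
    have "(\<Prod>b\<in>Basis. (u - l) \<bullet> b) = (\<Prod>i\<in>UNIV. (u - l) $ i)"
    proof -
      have B: "(Basis :: (real^3) set) = range (\<lambda>i. axis i 1)" by (auto simp: Basis_vec_def)
      have inj: "inj (\<lambda>i::3. axis i (1::real))" by (auto simp: inj_def axis_eq_axis)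
      show ?thesis unfolding B prod.reindex[OF inj] by (simp add: inner_axis)
    qed
    also have "\<dots> = (u$3 - l$3) * ((u$2 - l$2) * (u$1 - l$1))"
      unfolding UNIV_3 by simp
    finally show ?thesis by (rule sym)
  qed
  finally show "emeasure (distr lborel borel vec3_of) (box l u) = ennreal (\<Prod>b\<in>Basis. (u - l) \<bullet> b)" .
qed simp

lemma integrable_vec3_of_iff:
  fixes f :: "real^3 \<Rightarrow> 'b::{banach, second_countable_topology}"
  assumes "f \<in> borel_measurable borel"
  shows "integrable lborel (\<lambda>p. f (vec3_of p)) \<longleftrightarrow> integrable lborel f"
  using integrable_distr_eq[of vec3_of lborel borel f] assms by (simp add: lborel_distr_vec3_of)

lemma integral_vec3_of:
  fixes f :: "real^3 \<Rightarrow> 'b::{banach, second_countable_topology}"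
  assumes "f \<in> borel_measurable borel"
  shows "(LBINT p. f (vec3_of p)) = (LBINT x. f x)"
  using integral_distr[of vec3_of lborel borel f] assms by (simp add: lborel_distr_vec3_of)

section \<open>The octonion kernel and pointwise inversion\<close>

lemma borel_measurable_nth [measurable (raw)]:
  fixes f :: "'z \<Rightarrow> real^'n"
  assumes "f \<in> borel_measurable M"
  shows "(\<lambda>x. f x $ i) \<in> borel_measurable M"
  using measurable_compose[OF assms, of "\<lambda>x. x $ i" borel]
  by (simp add: borel_measurable_continuous_onI continuous_on_component)

definition rmul :: "oct \<Rightarrow> oct \<Rightarrow> oct" where
  "rmul \<mu> z = z \<odot> \<mu>"

lemma bounded_linear_rmul: "bounded_linear (rmul \<mu>)"
proof -
  obtain a b c d a' b' c' d' where \<mu>: "\<mu> = ((a, b, c, d), (a', b', c', d'))"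
    by (metis prod.exhaust)
  have "linear (rmul \<mu>)"
    by (rule linearI) (auto simp: \<mu> rmul_def algebra_simps)
  then show ?thesis by (simp add: linear_conv_bounded_linear)
qed

text \<open>This is right alternativity, \<open>(z \<odot> \<mu>) \<odot> \<mu> = z \<odot> (\<mu>
  \<odot> \<mu>)\<close>, for the three units of the kernels, checked in coordinates.\<close>

lemma complex_structure_rmul:
  "complex_structure (rmul mu1)" "complex_structure (rmul mu2)" "complex_structure (rmul mu4)"
proof -
  have "rmul \<mu> (rmul \<mu> z) = - z" if "\<mu> = mu1 \<or> \<mu> = mu2 \<or> \<mu> = mu4" for \<mu> z
  proof -
    obtain p q r s p' q' r' s' where "z = ((p, q, r, s), (p', q', r', s'))"
      by (metis prod.exhaust)
    with that show ?thesis
      by (auto simp: rmul_def mu1_def mu2_def mu4_def)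
  qed
  then show "complex_structure (rmul mu1)" "complex_structure (rmul mu2)" "complex_structure (rmul mu4)"
    by (auto simp: complex_structure_def complex_structure_axioms_def bounded_linear_rmul)
qed

lemmas rmul_rot_le_imp = complex_structure_rmul[THEN complex_structure.norm_rot_le_imp]
  and rmul_rot_le = complex_structure_rmul[THEN complex_structure.norm_rot_le]
  and bounded_linear_rmul_rot = complex_structure_rmul[THEN complex_structure.bounded_linear_rot]
  and tendsto_rmul_rot = complex_structure_rmul[THEN complex_structure.tendsto_rot]

lemmas borel_measurable_rmul_rot [measurable (raw)] =
  complex_structure_rmul[THEN complex_structure.borel_measurable_rot]

lemma rot_rmul_scaleR: "rot (rmul \<mu>) t (c *\<^sub>R z) = c *\<^sub>R rot (rmul \<mu>) t z"
  by (simp add: rot_def linear_scale[OF bounded_linear.linear[OF bounded_linear_rmul]] algebra_simps)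

definition lct_phase :: "real^2^2 \<Rightarrow> real \<Rightarrow> real \<Rightarrow> real" where
  "lct_phase A s t = 1 / (2 * A $ 1 $ 2) * (A $ 1 $ 1 * s\<^sup>2 - 2 * s * t + A $ 2 $ 2 * t\<^sup>2 - pi / 2)"

text \<open>The constant of the one-dimensional weak inversion. A kernel and its inverse kernel
  carry one factor \<open>1 / sqrt (lct_scale A)\<close> each, and together they cancel it.\<close>

definition lct_scale :: "real^2^2 \<Rightarrow> real" where
  "lct_scale A = 2 * pi * \<bar>A $ 1 $ 2\<bar>"

lemma borel_measurable_lct_phase [measurable (raw)]:
  assumes [measurable]: "f \<in> borel_measurable M" "g \<in> borel_measurable M"
  shows "(\<lambda>p. lct_phase A (f p) (g p)) \<in> borel_measurable M"
  unfolding lct_phase_def by measurable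

lemma rmul_scaleR_left: "rmul (c *\<^sub>R \<mu>) z = c *\<^sub>R rmul \<mu> z"
proof -
  obtain p q r s p' q' r' s' where "z = ((p, q, r, s), (p', q', r', s'))"
    by (metis prod.exhaust)
  moreover obtain a b c d a' b' c' d' where "\<mu> = ((a, b, c, d), (a', b', c', d'))"
    by (metis prod.exhaust)
  ultimately show ?thesis by (simp add: rmul_def algebra_simps)
qed

lemma rmul_add_left: "rmul (\<mu> + \<nu>) z = rmul \<mu> z + rmul \<nu> z"
proof -
  obtain p q r s p' q' r' s' where "z = ((p, q, r, s), (p', q', r', s'))"
    by (metis prod.exhaust)
  moreover obtain a b c d a' b' c' d' where "\<mu> = ((a, b, c, d), (a', b', c', d'))"
    by (metis prod.exhaust)
  moreover obtain e f g h e' f' g' h' where "\<nu> = ((e, f, g, h), (e', f', g', h'))"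
    by (metis prod.exhaust)
  ultimately show ?thesis by (simp add: rmul_def algebra_simps)
qed

lemma omul_oexp: "z \<odot> (c *\<^sub>R oexp \<mu> \<theta>) = c *\<^sub>R rot (rmul \<mu>) \<theta> z"
  unfolding rmul_def[symmetric] rmul_scaleR_left oexp_def rmul_add_left
  by (simp add: rot_def) (simp add: rmul_def oreal_omul)

lemma lct_kernel_eq:
  "lct_kernel \<mu> A s t = (1 / sqrt (lct_scale A)) *\<^sub>R oexp \<mu> (lct_phase A s t)"
  by (simp add: lct_kernel_def lct_phase_def lct_scale_def Let_def)

text \<open>Passing to the inverse matrix exchanges the diagonal entries, which matches the exchange
  of the two arguments, and negates \<open>b\<close>, which flips the sign of the whole phase,
  including the term in \<open>pi\<close>.\<close>

lemma lct_kernel_inv_eq: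
  "lct_kernel \<mu> (lct_inv A) t s = (1 / sqrt (lct_scale A)) *\<^sub>R oexp \<mu> (- lct_phase A s t)"
  by (simp add: lct_kernel_def lct_phase_def lct_inv_def lct_scale_def Let_def vector_2 algebra_simps add_divide_distrib diff_divide_distrib)

definition oct_kernel :: "real^2^2 \<Rightarrow> real^2^2 \<Rightarrow> real^2^2 \<Rightarrow> real^3 \<Rightarrow> real^3 \<Rightarrow> oct" where
  "oct_kernel A1 A2 A3 x w = rot (rmul mu4) (lct_phase A3 (x $ 3) (w $ 3))
     (rot (rmul mu2) (lct_phase A2 (x $ 2) (w $ 2)) (rot (rmul mu1) (lct_phase A1 (x $ 1) (w $ 1)) (oreal 1)))"

text \<open>This is a map rather than an octonion: without associativity, successive right
  multiplications need not be multiplication by a single octonion. The rotations occur in the order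
  opposite to that in \<open>oct_kernel\<close>.\<close>

definition oct_unkernel :: "real^2^2 \<Rightarrow> real^2^2 \<Rightarrow> real^2^2 \<Rightarrow> real^3 \<Rightarrow> real^3 \<Rightarrow> oct \<Rightarrow> oct" where
  "oct_unkernel A1 A2 A3 x w z = rot (rmul mu1) (- lct_phase A1 (x $ 1) (w $ 1))
     (rot (rmul mu2) (- lct_phase A2 (x $ 2) (w $ 2)) (rot (rmul mu4) (- lct_phase A3 (x $ 3) (w $ 3)) z))"

definition oct_transform :: "real^2^2 \<Rightarrow> real^2^2 \<Rightarrow> real^2^2 \<Rightarrow> (real^3 \<Rightarrow> real) \<Rightarrow> real^3 \<Rightarrow> oct" where
  "oct_transform A1 A2 A3 g w = (LBINT y. g y *\<^sub>R oct_kernel A1 A2 A3 y w)"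

lemma borel_measurable_oct_kernel [measurable (raw)]:
  assumes [measurable]: "f \<in> borel_measurable M" "g \<in> borel_measurable M"
  shows "(\<lambda>p. oct_kernel A1 A2 A3 (f p) (g p)) \<in> borel_measurable M"
  unfolding oct_kernel_def by measurable

lemma borel_measurable_oct_unkernel [measurable (raw)]:
  assumes [measurable]: "f \<in> borel_measurable M" "g \<in> borel_measurable M" "h \<in> borel_measurable M"
  shows "(\<lambda>p. oct_unkernel A1 A2 A3 (f p) (g p) (h p)) \<in> borel_measurable M"
  unfolding oct_unkernel_def by measurable

definition rot_bound :: real where
  "rot_bound = (1 + onorm (rmul mu1)) * ((1 + onorm (rmul mu2)) * (1 + onorm (rmul mu4)))"

lemma rot_bound_pos: "rot_bound > 0"
proof -
  have "0 < 1 + onorm (rmul \<mu>)" for \<mu>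
    using onorm_pos_le[OF bounded_linear_rmul, of \<mu>] by simp
  then show ?thesis by (simp add: rot_bound_def)
qed

lemma norm_oct_unkernel_le: "norm (oct_unkernel A1 A2 A3 x w z) \<le> rot_bound * norm z"
proof -
  have "norm (oct_unkernel A1 A2 A3 x w z) \<le> (1 + onorm (rmul mu1)) * ((1 + onorm (rmul mu2)) * ((1 + onorm (rmul mu4)) * norm z))"
    unfolding oct_unkernel_def by (intro rmul_rot_le_imp rmul_rot_le)
  then show ?thesis by (simp add: rot_bound_def mult.assoc)
qed

text \<open>The eight coordinates are all the products that take one of cosine and sine from each
  phase, so the sum of their squares factors into three sums equal to 1.\<close>

lemma norm_oct_kernel: "norm (oct_kernel A1 A2 A3 x w) = 1"
proof -
  define c1 s1 c2 s2 c3 s3 where d: "c1 = cos (lct_phase A1 (x $ 1) (w $ 1))" "s1 = sin (lct_phase A1 (x $ 1) (w $ 1))"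
    "c2 = cos (lct_phase A2 (x $ 2) (w $ 2))" "s2 = sin (lct_phase A2 (x $ 2) (w $ 2))"
    "c3 = cos (lct_phase A3 (x $ 3) (w $ 3))" "s3 = sin (lct_phase A3 (x $ 3) (w $ 3))"
  have e: "oct_kernel A1 A2 A3 x w = ((c3 * c2 * c1, c3 * c2 * s1, c3 * s2 * c1, c3 * s2 * s1), (s3 * c2 * c1, s3 * c2 * s1, s3 * s2 * c1, s3 * s2 * s1))"
    by (simp add: oct_kernel_def rot_def rmul_def mu1_def mu2_def mu4_def oreal_def d[symmetric])
  have one: "c1\<^sup>2 + s1\<^sup>2 = 1" "c2\<^sup>2 + s2\<^sup>2 = 1" "c3\<^sup>2 + s3\<^sup>2 = 1"
    by (simp_all add: d)
  have "(norm (oct_kernel A1 A2 A3 x w))\<^sup>2 = (c3\<^sup>2 + s3\<^sup>2) * ((c2\<^sup>2 + s2\<^sup>2) * (c1\<^sup>2 + s1\<^sup>2))"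
    unfolding e norm_Pair by (simp add: power_mult_distrib algebra_simps)
  then have "(norm (oct_kernel A1 A2 A3 x w))\<^sup>2 = 1" unfolding one by simp
  then show ?thesis by (simp add: power2_eq_1_iff) (smt (verit) norm_ge_zero)
qed

lemma bounded_linear_oct_unkernel: "bounded_linear (oct_unkernel A1 A2 A3 x w)"
  unfolding oct_unkernel_def
  by (intro bounded_linear_rmul_rot(3) bounded_linear_compose[OF bounded_linear_rmul_rot(1)] bounded_linear_compose[OF bounded_linear_rmul_rot(2)])

lemma olct_kernel_product:
  "(c *\<^sub>R lct_kernel mu1 A1 (x $ 1) (w $ 1)) \<odot> lct_kernel mu2 A2 (x $ 2) (w $ 2) \<odot> lct_kernel mu4 A3 (x $ 3) (w $ 3) =
   (1 / sqrt (lct_scale A1 * lct_scale A2 * lct_scale A3)) *\<^sub>R (c *\<^sub>R oct_kernel A1 A2 A3 x w)"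
proof -
  have "oreal (cos t) = cos t *\<^sub>R oreal 1" for t
    by (simp add: oreal_def)
  then have "oexp mu1 t = rot (rmul mu1) t (oreal 1)" for t
    by (simp add: oexp_def rot_def rmul_def oreal_omul)
  then show ?thesis
    unfolding lct_kernel_eq omul_oexp oct_kernel_def
    by (simp add: rot_rmul_scaleR real_sqrt_mult mult_ac)
qed

lemma stolct_inv_kernel_product:
  "z \<odot> lct_kernel mu4 (lct_inv A3) (w $ 3) (x $ 3) \<odot> lct_kernel mu2 (lct_inv A2) (w $ 2) (x $ 2)
     \<odot> lct_kernel mu1 (lct_inv A1) (w $ 1) (x $ 1) =
   (1 / sqrt (lct_scale A1 * lct_scale A2 * lct_scale A3)) *\<^sub>R oct_unkernel A1 A2 A3 x w z"
  unfolding lct_kernel_inv_eq omul_oexp oct_unkernel_def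
  by (simp add: rot_rmul_scaleR real_sqrt_mult)

lemma integrable_scaleR_oct_kernel:
  assumes g: "integrable lborel g"
  shows "integrable lborel (\<lambda>y. g y *\<^sub>R oct_kernel A1 A2 A3 y w)"
proof (rule Bochner_Integration.integrable_bound[OF g])
  show "(\<lambda>y. g y *\<^sub>R oct_kernel A1 A2 A3 y w) \<in> borel_measurable lborel"
    using g by measurable
qed (simp add: norm_oct_kernel)

lemma borel_measurable_oct_transform [measurable]:
  assumes [measurable]: "g \<in> borel_measurable borel"
  shows "oct_transform A1 A2 A3 g \<in> borel_measurable borel"
  unfolding oct_transform_def by measurable

lemma integrable_oct_unkernel:
  assumes H: "integrable lborel H"
  shows "integrable lborel (\<lambda>w. oct_unkernel A1 A2 A3 x w (H w))"
proof (rule Bochner_Integration.integrable_bound)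
  show "integrable lborel (\<lambda>w. rot_bound * norm (H w))" using H by simp
  show "(\<lambda>w. oct_unkernel A1 A2 A3 x w (H w)) \<in> borel_measurable lborel"
    using H by measurable
  show "AE w in lborel. norm (oct_unkernel A1 A2 A3 x w (H w)) \<le> norm (rot_bound * norm (H w))"
    by (intro AE_I2 order.trans[OF norm_oct_unkernel_le]) simp
qed

text \<open>The kernel is continuous in \<open>x\<close> and bounded uniformly, so dominated
  convergence applies. This continuity turns the weak inversion into a pointwise one.\<close>

lemma isCont_integral_oct_unkernel:
  assumes H: "integrable lborel H"
  shows "isCont (\<lambda>x. LBINT w. oct_unkernel A1 A2 A3 x w (H w)) x"
  unfolding continuous_at_sequentially comp_def
proof (intro allI impI)
  fix u assume u: "u \<longlonglongrightarrow> x"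
  have [measurable]: "H \<in> borel_measurable borel" using H by auto
  show "(\<lambda>n. LBINT w. oct_unkernel A1 A2 A3 (u n) w (H w)) \<longlonglongrightarrow> (LBINT w. oct_unkernel A1 A2 A3 x w (H w))"
  proof (rule integral_dominated_convergence)
    show "integrable lborel (\<lambda>w. rot_bound * norm (H w))" using H by simp
    have "(\<lambda>n. oct_unkernel A1 A2 A3 (u n) w (H w)) \<longlonglongrightarrow> oct_unkernel A1 A2 A3 x w (H w)" for w
      unfolding oct_unkernel_def lct_phase_def
      by (intro tendsto_rmul_rot tendsto_intros tendsto_vec_nth u)
    then show "AE w in lborel. (\<lambda>n. oct_unkernel A1 A2 A3 (u n) w (H w)) \<longlonglongrightarrow> oct_unkernel A1 A2 A3 x w (H w)"
      by simp
  qed (simp_all add: norm_oct_unkernel_le)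
qed

lemma oct_transform_inversion_weak:
  fixes g :: "real^3 \<Rightarrow> real" and \<psi>1 \<psi>2 \<psi>3 :: "real \<Rightarrow> real"
  assumes b: "A1 $ 1 $ 2 \<noteq> 0" "A2 $ 1 $ 2 \<noteq> 0" "A3 $ 1 $ 2 \<noteq> 0"
    and g: "integrable lborel g" and H: "integrable lborel (oct_transform A1 A2 A3 g)"
    and \<psi>1: "continuous_on UNIV \<psi>1" "integrable lborel \<psi>1" "\<And>x. \<bar>\<psi>1 x\<bar> \<le> M"
    and \<psi>2: "continuous_on UNIV \<psi>2" "integrable lborel \<psi>2" "\<And>x. \<bar>\<psi>2 x\<bar> \<le> M"
    and \<psi>3: "continuous_on UNIV \<psi>3" "integrable lborel \<psi>3" "\<And>x. \<bar>\<psi>3 x\<bar> \<le> M"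
  shows "(LBINT x. (\<psi>3 (x $ 3) * (\<psi>2 (x $ 2) * \<psi>1 (x $ 1))) *\<^sub>R
      (LBINT w. oct_unkernel A1 A2 A3 x w (oct_transform A1 A2 A3 g w))) =
    (lct_scale A1 * lct_scale A2 * lct_scale A3 * (LBINT x. (\<psi>3 (x $ 3) * (\<psi>2 (x $ 2) * \<psi>1 (x $ 1))) * g x)) *\<^sub>R oreal 1"
proof -
  have [measurable]: "g \<in> borel_measurable borel" "\<psi>1 \<in> borel_measurable borel" "\<psi>2 \<in> borel_measurable borel" "\<psi>3 \<in> borel_measurable borel"
    using g \<psi>1(2) \<psi>2(2) \<psi>3(2) by auto
  define H where "H = oct_transform A1 A2 A3 g"
  have Hm [measurable]: "H \<in> borel_measurable borel" unfolding H_def by measurable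
  have T: "(LBINT y. g (vec3_of y) *\<^sub>R rot (rmul mu4) (lct_phase A3 (fst y) (fst w)) (rot (rmul mu2) (lct_phase A2 (fst (snd y)) (fst (snd w)))
      (rot (rmul mu1) (lct_phase A1 (snd (snd y)) (snd (snd w))) (oreal 1)))) = H (vec3_of w)" for w
    unfolding H_def oct_transform_def by (subst integral_vec3_of[symmetric]) (simp_all add: oct_kernel_def)
  have U: "(LBINT w. rot (rmul mu1) (- lct_phase A1 (snd (snd x)) (snd (snd w))) (rot (rmul mu2) (- lct_phase A2 (fst (snd x)) (fst (snd w)))
        (rot (rmul mu4) (- lct_phase A3 (fst x) (fst w)) (H (vec3_of w))))) = (LBINT w. oct_unkernel A1 A2 A3 (vec3_of x) w (H w))" for x
    by (subst integral_vec3_of[symmetric]) (simp_all add: oct_unkernel_def)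
  note main = LCT_inversion_weak_3D[where ?a1.0 = "A1 $ 1 $ 1" and ?b1.0 = "A1 $ 1 $ 2" and ?d1.0 = "A1 $ 2 $ 2"
     and ?a2.0 = "A2 $ 1 $ 1" and ?b2.0 = "A2 $ 1 $ 2" and ?d2.0 = "A2 $ 2 $ 2"
     and ?a3.0 = "A3 $ 1 $ 1" and ?b3.0 = "A3 $ 1 $ 2" and ?d3.0 = "A3 $ 2 $ 2"
     and ?J1.0 = "rmul mu1" and ?J2.0 = "rmul mu2" and ?J3.0 = "rmul mu4" and g = "\<lambda>y. g (vec3_of y)" and v = "oreal 1",
     folded lct_phase_def, unfolded T U, OF complex_structure_rmul b _ _ \<psi>1 \<psi>2 \<psi>3]
  have "(LBINT x. (\<psi>3 (fst x) * (\<psi>2 (fst (snd x)) * \<psi>1 (snd (snd x)))) *\<^sub>R (LBINT w. oct_unkernel A1 A2 A3 (vec3_of x) w (H w))) =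
    (2 * pi * \<bar>A3 $ 1 $ 2\<bar> * (2 * pi * \<bar>A2 $ 1 $ 2\<bar>) * (2 * pi * \<bar>A1 $ 1 $ 2\<bar>) *
      (LBINT x. (\<psi>3 (fst x) * (\<psi>2 (fst (snd x)) * \<psi>1 (snd (snd x)))) * g (vec3_of x))) *\<^sub>R oreal 1"
    by (rule main) (use g H in \<open>simp_all add: integrable_vec3_of_iff H_def\<close>)
  also have "(LBINT x. (\<psi>3 (fst x) * (\<psi>2 (fst (snd x)) * \<psi>1 (snd (snd x)))) *\<^sub>R (LBINT w. oct_unkernel A1 A2 A3 (vec3_of x) w (H w))) =
     (LBINT x. (\<psi>3 (x $ 3) * (\<psi>2 (x $ 2) * \<psi>1 (x $ 1))) *\<^sub>R (LBINT w. oct_unkernel A1 A2 A3 x w (H w)))"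
    by (subst (2) integral_vec3_of[symmetric]) simp_all
  also have "(LBINT x. (\<psi>3 (fst x) * (\<psi>2 (fst (snd x)) * \<psi>1 (snd (snd x)))) * g (vec3_of x)) =
     (LBINT x. (\<psi>3 (x $ 3) * (\<psi>2 (x $ 2) * \<psi>1 (x $ 1))) * g x)"
    by (subst integral_vec3_of[symmetric]) simp_all
  finally show ?thesis
    by (simp add: H_def lct_scale_def mult_ac)
qed

section \<open>Mollifiers built from tent functions, and pointwise inversion\<close>

definition tent :: "real \<Rightarrow> real" where
  "tent t = max 0 (1 - \<bar>t\<bar>)"

lemma tent_bounds: "0 \<le> tent t" "tent t \<le> 1" "\<bar>tent t\<bar> \<le> 1"
  by (auto simp: tent_def)

lemma continuous_on_tent: "continuous_on UNIV tent"
  unfolding tent_def by (intro continuous_intros)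

lemma borel_measurable_tent [measurable]: "tent \<in> borel_measurable borel"
  by (intro borel_measurable_continuous_onI continuous_on_tent)

text \<open>A product of functions of one variable, because this is the form of test function that
  the weak inversion admits.\<close>

definition bump :: "real \<Rightarrow> real^3 \<Rightarrow> real" where
  "bump r s = tent (s $ 3 / r) * (tent (s $ 2 / r) * tent (s $ 1 / r))"

lemma bump_bounds: "0 \<le> bump r s" "bump r s \<le> 1"
  using tent_bounds by (auto simp: bump_def intro!: mult_le_one)

lemma borel_measurable_bump [measurable]: "bump r \<in> borel_measurable borel"
  unfolding bump_def[abs_def] by measurable

text \<open>The support lies in the cube of half-side \<open>r\<close>; the factor 3 comes from
  bounding the Euclidean norm by the sum of the three coordinates.\<close>

lemma bump_eq_0:
  assumes "r > 0" "norm s > 3 * r"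
  shows "bump r s = 0"
proof -
  have "norm s \<le> \<bar>s $ 1\<bar> + \<bar>s $ 2\<bar> + \<bar>s $ 3\<bar>"
    using norm_le_l1_cart[of s] by (simp add: sum_3)
  with assms have "\<bar>s $ 1\<bar> \<ge> r \<or> \<bar>s $ 2\<bar> \<ge> r \<or> \<bar>s $ 3\<bar> \<ge> r"
    by linarith
  with assms(1) show ?thesis
    by (auto simp: bump_def tent_def)
qed

lemma integrable_bump:
  assumes "r > 0"
  shows "integrable lborel (bump r)"
proof (rule Bochner_Integration.integrable_bound)
  show "integrable lborel (indicat_real (cball (0 :: real^3) (3 * r)))"
    using emeasure_lborel_cball_finite by (auto simp: integrable_indicator_iff)
  show "AE s in lborel. norm (bump r s) \<le> norm (indicat_real (cball 0 (3 * r)) s)"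
    using bump_bounds[of r] bump_eq_0[OF assms] by (intro AE_I2) (auto simp: indicator_def)
qed measurable

lemma integral_bump_pos:
  assumes "r > 0"
  shows "0 < (LBINT s. bump r s)"
proof -
  \<comment> \<open>On this ball each of the three tents is at least 1/2, which gives
    \<open>1 / 8\<close>.\<close>
  have le: "1 / 8 * indicat_real (ball 0 (r / 2)) s \<le> bump r s" for s :: "real^3"
  proof (cases "s \<in> ball 0 (r / 2)")
    case True
    have "\<bar>s $ i\<bar> \<le> r / 2" for i
      using True component_le_norm_cart[of s i] by simp
    then have half: "\<bar>s $ i / r\<bar> \<le> 1 / 2" for i
      using assms by (simp add: abs_divide divide_le_eq)
    have "1 / 2 \<le> tent (s $ i / r)" for i
      unfolding tent_def using half[of i] by (intro max.coboundedI2) linarith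
    then have "1 / 2 * (1 / 2 * (1 / 2)) \<le> bump r s"
      unfolding bump_def by (intro mult_mono) (auto simp: tent_bounds)
    with True show ?thesis by simp
  qed (simp add: bump_bounds)
  have "0 < 1 / 8 * measure lborel (ball (0 :: real^3) (r / 2))"
    using assms by (simp add: content_ball_pos)
  also have "\<dots> = (LBINT s::real^3. 1 / 8 * indicat_real (ball 0 (r / 2)) s)"
    by simp
  also have "\<dots> \<le> (LBINT s. bump r s)"
    using emeasure_lborel_ball_finite le
    by (intro integral_mono integrable_bump assms integrable_mult_right) (auto simp: integrable_indicator_iff)
  finally show ?thesis .
qed

definition mollifier :: "real \<Rightarrow> real^3 \<Rightarrow> real" where
  "mollifier r s = bump r s / (LBINT s. bump r s)"

lemma borel_measurable_mollifier [measurable]: "mollifier r \<in> borel_measurable borel"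
  unfolding mollifier_def[abs_def] by measurable

lemma mollifier_nonneg: "r > 0 \<Longrightarrow> 0 \<le> mollifier r s"
  using integral_bump_pos[of r] bump_bounds by (simp add: mollifier_def)

lemma mollifier_le: "r > 0 \<Longrightarrow> mollifier r s \<le> 1 / (LBINT s. bump r s)"
  using integral_bump_pos[of r] bump_bounds by (simp add: mollifier_def divide_right_mono)

lemma mollifier_eq_0: "r > 0 \<Longrightarrow> norm s > 3 * r \<Longrightarrow> mollifier r s = 0"
  by (simp add: mollifier_def bump_eq_0)

lemma integrable_mollifier: "r > 0 \<Longrightarrow> integrable lborel (mollifier r)"
  unfolding mollifier_def[abs_def] by (simp add: integrable_bump)

lemma integral_mollifier: "r > 0 \<Longrightarrow> (LBINT s. mollifier r s) = 1"
  using integral_bump_pos[of r] by (simp add: mollifier_def)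

lemma lborel_integral_translate:
  fixes f :: "'a::euclidean_space \<Rightarrow> 'b::{banach, second_countable_topology}"
  assumes "f \<in> borel_measurable borel"
  shows "(LBINT s. f (x + s)) = (LBINT s. f s)"
  using integral_distr[of "(+) x" lborel borel f] assms by (simp add: lborel_distr_plus)

lemma lborel_integrable_translate:
  fixes f :: "'a::euclidean_space \<Rightarrow> 'b::{banach, second_countable_topology}"
  assumes "f \<in> borel_measurable borel"
  shows "integrable lborel (\<lambda>s. f (x + s)) \<longleftrightarrow> integrable lborel f"
  using integrable_distr_eq[of "(+) x" lborel borel f] assms by (simp add: lborel_distr_plus)

lemma integrable_mollifier_scaleR:
  fixes h :: "real^3 \<Rightarrow> 'b::{banach, second_countable_topology}"
  assumes r: "r > 0" and h: "integrable lborel h"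
  shows "integrable lborel (\<lambda>s. mollifier r s *\<^sub>R h (x + s))"
proof (rule Bochner_Integration.integrable_bound)
  have [measurable]: "h \<in> borel_measurable borel" using h by auto
  show "integrable lborel (\<lambda>s. (1 / (LBINT s. bump r s)) *\<^sub>R h (x + s))"
    using h by (intro integrable_scaleR_right) (simp add: lborel_integrable_translate)
  show "AE s in lborel. norm (mollifier r s *\<^sub>R h (x + s)) \<le> norm ((1 / (LBINT s. bump r s)) *\<^sub>R h (x + s))"
  proof (intro AE_I2)
    fix s
    show "norm (mollifier r s *\<^sub>R h (x + s)) \<le> norm ((1 / (LBINT s. bump r s)) *\<^sub>R h (x + s))"
      using mult_right_mono[OF mollifier_le[OF r, of s] norm_ge_zero[of "h (x + s)"]]
        mollifier_nonneg[OF r, of s] integral_bump_pos[OF r] by simp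
  qed
  show "(\<lambda>s. mollifier r s *\<^sub>R h (x + s)) \<in> borel_measurable lborel"
    by measurable
qed

lemma mollifier_tendsto:
  fixes h :: "real^3 \<Rightarrow> 'b::{banach, second_countable_topology}"
  assumes cont: "isCont h x" and r: "\<And>n. r n > 0" "r \<longlonglongrightarrow> 0"
    and int: "\<And>n. integrable lborel (\<lambda>s. mollifier (r n) s *\<^sub>R h (x + s))"
  shows "(\<lambda>n. LBINT s. mollifier (r n) s *\<^sub>R h (x + s)) \<longlonglongrightarrow> h x"
proof (rule LIMSEQ_I)
  fix e :: real assume e: "e > 0"
  then obtain d where d: "d > 0" "\<And>y. dist y x < d \<Longrightarrow> dist (h y) (h x) < e / 2"
    using cont unfolding continuous_at_eps_delta by (metis half_gt_zero)
  \<comment> \<open>The mollifier is supported in the ball of radius \<open>3 * r n\<close>, so a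
    radius below \<open>d / 3\<close> keeps \<open>x + s\<close> within distance \<open>d\<close> of
    \<open>x\<close>.\<close>
  have "\<forall>\<^sub>F n in sequentially. r n < d / 3"
    using order_tendstoD(2)[OF r(2), of "d / 3"] d(1) by simp
  then obtain N where N: "\<And>n. n \<ge> N \<Longrightarrow> r n < d / 3"
    by (auto simp: eventually_sequentially)
  show "\<exists>N. \<forall>n\<ge>N. norm ((LBINT s. mollifier (r n) s *\<^sub>R h (x + s)) - h x) < e"
  proof (intro exI allI impI)
    fix n assume n: "n \<ge> N"
    have i: "integrable lborel (\<lambda>s. mollifier (r n) s *\<^sub>R h x)"
      using integrable_mollifier[OF r(1)] by simp
    have le: "norm (mollifier (r n) s *\<^sub>R (h (x + s) - h x)) \<le> mollifier (r n) s * (e / 2)" for s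
    proof (cases "norm s > 3 * r n")
      case False
      then have "dist (h (x + s)) (h x) < e / 2"
        using N[OF n] by (intro d(2)) (simp add: dist_norm)
      then have "norm (h (x + s) - h x) \<le> e / 2"
        by (simp add: dist_norm)
      from mult_left_mono[OF this mollifier_nonneg[OF r(1), of n s]] show ?thesis
        using mollifier_nonneg[OF r(1), of n s] by simp
    qed (simp add: mollifier_eq_0 r)
    have "(LBINT s. mollifier (r n) s *\<^sub>R h (x + s)) - h x =
      (LBINT s. mollifier (r n) s *\<^sub>R (h (x + s) - h x))"
      using int[of n] i integrable_mollifier[OF r(1)]
      by (simp add: scaleR_diff_right Bochner_Integration.integral_diff integral_mollifier r)
    also have "norm \<dots> \<le> (LBINT s. mollifier (r n) s * (e / 2))"
      using int[of n] i integrable_mollifier[OF r(1)] le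
      by (intro Bochner_Integration.integral_norm_bound_integral) (auto simp: scaleR_diff_right)
    also have "\<dots> = e / 2"
      by (simp add: integral_mollifier r)
    finally show "norm ((LBINT s. mollifier (r n) s *\<^sub>R h (x + s)) - h x) < e"
      using e by simp
  qed
qed

text \<open>In the weak identity tested with a mollifier at \<open>x\<close>, the left side
  converges because the inverse transform is continuous, and the right side converges by
  \<open>lim\<close>. The hypothesis is a limit along given radii instead of continuity of
  \<open>g\<close>, so that it also covers a signal multiplied by a merely measurable window, at a
  suitable point.\<close>

lemma oct_transform_inversion_pointwise:
  assumes b: "A1 $ 1 $ 2 \<noteq> 0" "A2 $ 1 $ 2 \<noteq> 0" "A3 $ 1 $ 2 \<noteq> 0"
    and g: "integrable lborel g" and H: "integrable lborel (oct_transform A1 A2 A3 g)"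
    and r: "\<And>n. r n > 0" "r \<longlonglongrightarrow> 0"
    and lim: "(\<lambda>n. LBINT s. mollifier (r n) s * g (x + s)) \<longlonglongrightarrow> l"
  shows "(LBINT w. oct_unkernel A1 A2 A3 x w (oct_transform A1 A2 A3 g w)) =
    (lct_scale A1 * lct_scale A2 * lct_scale A3 * l) *\<^sub>R oreal 1"
proof -
  define \<Phi> where "\<Phi> = (\<lambda>x. LBINT w. oct_unkernel A1 A2 A3 x w (oct_transform A1 A2 A3 g w))"
  define C where "C = lct_scale A1 * lct_scale A2 * lct_scale A3"
  have [measurable]: "g \<in> borel_measurable borel" using g by auto
  have cont: "isCont \<Phi> y" for y
    unfolding \<Phi>_def by (rule isCont_integral_oct_unkernel[OF H])
  then have [measurable]: "\<Phi> \<in> borel_measurable borel"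
    by (intro borel_measurable_continuous_onI) (simp add: continuous_at_imp_continuous_on)
  have \<Phi>_le: "norm (\<Phi> y) \<le> (LBINT w. rot_bound * norm (oct_transform A1 A2 A3 g w))" for y
    unfolding \<Phi>_def using H
    by (intro Bochner_Integration.integral_norm_bound_integral integrable_oct_unkernel norm_oct_unkernel_le) auto
  have "(LBINT s. mollifier (r n) s *\<^sub>R \<Phi> (x + s)) = (C * (LBINT s. mollifier (r n) s * g (x + s))) *\<^sub>R oreal 1" for n
  proof -
    \<comment> \<open>The tents are recentred at the coordinates of \<open>x\<close>: the weak
      inversion tests in the original variable, the mollifier in the displacement from
      \<open>x\<close>.\<close>
    define p where "p = (\<lambda>i t. tent ((t - x $ i) / r n))"
    have p: "continuous_on UNIV (p i)" "integrable lborel (p i)" "\<bar>p i t\<bar> \<le> 1" for i t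
    proof -
      show cp: "continuous_on UNIV (p i)"
        unfolding p_def using r(1)[of n]
        by (intro continuous_on_compose2[OF continuous_on_tent] continuous_intros) auto
      show "integrable lborel (p i)"
      proof (rule Bochner_Integration.integrable_bound)
        show "integrable lborel (indicat_real {x $ i - r n .. x $ i + r n})"
          by (auto simp: integrable_indicator_iff emeasure_lborel_Icc_eq)
        show "AE t in lborel. norm (p i t) \<le> norm (indicat_real {x $ i - r n .. x $ i + r n} t)"
          using r(1)[of n] by (intro AE_I2) (auto simp: p_def tent_def indicator_def field_simps split: if_splits)
        show "p i \<in> borel_measurable lborel"
          using borel_measurable_continuous_onI[OF cp] by simp
      qed
      show "\<bar>p i t\<bar> \<le> 1" by (simp add: p_def tent_bounds)
    qed
    let ?c = "LBINT s. bump (r n) s"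
    have bump_p: "p 3 ((x + s) $ 3) * (p 2 ((x + s) $ 2) * p 1 ((x + s) $ 1)) = bump (r n) s" for s
      by (simp add: p_def bump_def)
    have [measurable]: "p i \<in> borel_measurable borel" for i
      using p(2) by auto
    have "(LBINT s. bump (r n) s *\<^sub>R \<Phi> (x + s)) = (C * (LBINT s. bump (r n) s * g (x + s))) *\<^sub>R oreal 1"
    proof -
      have "(LBINT s. bump (r n) s *\<^sub>R \<Phi> (x + s)) = (LBINT y. (p 3 (y $ 3) * (p 2 (y $ 2) * p 1 (y $ 1))) *\<^sub>R \<Phi> y)"
        using lborel_integral_translate[of "\<lambda>y. (p 3 (y $ 3) * (p 2 (y $ 2) * p 1 (y $ 1))) *\<^sub>R \<Phi> y" x]
        unfolding bump_p by simp
      also have "\<dots> = (C * (LBINT y. (p 3 (y $ 3) * (p 2 (y $ 2) * p 1 (y $ 1))) * g y)) *\<^sub>R oreal 1"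
        unfolding \<Phi>_def C_def by (rule oct_transform_inversion_weak[OF b g H p(1,2,3) p(1,2,3) p(1,2,3)])
      also have "(LBINT y. (p 3 (y $ 3) * (p 2 (y $ 2) * p 1 (y $ 1))) * g y) = (LBINT s. bump (r n) s * g (x + s))"
        using lborel_integral_translate[of "\<lambda>y. (p 3 (y $ 3) * (p 2 (y $ 2) * p 1 (y $ 1))) * g y" x]
        unfolding bump_p by simp
      finally show ?thesis .
    qed
    then show ?thesis
      by (simp add: mollifier_def divide_inverse mult.commute[of _ "inverse _"] mult.assoc scaleR_scaleR[symmetric] del: scaleR_scaleR)
        (simp add: mult_ac)
  qed
  moreover have "(\<lambda>n. LBINT s. mollifier (r n) s *\<^sub>R \<Phi> (x + s)) \<longlonglongrightarrow> \<Phi> x"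
  proof (rule mollifier_tendsto[OF cont r])
    fix n
    show "integrable lborel (\<lambda>s. mollifier (r n) s *\<^sub>R \<Phi> (x + s))"
    proof (rule Bochner_Integration.integrable_bound)
      let ?K = "LBINT w. rot_bound * norm (oct_transform A1 A2 A3 g w)"
      show "integrable lborel (\<lambda>s. mollifier (r n) s * ?K)"
        using integrable_mollifier[OF r(1)] by simp
      show "AE s in lborel. norm (mollifier (r n) s *\<^sub>R \<Phi> (x + s)) \<le> norm (mollifier (r n) s * ?K)"
      proof (intro AE_I2)
        fix s
        show "norm (mollifier (r n) s *\<^sub>R \<Phi> (x + s)) \<le> norm (mollifier (r n) s * ?K)"
          unfolding norm_scaleR real_norm_def abs_mult
          by (intro mult_left_mono order.trans[OF \<Phi>_le abs_ge_self] abs_ge_zero)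
      qed
    qed measurable
  qed
  moreover have "(\<lambda>n. (C * (LBINT s. mollifier (r n) s * g (x + s))) *\<^sub>R oreal 1) \<longlonglongrightarrow> (C * l) *\<^sub>R oreal 1"
    by (intro tendsto_intros lim)
  ultimately show ?thesis
    unfolding C_def \<Phi>_def by (simp add: LIMSEQ_unique)
qed

section \<open>Continuity of translations in the mean square\<close>

lemma integrable_mult_L2:
  fixes f g :: "'a \<Rightarrow> real"
  assumes [measurable]: "f \<in> borel_measurable M" "g \<in> borel_measurable M"
    and f: "integrable M (\<lambda>x. (f x)\<^sup>2)" and g: "integrable M (\<lambda>x. (g x)\<^sup>2)"
  shows "integrable M (\<lambda>x. f x * g x)"
proof (rule Bochner_Integration.integrable_bound)
  show "integrable M (\<lambda>x. (f x)\<^sup>2 + (g x)\<^sup>2)" using f g by simp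
  have "\<bar>a * b\<bar> \<le> a\<^sup>2 + b\<^sup>2" for a b :: real
    using sum_squares_bound[of "\<bar>a\<bar>" "\<bar>b\<bar>"] mult_nonneg_nonneg[of "\<bar>a\<bar>" "\<bar>b\<bar>"]
    unfolding abs_mult power2_abs by linarith
  then show "AE x in M. norm (f x * g x) \<le> norm ((f x)\<^sup>2 + (g x)\<^sup>2)"
    by (intro AE_I2) simp
qed measurable

lemma integrable_diff_L2:
  fixes f g :: "'a \<Rightarrow> real"
  assumes [measurable]: "f \<in> borel_measurable M" "g \<in> borel_measurable M"
    and f: "integrable M (\<lambda>x. (f x)\<^sup>2)" and g: "integrable M (\<lambda>x. (g x)\<^sup>2)"
  shows "integrable M (\<lambda>x. (f x - g x)\<^sup>2)"
  using f g integrable_mult_L2[OF assms] by (simp add: power2_diff mult.assoc)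

text \<open>Cauchy-Schwarz, from the nonnegativity of the quadratic form in \<open>s\<close> and
  \<open>t\<close> given by the integral of \<open>(s * f x - t * g x)\<^sup>2\<close>.\<close>

lemma integral_mult_L2_le:
  fixes f g :: "'a \<Rightarrow> real"
  assumes [measurable]: "f \<in> borel_measurable M" "g \<in> borel_measurable M"
    and f: "integrable M (\<lambda>x. (f x)\<^sup>2)" and g: "integrable M (\<lambda>x. (g x)\<^sup>2)"
  shows "(LINT x|M. f x * g x)\<^sup>2 \<le> (LINT x|M. (f x)\<^sup>2) * (LINT x|M. (g x)\<^sup>2)"
proof -
  let ?A = "LINT x|M. (f x)\<^sup>2" and ?B = "LINT x|M. (g x)\<^sup>2" and ?I = "LINT x|M. f x * g x"
  have A: "?A \<ge> 0" by simp
  have *: "0 \<le> s\<^sup>2 * ?A - 2 * (s * t) * ?I + t\<^sup>2 * ?B" for s t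
  proof -
    have "0 \<le> (LINT x|M. (s * f x - t * g x)\<^sup>2)" by simp
    also have "(\<lambda>x. (s * f x - t * g x)\<^sup>2) = (\<lambda>x. s\<^sup>2 * (f x)\<^sup>2 - 2 * (s * t) * (f x * g x) + t\<^sup>2 * (g x)\<^sup>2)"
      by (auto simp: power2_diff power_mult_distrib mult_ac)
    also have "(LINT x|M. s\<^sup>2 * (f x)\<^sup>2 - 2 * (s * t) * (f x * g x) + t\<^sup>2 * (g x)\<^sup>2) = s\<^sup>2 * ?A - 2 * (s * t) * ?I + t\<^sup>2 * ?B"
      using f g integrable_mult_L2[OF assms] by simp
    finally show ?thesis .
  qed
  show ?thesis
  proof (cases "?A = 0")
    case True
    have "?I = 0"
    proof (rule ccontr)
      assume I: "?I \<noteq> 0"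
      \<comment> \<open>With \<open>?A = 0\<close> the form is affine in \<open>s\<close>; this
        choice, with \<open>t = 1\<close>, makes its value -1.\<close>
      define c where "c = (?B + 1) / (2 * ?I)"
      have cI: "c * ?I = (?B + 1) / 2" using I by (simp add: c_def)
      have "0 \<le> c\<^sup>2 * 0 - 2 * (c * 1) * ?I + 1\<^sup>2 * ?B"
        using *[of c 1] unfolding True .
      then have "2 * (c * ?I) \<le> ?B" by (simp add: mult.assoc)
      then have "?B + 1 \<le> ?B" unfolding cI by simp
      then show False by simp
    qed
    then show ?thesis using True by simp
  next
    case False
    then have "?A > 0" using A by linarith
    \<comment> \<open>The form is evaluated at \<open>s = ?I\<close> and
      \<open>t = ?A\<close>.\<close>
    have "0 \<le> ?A * (?A * ?B - ?I\<^sup>2)"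
      using *[of ?I ?A] by (simp add: power2_eq_square algebra_simps)
    then show ?thesis using \<open>?A > 0\<close> by (simp add: zero_le_mult_iff)
  qed
qed

lemma L2_approx_bounded:
  fixes f :: "'a::euclidean_space \<Rightarrow> real"
  assumes [measurable]: "f \<in> borel_measurable borel" and f: "integrable lborel (\<lambda>x. (f x)\<^sup>2)"
  defines "g \<equiv> \<lambda>n x. if \<bar>f x\<bar> \<le> real n \<and> norm x \<le> real n then f x else 0"
  shows "(\<lambda>n. LBINT x. (f x - g n x)\<^sup>2) \<longlonglongrightarrow> 0"
proof -
  have "(\<lambda>n. LBINT x. (f x - g n x)\<^sup>2) \<longlonglongrightarrow> (LBINT x::'a. 0)"
  proof (rule integral_dominated_convergence[where w = "\<lambda>x. (f x)\<^sup>2"])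
    show "AE x in lborel. (\<lambda>n. (f x - g n x)\<^sup>2) \<longlonglongrightarrow> 0"
    proof (intro AE_I2 tendsto_eventually)
      fix x
      have "\<forall>\<^sub>F n in sequentially. max \<bar>f x\<bar> (norm x) \<le> real n"
        using filterlim_real_sequentially unfolding filterlim_at_top by blast
      then show "\<forall>\<^sub>F n in sequentially. (f x - g n x)\<^sup>2 = 0"
        by eventually_elim (simp add: g_def)
    qed
  qed (use f in \<open>auto simp: g_def\<close>)
  then show ?thesis by simp
qed

text \<open>A measurable function is almost everywhere a limit of continuous functions. Clipping
  these at height \<open>M\<close> and multiplying by a cutoff equal to 1 on the ball of radius
  \<open>R\<close> does not disturb the limit, and it supplies a bounded dominating function
  supported in the ball of radius \<open>R + 1\<close>.\<close>

lemma L2_approx_continuous: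
  fixes f :: "'a::euclidean_space \<Rightarrow> real"
  assumes [measurable]: "f \<in> borel_measurable borel"
    and bnd: "\<And>x. \<bar>f x\<bar> \<le> M" and supp: "\<And>x. norm x > R \<Longrightarrow> f x = 0"
  shows "\<exists>g. (\<forall>n. continuous_on UNIV (g n)) \<and> (\<forall>n x. \<bar>g n x\<bar> \<le> M) \<and> (\<forall>n x. norm x > R + 1 \<longrightarrow> g n x = 0) \<and>
    (\<lambda>n. LBINT x. (f x - g n x)\<^sup>2) \<longlonglongrightarrow> 0"
proof -
  have "f \<in> borel_measurable lebesgue" by (rule measurable_completion) simp
  then have "f measurable_on UNIV"
    by (rule lebesgue_measurable_imp_measurable_on) simp
  then obtain N h where N: "negligible N" and h: "\<And>n. continuous_on UNIV (h n)" "\<And>x. x \<notin> N \<Longrightarrow> (\<lambda>n. h n x) \<longlonglongrightarrow> f x"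
    unfolding measurable_on_def by auto
  have M: "M \<ge> 0" using bnd[of 0] by simp
  define k where "k = (\<lambda>x::'a. min 1 (max 0 (R + 1 - norm x)))"
  have k: "0 \<le> k x" "k x \<le> 1" "norm x > R + 1 \<Longrightarrow> k x = 0" "norm x \<le> R \<Longrightarrow> k x = 1" for x
    by (auto simp: k_def)
  define g where "g = (\<lambda>n x. k x * max (- M) (min M (h n x)))"
  have g1: "continuous_on UNIV (g n)" for n
    unfolding g_def k_def using h(1) by (intro continuous_intros)
  then have [measurable]: "g n \<in> borel_measurable borel" for n
    by (rule borel_measurable_continuous_onI)
  have g2: "\<bar>g n x\<bar> \<le> M" for n x
  proof -
    have "\<bar>max (- M) (min M (h n x))\<bar> \<le> M" using M by linarith
    then have "\<bar>k x\<bar> * \<bar>max (- M) (min M (h n x))\<bar> \<le> 1 * M"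
      using k[of x] M by (intro mult_mono) auto
    then show ?thesis by (simp add: g_def abs_mult)
  qed
  have g3: "g n x = 0" if "norm x > R + 1" for n x
    using k(3)[OF that] by (simp add: g_def)
  have "AE x in lebesgue. x \<notin> N"
    using N by (intro AE_not_in) (simp add: negligible_iff_null_sets)
  then have AEN: "AE x in lborel. x \<notin> N" by (simp add: AE_completion_iff)
  have "(\<lambda>n. LBINT x. (f x - g n x)\<^sup>2) \<longlonglongrightarrow> (LBINT x::'a. 0)"
  proof (rule integral_dominated_convergence)
    show "integrable lborel (\<lambda>x::'a. (2 * M)\<^sup>2 * indicat_real (cball 0 (R + 1)) x)"
      using emeasure_lborel_cball_finite by (intro integrable_mult_right) (auto simp: integrable_indicator_iff)
    show "AE x in lborel. (\<lambda>n. (f x - g n x)\<^sup>2) \<longlonglongrightarrow> 0"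
      using AEN
    proof eventually_elim
      case (elim x)
      have "(\<lambda>n. (f x - k x * max (- M) (min M (h n x)))\<^sup>2) \<longlonglongrightarrow> (f x - k x * max (- M) (min M (f x)))\<^sup>2"
        by (intro tendsto_intros h(2) elim)
      moreover have "k x * max (- M) (min M (f x)) = f x"
      proof (cases "norm x > R")
        case True
        then show ?thesis using supp[OF True] M by simp
      next
        case False
        then show ?thesis using k(4)[of x] bnd[of x] by simp
      qed
      ultimately show ?case by (simp add: g_def)
    qed
    show "AE x in lborel. norm ((f x - g n x)\<^sup>2) \<le> (2 * M)\<^sup>2 * indicat_real (cball 0 (R + 1)) x" for n
    proof (intro AE_I2)
      fix x
      show "norm ((f x - g n x)\<^sup>2) \<le> (2 * M)\<^sup>2 * indicat_real (cball 0 (R + 1)) x"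
      proof (cases "norm x > R + 1")
        case True
        then show ?thesis using g3[OF True] supp[of x] by simp
      next
        case False
        have "\<bar>f x - g n x\<bar> \<le> 2 * M" using bnd[of x] g2[of n x] by linarith
        then have "(f x - g n x)\<^sup>2 \<le> (2 * M)\<^sup>2" using M by (intro abs_le_square_iff[THEN iffD1]) simp
        then show ?thesis using False by (simp add: indicator_def)
      qed
    qed
  qed measurable
  then show ?thesis
    using g1 g2 g3 by (intro exI[of _ g]) simp
qed

text \<open>A density argument: the claim holds for continuous functions of bounded support by
  dominated convergence, and \<open>approx\<close> carries it over to bounded functions of bounded
  support and from these to all of L2.\<close>

lemma L2_translation_tendsto:
  fixes f :: "'a::euclidean_space \<Rightarrow> real"
  assumes [measurable]: "f \<in> borel_measurable borel" and f: "integrable lborel (\<lambda>x. (f x)\<^sup>2)"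
    and s: "s \<longlonglongrightarrow> (0 :: 'a)"
  shows "(\<lambda>n. LBINT p. (f (p + s n) - f p)\<^sup>2) \<longlonglongrightarrow> 0"
proof -
  define T where "T = (\<lambda>(g::'a \<Rightarrow> real) n. LBINT p. (g (p + s n) - g p)\<^sup>2)"
  have T0: "0 \<le> T g n" for g n by (simp add: T_def)
  have shift: "integrable lborel (\<lambda>p. (h (p + z))\<^sup>2)" "(LBINT p. (h (p + z))\<^sup>2) = (LBINT p. (h p)\<^sup>2)"
    if [measurable]: "h \<in> borel_measurable borel" and "integrable lborel (\<lambda>x. (h x)\<^sup>2)" for h :: "'a \<Rightarrow> real" and z
    using lborel_integrable_translate[of "\<lambda>p. (h p)\<^sup>2" z] lborel_integral_translate[of "\<lambda>p. (h p)\<^sup>2" z] that(2)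
    by (simp_all add: add.commute)
  \<comment> \<open>The two approximation errors, one translated and one not, have equal integrals
    by translation invariance, hence the factor 2. The factor 3 comes from squaring a sum of three
    terms.\<close>
  have le: "T f n \<le> 3 * (2 * (LBINT p. (f p - g p)\<^sup>2) + T g n)"
    if [measurable]: "f \<in> borel_measurable borel" "g \<in> borel_measurable borel"
      and f: "integrable lborel (\<lambda>x. (f x)\<^sup>2)" and g: "integrable lborel (\<lambda>x. (g x)\<^sup>2)" for f g :: "'a \<Rightarrow> real" and n
  proof -
    have fg: "integrable lborel (\<lambda>x. (f x - g x)\<^sup>2)"
      using that by (intro integrable_diff_L2) auto
    have gs: "integrable lborel (\<lambda>p. (g (p + s n) - g p)\<^sup>2)"
      using shift[OF that(2) g] g by (intro integrable_diff_L2) auto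
    have fs: "integrable lborel (\<lambda>p. (f (p + s n) - f p)\<^sup>2)"
      using shift[OF that(1) f] f by (intro integrable_diff_L2) auto
    have fgs: "integrable lborel (\<lambda>p. (f (p + s n) - g (p + s n))\<^sup>2)" "(LBINT p. (f (p + s n) - g (p + s n))\<^sup>2) = (LBINT p. (f p - g p)\<^sup>2)"
      using shift[of "\<lambda>p. f p - g p" "s n"] fg by simp_all
    have sq: "(a + b + c)\<^sup>2 \<le> 3 * (a\<^sup>2 + b\<^sup>2 + c\<^sup>2)" for a b c :: real
    proof -
      have "0 \<le> (a - b)\<^sup>2 + (b - c)\<^sup>2 + (a - c)\<^sup>2" by simp
      then show ?thesis by (simp add: power2_eq_square algebra_simps)
    qed
    have "T f n \<le> (LBINT p. 3 * ((f (p + s n) - g (p + s n))\<^sup>2 + (g (p + s n) - g p)\<^sup>2 + (f p - g p)\<^sup>2))"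
      unfolding T_def
    proof (rule integral_mono[OF fs])
      fix p
      show "(f (p + s n) - f p)\<^sup>2 \<le> 3 * ((f (p + s n) - g (p + s n))\<^sup>2 + (g (p + s n) - g p)\<^sup>2 + (f p - g p)\<^sup>2)"
        using sq[of "f (p + s n) - g (p + s n)" "g (p + s n) - g p" "- (f p - g p)"] by (simp add: power2_commute)
    qed (use fg gs fgs in simp)
    also have "\<dots> = 3 * ((LBINT p. (f p - g p)\<^sup>2) + T g n + (LBINT p. (f p - g p)\<^sup>2))"
      using fg gs fgs by (simp add: T_def)
    finally show ?thesis by simp
  qed
  have approx: "T f \<longlonglongrightarrow> 0"
    if "f \<in> borel_measurable borel" "integrable lborel (\<lambda>x. (f x)\<^sup>2)"
      and g: "\<And>n. g n \<in> borel_measurable borel" "\<And>n. integrable lborel (\<lambda>x. (g n x)\<^sup>2)" "\<And>n. T (g n) \<longlonglongrightarrow> 0"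
        "(\<lambda>n. LBINT p. (f p - g n p)\<^sup>2) \<longlonglongrightarrow> 0" for f and g :: "nat \<Rightarrow> 'a \<Rightarrow> real"
  proof (rule LIMSEQ_I)
    fix e :: real assume e: "e > 0"
    \<comment> \<open>The thresholds satisfy \<open>3 * (2 * (e / 12) + e / 6) = e\<close>, in line
      with \<open>le\<close>.\<close>
    obtain k where k: "(LBINT p. (f p - g k p)\<^sup>2) < e / 12"
      using order_tendstoD(2)[OF g(4), of "e / 12"] e by (auto simp: eventually_sequentially)
    obtain N where N: "\<And>n. n \<ge> N \<Longrightarrow> T (g k) n < e / 6"
      using order_tendstoD(2)[OF g(3), of "e / 6"] e by (auto simp: eventually_sequentially)
    show "\<exists>N. \<forall>n\<ge>N. norm (T f n - 0) < e"
    proof (intro exI allI impI)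
      fix n assume "n \<ge> N"
      then show "norm (T f n - 0) < e"
        using le[OF that(1) g(1)[of k] that(2) g(2)[of k], of n] k N[of n] T0[of f n] by simp
    qed
  qed
  have cont: "T g \<longlonglongrightarrow> 0"
    if g: "continuous_on UNIV g" "\<And>x. \<bar>g x\<bar> \<le> M" "\<And>x. norm x > R \<Longrightarrow> g x = 0" for g :: "'a \<Rightarrow> real" and M R
  proof -
    have [measurable]: "g \<in> borel_measurable borel" by (rule borel_measurable_continuous_onI[OF g(1)])
    have M: "M \<ge> 0" using g(2)[of 0] by simp
    \<comment> \<open>A common bound for the translations keeps all differences supported in one
      fixed ball.\<close>
    obtain S where S: "\<And>n. norm (s n) \<le> S"
      using convergent_imp_bounded[OF s] by (auto simp: bounded_iff)
    have "T g \<longlonglongrightarrow> (LBINT p::'a. 0)"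
      unfolding T_def
    proof (rule integral_dominated_convergence)
      show "integrable lborel (\<lambda>x::'a. (2 * M)\<^sup>2 * indicat_real (cball 0 (R + S)) x)"
        using emeasure_lborel_cball_finite by (intro integrable_mult_right) (auto simp: integrable_indicator_iff)
      show "AE p in lborel. (\<lambda>n. (g (p + s n) - g p)\<^sup>2) \<longlonglongrightarrow> 0"
      proof (intro AE_I2)
        fix p
        have "(\<lambda>n. p + s n) \<longlonglongrightarrow> p + 0" by (intro tendsto_intros s)
        then have "(\<lambda>n. g (p + s n)) \<longlonglongrightarrow> g p"
          using g(1) by (intro isCont_tendsto_compose[of _ g]) (auto simp: continuous_on_eq_continuous_at)
        then have "(\<lambda>n. (g (p + s n) - g p)\<^sup>2) \<longlonglongrightarrow> (g p - g p)\<^sup>2"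
          by (intro tendsto_intros)
        then show "(\<lambda>n. (g (p + s n) - g p)\<^sup>2) \<longlonglongrightarrow> 0" by simp
      qed
      show "AE p in lborel. norm ((g (p + s n) - g p)\<^sup>2) \<le> (2 * M)\<^sup>2 * indicat_real (cball 0 (R + S)) p" for n
      proof (intro AE_I2)
        fix p
        show "norm ((g (p + s n) - g p)\<^sup>2) \<le> (2 * M)\<^sup>2 * indicat_real (cball 0 (R + S)) p"
        proof (cases "norm p > R + S")
          case True
          have "norm (p + s n) > R" "norm p > R"
            using True S[of n] norm_diff_ineq[of p "s n"] norm_ge_zero[of "s n"] by linarith+
          then show ?thesis using g(3) by simp
        next
          case False
          have "\<bar>g (p + s n) - g p\<bar> \<le> 2 * M" using g(2)[of p] g(2)[of "p + s n"] by linarith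
          then have "(g (p + s n) - g p)\<^sup>2 \<le> (2 * M)\<^sup>2" using M by (intro abs_le_square_iff[THEN iffD1]) simp
          then show ?thesis using False by (simp add: indicator_def)
        qed
      qed
    qed measurable
    then show ?thesis by simp
  qed
  have L2b: "integrable lborel (\<lambda>x. (g x)\<^sup>2)"
    if [measurable]: "g \<in> borel_measurable borel" and g: "\<And>x. \<bar>g x\<bar> \<le> M" "\<And>x. norm x > R \<Longrightarrow> g x = 0" for g :: "'a \<Rightarrow> real" and M R
  proof (rule Bochner_Integration.integrable_bound)
    show "integrable lborel (\<lambda>x::'a. M\<^sup>2 * indicat_real (cball 0 R) x)"
      using emeasure_lborel_cball_finite by (intro integrable_mult_right) (auto simp: integrable_indicator_iff)
    have "(g x)\<^sup>2 \<le> M\<^sup>2" for x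
      using g(1)[of x] by (intro abs_le_square_iff[THEN iffD1]) simp
    then show "AE x in lborel. norm ((g x)\<^sup>2) \<le> norm (M\<^sup>2 * indicat_real (cball 0 R) x)"
      using g(2) by (intro AE_I2) (auto simp: indicator_def)
  qed measurable
  have bounded: "T g \<longlonglongrightarrow> 0"
    if gm [measurable]: "g \<in> borel_measurable borel" and g: "\<And>x. \<bar>g x\<bar> \<le> M" "\<And>x. norm x > R \<Longrightarrow> g x = 0" for g :: "'a \<Rightarrow> real" and M R
  proof -
    obtain h where h: "\<And>n. continuous_on UNIV (h n)" "\<And>n x. \<bar>h n x\<bar> \<le> M" "\<And>n x. norm x > R + 1 \<Longrightarrow> h n x = 0"
      "(\<lambda>n. LBINT x. (g x - h n x)\<^sup>2) \<longlonglongrightarrow> 0"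
      using L2_approx_continuous[OF gm g, where R = R] by blast
    have hm: "h n \<in> borel_measurable borel" for n
      by (rule borel_measurable_continuous_onI[OF h(1)])
    show ?thesis
    proof (rule approx[of g h])
      show "integrable lborel (\<lambda>x. (g x)\<^sup>2)" by (rule L2b[OF gm g])
      show "integrable lborel (\<lambda>x. (h n x)\<^sup>2)" for n by (rule L2b[OF hm h(2,3)])
      show "T (h n) \<longlonglongrightarrow> 0" for n by (rule cont[OF h(1-3)])
    qed (fact gm hm h(4))+
  qed
  define g where "g = (\<lambda>n x. if \<bar>f x\<bar> \<le> real n \<and> norm x \<le> real n then f x else 0)"
  have [measurable]: "g n \<in> borel_measurable borel" for n
    unfolding g_def by measurable
  have g: "\<bar>g n x\<bar> \<le> real n" "norm x > real n \<Longrightarrow> g n x = 0" for n x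
    by (auto simp: g_def)
  have "T f \<longlonglongrightarrow> 0"
  proof (rule approx[of f g])
    show "integrable lborel (\<lambda>x. (g n x)\<^sup>2)" for n
      by (rule L2b[of "g n" "real n" "real n"]) (auto simp: g)
    show "T (g n) \<longlonglongrightarrow> 0" for n
      by (rule bounded[of "g n" "real n" "real n"]) (auto simp: g)
    show "(\<lambda>n. LBINT p. (f p - g n p)\<^sup>2) \<longlonglongrightarrow> 0"
      unfolding g_def by (rule L2_approx_bounded) (use f in auto)
  qed (use f in auto)
  then show ?thesis by (simp add: T_def)
qed

section \<open>Multiplying the signal by an autocorrelation\<close>

text \<open>The tensor product of three plane vectors, arranged in the eight coordinates exactly as
  the product of the three kernels is.\<close>

definition trig_tensor :: "real \<Rightarrow> real \<Rightarrow> real \<Rightarrow> real \<Rightarrow> real \<Rightarrow> real \<Rightarrow> oct" where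
  "trig_tensor c1 s1 c2 s2 c3 s3 =
    ((c3 * c2 * c1, c3 * c2 * s1, c3 * s2 * c1, c3 * s2 * s1), (s3 * c2 * c1, s3 * c2 * s1, s3 * s2 * c1, s3 * s2 * s1))"

lemma inner_trig_tensor:
  "trig_tensor c1 s1 c2 s2 c3 s3 \<bullet> trig_tensor c1' s1' c2' s2' c3' s3' =
   (c1 * c1' + s1 * s1') * (c2 * c2' + s2 * s2') * (c3 * c3' + s3 * s3')"
  by (simp add: trig_tensor_def algebra_simps)

lemma oct_kernel_eq_trig_tensor:
  "oct_kernel A1 A2 A3 x w = trig_tensor (cos (lct_phase A1 (x $ 1) (w $ 1))) (sin (lct_phase A1 (x $ 1) (w $ 1)))
     (cos (lct_phase A2 (x $ 2) (w $ 2))) (sin (lct_phase A2 (x $ 2) (w $ 2)))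
     (cos (lct_phase A3 (x $ 3) (w $ 3))) (sin (lct_phase A3 (x $ 3) (w $ 3)))"
  by (simp add: oct_kernel_def trig_tensor_def rot_def rmul_def mu1_def mu2_def mu4_def oreal_def)

text \<open>The minus signs make the inner product with the kernel a product of cosines whose phases
  are increased by \<open>c1\<close>, \<open>c2\<close> and \<open>c3\<close>. A change of phase is
  thus absorbed by a change of probe.\<close>

definition probe :: "real \<Rightarrow> real \<Rightarrow> real \<Rightarrow> oct" where
  "probe c1 c2 c3 = trig_tensor (cos c1) (- sin c1) (cos c2) (- sin c2) (cos c3) (- sin c3)"

lemma norm_probe: "norm (probe c1 c2 c3) = 1"
proof -
  have "cos c * cos c + - sin c * - sin c = 1" for c :: real
    by (simp add: power2_eq_square[symmetric])
  then show ?thesis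
    unfolding norm_eq_1 probe_def inner_trig_tensor by (simp only: mult_1)
qed

text \<open>For offsets 0 and \<open>pi / 2\<close> the probes are, up to sign, the eight coordinate
  vectors, so the right side is the l1 norm.\<close>

lemma norm_le_probes:
  "norm z \<le> (\<Sum>c1\<in>{0, pi / 2}. \<Sum>c2\<in>{0, pi / 2}. \<Sum>c3\<in>{0, pi / 2}. \<bar>z \<bullet> probe c1 c2 c3\<bar>)"
proof -
  obtain p q r s p' q' r' s' where z: "z = ((p, q, r, s), (p', q', r', s'))"
    by (metis prod.exhaust)
  have q: "norm (a, b, c, d) \<le> \<bar>a\<bar> + (\<bar>b\<bar> + (\<bar>c\<bar> + \<bar>d\<bar>))" for a b c d :: real
    by (intro order.trans[OF norm_Pair_le] add_mono) auto
  have "norm z \<le> norm (p, q, r, s) + norm (p', q', r', s')"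
    unfolding z by (rule norm_Pair_le)
  also have "\<dots> \<le> (\<bar>p\<bar> + (\<bar>q\<bar> + (\<bar>r\<bar> + \<bar>s\<bar>))) + (\<bar>p'\<bar> + (\<bar>q'\<bar> + (\<bar>r'\<bar> + \<bar>s'\<bar>)))"
    by (intro add_mono q)
  finally show ?thesis
    by (simp add: z probe_def trig_tensor_def)
qed

text \<open>This reduces the octonion-valued transform to scalar integrals of products of cosines,
  where a modulation can be handled by trigonometric identities.\<close>

lemma inner_oct_transform_probe:
  assumes g: "integrable lborel g"
  shows "oct_transform A1 A2 A3 g w \<bullet> probe c1 c2 c3 =
    (LBINT y. g y * (cos (lct_phase A1 (y $ 1) (w $ 1) + c1) * cos (lct_phase A2 (y $ 2) (w $ 2) + c2) *
       cos (lct_phase A3 (y $ 3) (w $ 3) + c3)))"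
proof -
  have "oct_transform A1 A2 A3 g w \<bullet> probe c1 c2 c3 = (LBINT y. (g y *\<^sub>R oct_kernel A1 A2 A3 y w) \<bullet> probe c1 c2 c3)"
    unfolding oct_transform_def
    by (rule integral_inner_left[symmetric]) (rule integrable_scaleR_oct_kernel[OF g])
  then show ?thesis
    by (simp add: oct_kernel_eq_trig_tensor probe_def inner_trig_tensor cos_add)
qed

lemma abs_inner_oct_transform_probe_le:
  "\<bar>oct_transform A1 A2 A3 g w \<bullet> probe c1 c2 c3\<bar> \<le> norm (oct_transform A1 A2 A3 g w)"
  using Cauchy_Schwarz_ineq2[of "oct_transform A1 A2 A3 g w" "probe c1 c2 c3"] by (simp add: norm_probe)

text \<open>Modulating the signal shifts the frequency variable, up to a phase that is constant in the
  signal variable.\<close>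

lemma lct_phase_shift:
  assumes "A $ 1 $ 2 \<noteq> 0"
  shows "lct_phase A y w + c + \<sigma> * (\<xi> * (y - x) + \<tau>) = lct_phase A y (w - \<sigma> * (A $ 1 $ 2 * \<xi>)) +
    (c + \<sigma> * (\<tau> - \<xi> * x) + A $ 2 $ 2 * (w\<^sup>2 - (w - \<sigma> * (A $ 1 $ 2 * \<xi>))\<^sup>2) / (2 * A $ 1 $ 2))"
proof -
  have "A $ 1 $ 2 * (1 / A $ 1 $ 2) = 1" using assms by simp
  then show ?thesis
    using assms by (simp add: lct_phase_def field_simps power2_eq_square)
qed

text \<open>The parameters \<open>\<sigma>1\<close>, \<open>\<sigma>2\<close>,
  \<open>\<sigma>3\<close> will be the signs from the product-to-sum formula. The off-diagonal entry
  appears because the phase contains the mixed term \<open>- s * t / b\<close>, so a modulation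
  frequency must be multiplied by \<open>b\<close> to become a shift of \<open>w\<close>.\<close>

definition freq_shift :: "real^2^2 \<Rightarrow> real^2^2 \<Rightarrow> real^2^2 \<Rightarrow> real^3 \<Rightarrow> real \<Rightarrow> real \<Rightarrow> real \<Rightarrow> real^3" where
  "freq_shift A1 A2 A3 \<xi> \<sigma>1 \<sigma>2 \<sigma>3 =
     vector [\<sigma>1 * (A1 $ 1 $ 2 * \<xi> $ 1), \<sigma>2 * (A2 $ 1 $ 2 * \<xi> $ 2), \<sigma>3 * (A3 $ 1 $ 2 * \<xi> $ 3)]"

lemma integrable_mult_bounded:
  fixes f g :: "'a \<Rightarrow> real"
  assumes f: "integrable M f" and [measurable]: "g \<in> borel_measurable M" and g: "\<And>x. \<bar>g x\<bar> \<le> B"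
  shows "integrable M (\<lambda>x. f x * g x)"
proof (rule Bochner_Integration.integrable_bound)
  show "integrable M (\<lambda>x. B * f x)" using f by simp
  show "(\<lambda>x. f x * g x) \<in> borel_measurable M" using f by measurable
  have "\<bar>g x\<bar> * \<bar>f x\<bar> \<le> \<bar>B\<bar> * \<bar>f x\<bar>" for x
    using g[of x] by (intro mult_right_mono) auto
  then show "AE x in M. norm (f x * g x) \<le> norm (B * f x)"
    by (intro AE_I2) (simp add: abs_mult mult.commute)
qed

text \<open>In each coordinate the modulating cosine times the kernel cosine is half a sum, over two
  signs, of kernel cosines at a shifted frequency with a new offset. That offset depends on
  \<open>w\<close> but not on \<open>y\<close>, so each of the eight terms is a transform tested
  against another probe, and probes are unit vectors. This is why probes with arbitrary offsets are
  considered.\<close>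

lemma modulated_transform_bound:
  fixes x \<xi> w :: "real^3"
  assumes b: "A1 $ 1 $ 2 \<noteq> 0" "A2 $ 1 $ 2 \<noteq> 0" "A3 $ 1 $ 2 \<noteq> 0" and f: "integrable lborel f"
  shows "\<bar>LBINT y. f y * (cos (\<xi> $ 1 * (y $ 1 - x $ 1) + \<tau>1) * cos (\<xi> $ 2 * (y $ 2 - x $ 2) + \<tau>2) * cos (\<xi> $ 3 * (y $ 3 - x $ 3) + \<tau>3)) *
      (cos (lct_phase A1 (y $ 1) (w $ 1) + c1) * cos (lct_phase A2 (y $ 2) (w $ 2) + c2) * cos (lct_phase A3 (y $ 3) (w $ 3) + c3))\<bar>
    \<le> 1 / 8 * (\<Sum>\<sigma>1\<in>{-1, 1}. \<Sum>\<sigma>2\<in>{-1, 1}. \<Sum>\<sigma>3\<in>{-1, 1}. norm (oct_transform A1 A2 A3 f (w - freq_shift A1 A2 A3 \<xi> \<sigma>1 \<sigma>2 \<sigma>3)))"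
    (is "\<bar>?L\<bar> \<le> _")
proof -
  have [measurable]: "f \<in> borel_measurable borel" using f by auto
  define F where "F = (\<lambda>A i \<tau> c \<sigma> (y::real^3). cos (lct_phase A (y $ i) (w $ i) + c + \<sigma> * (\<xi> $ i * (y $ i - x $ i) + \<tau>)))"
  have F_le: "\<bar>F A i \<tau> c \<sigma> y\<bar> \<le> 1" for A i \<tau> c \<sigma> y by (simp add: F_def)
  have [measurable]: "F A i \<tau> c \<sigma> \<in> borel_measurable borel" for A i \<tau> c \<sigma>
    unfolding F_def by measurable
  have cc: "cos (\<xi> $ i * (y $ i - x $ i) + \<tau>) * cos (lct_phase A (y $ i) (w $ i) + c) = 1 / 2 * (\<Sum>\<sigma>\<in>{-1, 1}. F A i \<tau> c \<sigma> y)" for A i \<tau> c y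
  proof -
    have "cos a * cos b = 1 / 2 * (\<Sum>\<sigma>\<in>{-1, 1}. cos (b + \<sigma> * a))" for a b :: real
      by (simp add: cos_add cos_diff)
    then show ?thesis unfolding F_def by this
  qed
  have each: "\<bar>LBINT y. f y * (F A1 1 \<tau>1 c1 \<sigma>1 y * F A2 2 \<tau>2 c2 \<sigma>2 y * F A3 3 \<tau>3 c3 \<sigma>3 y)\<bar>
      \<le> norm (oct_transform A1 A2 A3 f (w - freq_shift A1 A2 A3 \<xi> \<sigma>1 \<sigma>2 \<sigma>3))" for \<sigma>1 \<sigma>2 \<sigma>3
  proof -
    let ?w = "w - freq_shift A1 A2 A3 \<xi> \<sigma>1 \<sigma>2 \<sigma>3"
    have w: "?w $ 1 = w $ 1 - \<sigma>1 * (A1 $ 1 $ 2 * \<xi> $ 1)" "?w $ 2 = w $ 2 - \<sigma>2 * (A2 $ 1 $ 2 * \<xi> $ 2)" "?w $ 3 = w $ 3 - \<sigma>3 * (A3 $ 1 $ 2 * \<xi> $ 3)"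
      by (simp_all add: freq_shift_def)
    \<comment> \<open>The new offset: besides the constants of the modulation, it contains the
      difference of the quadratic terms in the original and the shifted frequency.\<close>
    define e where "e = (\<lambda>(A :: real^2^2) i \<tau> c \<sigma>. c + \<sigma> * (\<tau> - \<xi> $ i * x $ i) +
      A $ 2 $ 2 * ((w $ i)\<^sup>2 - (w $ i - \<sigma> * (A $ 1 $ 2 * \<xi> $ i))\<^sup>2) / (2 * A $ 1 $ 2))"
    have F: "F A i \<tau> c \<sigma> y = cos (lct_phase A (y $ i) (w $ i - \<sigma> * (A $ 1 $ 2 * \<xi> $ i)) + e A i \<tau> c \<sigma>)"
      if "A $ 1 $ 2 \<noteq> 0" for A i \<tau> c \<sigma> y
      unfolding F_def e_def by (subst lct_phase_shift[OF that]) (rule refl)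
    have "(LBINT y. f y * (F A1 1 \<tau>1 c1 \<sigma>1 y * F A2 2 \<tau>2 c2 \<sigma>2 y * F A3 3 \<tau>3 c3 \<sigma>3 y)) =
      oct_transform A1 A2 A3 f ?w \<bullet> probe (e A1 1 \<tau>1 c1 \<sigma>1) (e A2 2 \<tau>2 c2 \<sigma>2) (e A3 3 \<tau>3 c3 \<sigma>3)"
      unfolding F[OF b(1)] F[OF b(2)] F[OF b(3)] inner_oct_transform_probe[OF f] w ..
    then show ?thesis
      by (simp only: abs_inner_oct_transform_probe_le)
  qed
  have int: "integrable lborel (\<lambda>y. f y * (F A1 1 \<tau>1 c1 \<sigma>1 y * F A2 2 \<tau>2 c2 \<sigma>2 y * F A3 3 \<tau>3 c3 \<sigma>3 y))" for \<sigma>1 \<sigma>2 \<sigma>3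
  proof (rule integrable_mult_bounded[OF f, where B = 1])
    show "\<bar>F A1 1 \<tau>1 c1 \<sigma>1 y * F A2 2 \<tau>2 c2 \<sigma>2 y * F A3 3 \<tau>3 c3 \<sigma>3 y\<bar> \<le> 1" for y
      unfolding abs_mult by (intro mult_le_one F_le) auto
  qed measurable
  have regroup: "a * (p * q * r) * (p' * q' * r') = a * ((p * p') * (q * q') * (r * r'))" for a p q r p' q' r' :: real
    by (simp add: mult_ac)
  have expand: "a * (1 / 2 * (\<Sum>\<sigma>\<in>{-1, 1}. p \<sigma>) * (1 / 2 * (\<Sum>\<sigma>\<in>{-1, 1}. q \<sigma>)) * (1 / 2 * (\<Sum>\<sigma>\<in>{-1, 1}. r \<sigma>))) =
      1 / 8 * (\<Sum>\<sigma>1\<in>{-1, 1}. \<Sum>\<sigma>2\<in>{-1, 1}. \<Sum>\<sigma>3\<in>{-1, 1}. a * (p \<sigma>1 * q \<sigma>2 * r \<sigma>3))" for a and p q r :: "real \<Rightarrow> real"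
    by (simp add: algebra_simps)
  have "?L = (LBINT y. 1 / 8 * (\<Sum>\<sigma>1\<in>{-1, 1}. \<Sum>\<sigma>2\<in>{-1, 1}. \<Sum>\<sigma>3\<in>{-1, 1}.
      f y * (F A1 1 \<tau>1 c1 \<sigma>1 y * F A2 2 \<tau>2 c2 \<sigma>2 y * F A3 3 \<tau>3 c3 \<sigma>3 y)))"
    unfolding regroup cc expand ..
  also have "\<dots> = 1 / 8 * (\<Sum>\<sigma>1\<in>{-1, 1}. \<Sum>\<sigma>2\<in>{-1, 1}. \<Sum>\<sigma>3\<in>{-1, 1}.
      LBINT y. f y * (F A1 1 \<tau>1 c1 \<sigma>1 y * F A2 2 \<tau>2 c2 \<sigma>2 y * F A3 3 \<tau>3 c3 \<sigma>3 y))"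
    using int by (simp only: Bochner_Integration.integral_mult_right_zero Bochner_Integration.integral_sum Bochner_Integration.integrable_sum)
  finally have L: "?L = 1 / 8 * (\<Sum>\<sigma>1\<in>{-1, 1}. \<Sum>\<sigma>2\<in>{-1, 1}. \<Sum>\<sigma>3\<in>{-1, 1}.
      LBINT y. f y * (F A1 1 \<tau>1 c1 \<sigma>1 y * F A2 2 \<tau>2 c2 \<sigma>2 y * F A3 3 \<tau>3 c3 \<sigma>3 y))" .
  show ?thesis
    unfolding L abs_mult
    by (intro mult_mono order.trans[OF sum_abs] sum_mono each) auto
qed

text \<open>The cosine of a sum of three angles is a signed sum of four products of cosines, sines
  being cosines delayed by \<open>pi / 2\<close>. The preceding bound of 1/8 per product gives 1/2
  per probe, and the eight probes of \<open>norm_le_probes\<close> give 4.\<close>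

lemma cos_modulated_transform_bound:
  fixes x \<xi> w :: "real^3"
  assumes b: "A1 $ 1 $ 2 \<noteq> 0" "A2 $ 1 $ 2 \<noteq> 0" "A3 $ 1 $ 2 \<noteq> 0" and f: "integrable lborel f"
  shows "norm (oct_transform A1 A2 A3 (\<lambda>y. f y * cos (\<xi> \<bullet> (y - x))) w) \<le>
    4 * (\<Sum>\<sigma>1\<in>{-1, 1}. \<Sum>\<sigma>2\<in>{-1, 1}. \<Sum>\<sigma>3\<in>{-1, 1}. norm (oct_transform A1 A2 A3 f (w - freq_shift A1 A2 A3 \<xi> \<sigma>1 \<sigma>2 \<sigma>3)))"
    (is "_ \<le> 4 * ?S")
proof -
  have [measurable]: "f \<in> borel_measurable borel" using f by auto
  let ?g = "\<lambda>y. f y * cos (\<xi> \<bullet> (y - x))"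
  have g: "integrable lborel ?g"
    by (rule integrable_mult_bounded[OF f, where B = 1]) auto
  define m where "m = (\<lambda>\<tau>1 \<tau>2 \<tau>3 (y::real^3). cos (\<xi> $ 1 * (y $ 1 - x $ 1) + \<tau>1) * cos (\<xi> $ 2 * (y $ 2 - x $ 2) + \<tau>2) * cos (\<xi> $ 3 * (y $ 3 - x $ 3) + \<tau>3))"
  have [measurable]: "m \<tau>1 \<tau>2 \<tau>3 \<in> borel_measurable borel" for \<tau>1 \<tau>2 \<tau>3
    unfolding m_def by measurable
  have cos3: "cos (\<xi> \<bullet> (y - x)) = m 0 0 0 y - m 0 (- pi / 2) (- pi / 2) y - m (- pi / 2) 0 (- pi / 2) y - m (- pi / 2) (- pi / 2) 0 y" for y
  proof -
    have "cos (a + b + c) = cos (a + 0) * cos (b + 0) * cos (c + 0) - cos (a + 0) * cos (b + - pi / 2) * cos (c + - pi / 2)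
      - cos (a + - pi / 2) * cos (b + 0) * cos (c + - pi / 2) - cos (a + - pi / 2) * cos (b + - pi / 2) * cos (c + 0)" for a b c :: real
      by (simp add: cos_add sin_add cos_diff algebra_simps)
    moreover have "\<xi> \<bullet> (y - x) = \<xi> $ 1 * (y $ 1 - x $ 1) + \<xi> $ 2 * (y $ 2 - x $ 2) + \<xi> $ 3 * (y $ 3 - x $ 3)"
      by (simp add: inner_vec_def sum_3)
    ultimately show ?thesis unfolding m_def by (simp only:)
  qed
  have each: "\<bar>oct_transform A1 A2 A3 ?g w \<bullet> probe c1 c2 c3\<bar> \<le> 1 / 2 * ?S" for c1 c2 c3
  proof -
    define k where "k = (\<lambda>y::real^3. cos (lct_phase A1 (y $ 1) (w $ 1) + c1) * cos (lct_phase A2 (y $ 2) (w $ 2) + c2) * cos (lct_phase A3 (y $ 3) (w $ 3) + c3))"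
    have [measurable]: "k \<in> borel_measurable borel"
      unfolding k_def by measurable
    have m_le: "\<bar>m \<tau>1 \<tau>2 \<tau>3 y\<bar> \<le> 1" for \<tau>1 \<tau>2 \<tau>3 y
      unfolding m_def abs_mult by (intro mult_le_one) auto
    have k_le: "\<bar>k y\<bar> \<le> 1" for y
      unfolding k_def abs_mult by (intro mult_le_one) auto
    have int: "integrable lborel (\<lambda>y. f y * m \<tau>1 \<tau>2 \<tau>3 y * k y)" for \<tau>1 \<tau>2 \<tau>3
      by (rule integrable_mult_bounded[OF integrable_mult_bounded[OF f _ m_le] _ k_le]) measurable
    have bd: "\<bar>LBINT y. f y * m \<tau>1 \<tau>2 \<tau>3 y * k y\<bar> \<le> 1 / 8 * ?S" for \<tau>1 \<tau>2 \<tau>3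
      unfolding m_def k_def by (rule modulated_transform_bound[OF b f])
    have "oct_transform A1 A2 A3 ?g w \<bullet> probe c1 c2 c3 = (LBINT y. f y * cos (\<xi> \<bullet> (y - x)) * k y)"
      unfolding inner_oct_transform_probe[OF g] k_def ..
    also have "\<dots> = (LBINT y. f y * m 0 0 0 y * k y - f y * m 0 (- pi / 2) (- pi / 2) y * k y - f y * m (- pi / 2) 0 (- pi / 2) y * k y - f y * m (- pi / 2) (- pi / 2) 0 y * k y)"
      unfolding cos3 by (simp add: algebra_simps)
    also have "\<dots> = (LBINT y. f y * m 0 0 0 y * k y) - (LBINT y. f y * m 0 (- pi / 2) (- pi / 2) y * k y) - (LBINT y. f y * m (- pi / 2) 0 (- pi / 2) y * k y) - (LBINT y. f y * m (- pi / 2) (- pi / 2) 0 y * k y)"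
      using int by (simp only: Bochner_Integration.integral_diff Bochner_Integration.integrable_diff)
    finally show ?thesis
      using bd[of 0 0 0] bd[of 0 "- pi / 2" "- pi / 2"] bd[of "- pi / 2" 0 "- pi / 2"] bd[of "- pi / 2" "- pi / 2" 0]
      by linarith
  qed
  have "norm (oct_transform A1 A2 A3 ?g w) \<le> (\<Sum>c1\<in>{0, pi / 2}. \<Sum>c2\<in>{0, pi / 2}. \<Sum>c3\<in>{0, pi / 2}. 1 / 2 * ?S)"
    by (rule order.trans[OF norm_le_probes]) (intro sum_mono each)
  also have "\<dots> = 4 * ?S"
    by (simp only: sum_constant) simp
  finally show ?thesis .
qed

lemma nn_integral_lborel_translate:
  fixes F :: "'a::euclidean_space \<Rightarrow> ennreal"
  assumes "F \<in> borel_measurable borel"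
  shows "(\<integral>\<^sup>+ w. F (w - v) \<partial>lborel) = (\<integral>\<^sup>+ w. F w \<partial>lborel)"
  using nn_integral_distr[of "(+) (- v)" lborel borel F] assms by (simp add: lborel_distr_plus)

text \<open>Valued in \<open>ennreal\<close>, so that estimates make sense before integrability is
  known; integrability is deduced from them at the end.\<close>

abbreviation transform_mass :: "real^2^2 \<Rightarrow> real^2^2 \<Rightarrow> real^2^2 \<Rightarrow> (real^3 \<Rightarrow> real) \<Rightarrow> ennreal" where
  "transform_mass A1 A2 A3 g \<equiv> \<integral>\<^sup>+ w. ennreal (norm (oct_transform A1 A2 A3 g w)) \<partial>lborel"

text \<open>Shifting the frequency does not change the mass, so eight shifts with the factor 4 give
  32. The bound is uniform in \<open>\<xi>\<close>, which is what a superposition of modulations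
  requires.\<close>

lemma nn_integral_cos_modulated_transform_le:
  fixes x \<xi> :: "real^3"
  assumes b: "A1 $ 1 $ 2 \<noteq> 0" "A2 $ 1 $ 2 \<noteq> 0" "A3 $ 1 $ 2 \<noteq> 0" and f: "integrable lborel f"
  shows "(transform_mass A1 A2 A3 (\<lambda>y. f y * cos (\<xi> \<bullet> (y - x)))) \<le>
    32 * (transform_mass A1 A2 A3 f)"
proof -
  have [measurable]: "f \<in> borel_measurable borel" using f by auto
  let ?N = "transform_mass A1 A2 A3 f"
  have shift: "(\<integral>\<^sup>+ w. ennreal (norm (oct_transform A1 A2 A3 f (w - v))) \<partial>lborel) = ?N" for v
    by (rule nn_integral_lborel_translate) measurable
  define G where "G = (\<lambda>\<sigma>1 \<sigma>2 \<sigma>3 w. ennreal (norm (oct_transform A1 A2 A3 f (w - freq_shift A1 A2 A3 \<xi> \<sigma>1 \<sigma>2 \<sigma>3))))"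
  have [measurable]: "G \<sigma>1 \<sigma>2 \<sigma>3 \<in> borel_measurable borel" for \<sigma>1 \<sigma>2 \<sigma>3
    unfolding G_def by measurable
  have G: "(\<integral>\<^sup>+ w. G \<sigma>1 \<sigma>2 \<sigma>3 w \<partial>lborel) = ?N" for \<sigma>1 \<sigma>2 \<sigma>3
    unfolding G_def by (rule shift)
  have "(transform_mass A1 A2 A3 (\<lambda>y. f y * cos (\<xi> \<bullet> (y - x)))) \<le>
    (\<integral>\<^sup>+ w. ennreal 4 * (\<Sum>\<sigma>1\<in>{-1, 1}. \<Sum>\<sigma>2\<in>{-1, 1}. \<Sum>\<sigma>3\<in>{-1, 1}. G \<sigma>1 \<sigma>2 \<sigma>3 w) \<partial>lborel)"
    unfolding G_def
    by (intro nn_integral_mono, simp only: sum_ennreal sum_nonneg norm_ge_zero flip: ennreal_mult'')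
      (intro ennreal_leI cos_modulated_transform_bound b f)
  also have "\<dots> = ennreal 4 * (\<integral>\<^sup>+ w. (\<Sum>\<sigma>1\<in>{-1, 1}. \<Sum>\<sigma>2\<in>{-1, 1}. \<Sum>\<sigma>3\<in>{-1, 1}. G \<sigma>1 \<sigma>2 \<sigma>3 w) \<partial>lborel)"
    by (rule nn_integral_cmult) measurable
  also have "(\<integral>\<^sup>+ w. (\<Sum>\<sigma>1\<in>{-1, 1}. \<Sum>\<sigma>2\<in>{-1, 1}. \<Sum>\<sigma>3\<in>{-1, 1}. G \<sigma>1 \<sigma>2 \<sigma>3 w) \<partial>lborel) =
     (\<Sum>\<sigma>1\<in>{-1, 1::real}. \<Sum>\<sigma>2\<in>{-1, 1::real}. \<Sum>\<sigma>3\<in>{-1, 1::real}. ?N)"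
    by (subst nn_integral_sum, measurable)+ (simp only: G)
  also have "ennreal 4 * \<dots> = 32 * ?N"
    by (simp add: mult.assoc[symmetric])
  finally show ?thesis .
qed

text \<open>Dominated convergence gives convergence of the transforms at every frequency, and
  Fatou's lemma passes the bound on the mass to the limit.\<close>

lemma nn_integral_transform_limit_le:
  assumes f: "integrable lborel f"
    and q [measurable]: "\<And>n. q n \<in> borel_measurable borel" and q_le: "\<And>n y. \<bar>q n y\<bar> \<le> B"
    and lim: "\<And>y. (\<lambda>n. q n y) \<longlonglongrightarrow> q' y"
    and K: "\<And>n. (transform_mass A1 A2 A3 (\<lambda>y. f y * q n y)) \<le> K"
  shows "(transform_mass A1 A2 A3 (\<lambda>y. f y * q' y)) \<le> K"
proof -
  have [measurable]: "f \<in> borel_measurable borel" using f by auto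
  have [measurable]: "q' \<in> borel_measurable borel"
    by (rule borel_measurable_LIMSEQ_metric[OF q lim])
  have conv: "(\<lambda>n. oct_transform A1 A2 A3 (\<lambda>y. f y * q n y) w) \<longlonglongrightarrow> oct_transform A1 A2 A3 (\<lambda>y. f y * q' y) w" for w
    unfolding oct_transform_def
  proof (rule integral_dominated_convergence)
    show "integrable lborel (\<lambda>y. B * \<bar>f y\<bar>)" using f by simp
    show "AE y in lborel. (\<lambda>n. (f y * q n y) *\<^sub>R oct_kernel A1 A2 A3 y w) \<longlonglongrightarrow> (f y * q' y) *\<^sub>R oct_kernel A1 A2 A3 y w"
      by (intro AE_I2 tendsto_intros lim)
    show "AE y in lborel. norm ((f y * q n y) *\<^sub>R oct_kernel A1 A2 A3 y w) \<le> B * \<bar>f y\<bar>" for n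
    proof (intro AE_I2)
      fix y
      show "norm ((f y * q n y) *\<^sub>R oct_kernel A1 A2 A3 y w) \<le> B * \<bar>f y\<bar>"
        using mult_right_mono[OF q_le[of n y] abs_ge_zero[of "f y"]]
        by (simp add: norm_oct_kernel abs_mult mult.commute)
    qed
  qed measurable
  have "(transform_mass A1 A2 A3 (\<lambda>y. f y * q' y)) =
      (\<integral>\<^sup>+ w. liminf (\<lambda>n. ennreal (norm (oct_transform A1 A2 A3 (\<lambda>y. f y * q n y) w))) \<partial>lborel)"
    by (intro nn_integral_cong lim_imp_Liminf[symmetric] tendsto_ennrealI tendsto_norm conv) simp
  also have "\<dots> \<le> liminf (\<lambda>n. transform_mass A1 A2 A3 (\<lambda>y. f y * q n y))"
    by (rule nn_integral_liminf) measurable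
  also have "\<dots> \<le> K"
    by (rule Liminf_le) (auto intro!: always_eventually K)
  finally show ?thesis .
qed

text \<open>By Fubini the transform of the superposition is the superposition of the transforms. Its
  mass is at most the uniform bound for single modulations, weighted by the total mass of the
  nonnegative density.\<close>

lemma nn_integral_transform_cos_superposition_le:
  fixes x :: "real^3" and p :: "real^3 \<Rightarrow> real"
  assumes b: "A1 $ 1 $ 2 \<noteq> 0" "A2 $ 1 $ 2 \<noteq> 0" "A3 $ 1 $ 2 \<noteq> 0" and f: "integrable lborel f"
    and p: "integrable lborel p" "\<And>\<xi>. 0 \<le> p \<xi>"
  shows "(transform_mass A1 A2 A3 (\<lambda>y. f y * (LBINT \<xi>. p \<xi> * cos (\<xi> \<bullet> (y - x))))) \<le>
    ennreal (LBINT \<xi>. p \<xi>) * (32 * (transform_mass A1 A2 A3 f))"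
proof -
  have [measurable]: "f \<in> borel_measurable borel" "p \<in> borel_measurable borel" using f p by auto
  define H where "H = (\<lambda>\<xi> w. oct_transform A1 A2 A3 (\<lambda>y. f y * cos (\<xi> \<bullet> (y - x))) w)"
  have [measurable]: "(\<lambda>q. H (fst q) (snd q)) \<in> borel_measurable (lborel \<Otimes>\<^sub>M lborel)"
    unfolding H_def oct_transform_def by measurable
  let ?N = "transform_mass A1 A2 A3 f"
  have eq: "oct_transform A1 A2 A3 (\<lambda>y. f y * (LBINT \<xi>. p \<xi> * cos (\<xi> \<bullet> (y - x)))) w = (LBINT \<xi>. p \<xi> *\<^sub>R H \<xi> w)" for w
  proof -
    have pi: "integrable lborel (\<lambda>\<xi>. p \<xi> * cos (\<xi> \<bullet> (y - x)))" for y
      by (rule integrable_mult_bounded[OF p(1), where B = 1]) auto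
    have "integrable (lborel \<Otimes>\<^sub>M lborel) (\<lambda>(\<xi>, y). (p \<xi> * f y * cos (\<xi> \<bullet> (y - x))) *\<^sub>R oct_kernel A1 A2 A3 y w)"
    proof (rule Bochner_Integration.integrable_bound)
      show "integrable (lborel \<Otimes>\<^sub>M lborel) (\<lambda>q. p (fst q) * f (snd q))"
        using p f by (intro lborel_pair.integrable_times)
      show "AE q in lborel \<Otimes>\<^sub>M lborel. norm (case q of (\<xi>, y) \<Rightarrow> (p \<xi> * f y * cos (\<xi> \<bullet> (y - x))) *\<^sub>R oct_kernel A1 A2 A3 y w) \<le> norm (p (fst q) * f (snd q))"
        by (intro AE_I2) (auto simp: norm_oct_kernel abs_mult intro!: mult_left_le)
    qed measurable
    from lborel_pair.Fubini_integral[OF this]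
    have "(LBINT y. LBINT \<xi>. (p \<xi> * f y * cos (\<xi> \<bullet> (y - x))) *\<^sub>R oct_kernel A1 A2 A3 y w) =
      (LBINT \<xi>. LBINT y. (p \<xi> * f y * cos (\<xi> \<bullet> (y - x))) *\<^sub>R oct_kernel A1 A2 A3 y w)" .
    moreover have "(LBINT \<xi>. (p \<xi> * f y * cos (\<xi> \<bullet> (y - x))) *\<^sub>R oct_kernel A1 A2 A3 y w) =
       (f y * (LBINT \<xi>. p \<xi> * cos (\<xi> \<bullet> (y - x)))) *\<^sub>R oct_kernel A1 A2 A3 y w" for y
    proof -
      have "(LBINT \<xi>. (p \<xi> * f y * cos (\<xi> \<bullet> (y - x))) *\<^sub>R oct_kernel A1 A2 A3 y w) =
        (LBINT \<xi>. (p \<xi> * cos (\<xi> \<bullet> (y - x))) *\<^sub>R (f y *\<^sub>R oct_kernel A1 A2 A3 y w))"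
        by (simp add: mult_ac)
      also have "\<dots> = (LBINT \<xi>. p \<xi> * cos (\<xi> \<bullet> (y - x))) *\<^sub>R (f y *\<^sub>R oct_kernel A1 A2 A3 y w)"
        using pi by (rule integral_scaleR_left)
      finally show ?thesis by (simp add: mult.commute)
    qed
    moreover have "(LBINT y. (p \<xi> * f y * cos (\<xi> \<bullet> (y - x))) *\<^sub>R oct_kernel A1 A2 A3 y w) = p \<xi> *\<^sub>R H \<xi> w" for \<xi>
      unfolding H_def oct_transform_def Bochner_Integration.integral_scaleR_right[symmetric] scaleR_scaleR
      by (simp only: mult.assoc)
    ultimately show ?thesis unfolding oct_transform_def by simp
  qed
  have "(\<integral>\<^sup>+ w. ennreal (norm (LBINT \<xi>. p \<xi> *\<^sub>R H \<xi> w)) \<partial>lborel) \<le> (\<integral>\<^sup>+ w. \<integral>\<^sup>+ \<xi>. ennreal (p \<xi>) * ennreal (norm (H \<xi> w)) \<partial>lborel \<partial>lborel)"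
  proof (intro nn_integral_mono)
    fix w
    show "ennreal (norm (LBINT \<xi>. p \<xi> *\<^sub>R H \<xi> w)) \<le> (\<integral>\<^sup>+ \<xi>. ennreal (p \<xi>) * ennreal (norm (H \<xi> w)) \<partial>lborel)"
    \<comment> \<open>Without integrability the Bochner integral is 0 and the bound is
      trivial.\<close>
    proof (cases "integrable lborel (\<lambda>\<xi>. p \<xi> *\<^sub>R H \<xi> w)")
      case True
      from integral_norm_bound_ennreal[OF True] show ?thesis
        using p(2) by (simp add: ennreal_mult)
    qed (simp add: not_integrable_integral_eq)
  qed
  also have "\<dots> = (\<integral>\<^sup>+ \<xi>. \<integral>\<^sup>+ w. ennreal (p \<xi>) * ennreal (norm (H \<xi> w)) \<partial>lborel \<partial>lborel)"
    by (rule lborel_pair.Fubini') measurable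
  also have "\<dots> \<le> (\<integral>\<^sup>+ \<xi>. ennreal (p \<xi>) * (32 * ?N) \<partial>lborel)"
  proof (intro nn_integral_mono)
    fix \<xi>
    have "(\<integral>\<^sup>+ w. ennreal (p \<xi>) * ennreal (norm (H \<xi> w)) \<partial>lborel) = ennreal (p \<xi>) * (\<integral>\<^sup>+ w. ennreal (norm (H \<xi> w)) \<partial>lborel)"
      unfolding H_def by (rule nn_integral_cmult) measurable
    also have "\<dots> \<le> ennreal (p \<xi>) * (32 * ?N)"
      unfolding H_def by (intro mult_left_mono nn_integral_cos_modulated_transform_le b f) simp
    finally show "(\<integral>\<^sup>+ w. ennreal (p \<xi>) * ennreal (norm (H \<xi> w)) \<partial>lborel) \<le> ennreal (p \<xi>) * (32 * ?N)" .
  qed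
  also have "\<dots> = (\<integral>\<^sup>+ \<xi>. ennreal (p \<xi>) \<partial>lborel) * (32 * ?N)"
    by (rule nn_integral_multc) measurable
  also have "(\<integral>\<^sup>+ \<xi>. ennreal (p \<xi>) \<partial>lborel) = ennreal (LBINT \<xi>. p \<xi>)"
    using p by (intro nn_integral_eq_integral) auto
  finally show ?thesis unfolding eq .
qed

lemma (in pair_sigma_finite) integral_times:
  fixes f g :: "_ \<Rightarrow> real"
  assumes f: "integrable M1 f" and g: "integrable M2 g"
  shows "(\<integral>p. f (fst p) * g (snd p) \<partial>(M1 \<Otimes>\<^sub>M M2)) = (\<integral>x. f x \<partial>M1) * (\<integral>y. g y \<partial>M2)"
  using integral_fst'[OF integrable_times[OF f g]] by simp

lemma integral_real3_product:
  fixes f1 f2 f3 :: "real \<Rightarrow> real"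
  assumes "integrable lborel f1" "integrable lborel f2" "integrable lborel f3"
  shows "integrable lborel (\<lambda>x::real^3. f3 (x $ 3) * (f2 (x $ 2) * f1 (x $ 1)))"
    and "(LBINT x::real^3. f3 (x $ 3) * (f2 (x $ 2) * f1 (x $ 1))) = (LBINT t. f3 t) * ((LBINT t. f2 t) * (LBINT t. f1 t))"
proof -
  have [measurable]: "f1 \<in> borel_measurable borel" "f2 \<in> borel_measurable borel" "f3 \<in> borel_measurable borel"
    using assms by auto
  have i2: "integrable lborel (\<lambda>p. f2 (fst p) * f1 (snd p))"
    using lborel_pair.integrable_times[OF assms(2,1)] by (simp add: lborel_prod)
  have i3: "integrable lborel (\<lambda>p. f3 (fst p) * (f2 (fst (snd p)) * f1 (snd (snd p))))"
    using lborel_pair.integrable_times[OF assms(3) i2] by (simp add: lborel_prod)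
  then show "integrable lborel (\<lambda>x::real^3. f3 (x $ 3) * (f2 (x $ 2) * f1 (x $ 1)))"
    by (subst integrable_vec3_of_iff[symmetric]) simp_all
  have "(LBINT x::real^3. f3 (x $ 3) * (f2 (x $ 2) * f1 (x $ 1))) = (LBINT p. f3 (fst p) * (f2 (fst (snd p)) * f1 (snd (snd p))))"
    by (subst integral_vec3_of[symmetric]) simp_all
  also have "\<dots> = (LBINT t. f3 t) * (LBINT p. f2 (fst p) * f1 (snd p))"
    using lborel_pair.integral_times[OF assms(3) i2] by (simp add: lborel_prod)
  also have "(LBINT p. f2 (fst p) * f1 (snd p)) = (LBINT t. f2 t) * (LBINT t. f1 t)"
    using lborel_pair.integral_times[OF assms(2,1)] by (simp add: lborel_prod)
  finally show "(LBINT x::real^3. f3 (x $ 3) * (f2 (x $ 2) * f1 (x $ 1))) = (LBINT t. f3 t) * ((LBINT t. f2 t) * (LBINT t. f1 t))" .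
qed

section \<open>Gaussians in three variables\<close>

definition gauss3 :: "real \<Rightarrow> real^3 \<Rightarrow> real" where
  "gauss3 \<sigma> \<xi> = exp (- (\<xi> $ 3 / \<sigma>)\<^sup>2 / 2) * (exp (- (\<xi> $ 2 / \<sigma>)\<^sup>2 / 2) * exp (- (\<xi> $ 1 / \<sigma>)\<^sup>2 / 2))"

lemma gauss3_nonneg: "0 \<le> gauss3 \<sigma> \<xi>"
  by (simp add: gauss3_def)

lemma borel_measurable_gauss3 [measurable]: "gauss3 \<sigma> \<in> borel_measurable borel"
  unfolding gauss3_def[abs_def] by measurable

lemma integrable_gauss3: "\<sigma> > 0 \<Longrightarrow> integrable lborel (gauss3 \<sigma>)"
  unfolding gauss3_def[abs_def] by (intro integral_real3_product integrable_gaussian)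

text \<open>Expanding the cosine of the sum gives one product of three cosines; every other term
  contains a sine, whose Gaussian integral vanishes.\<close>

lemma integral_gauss3_cos:
  assumes \<sigma>: "\<sigma> > 0"
  shows "(LBINT \<xi>. gauss3 \<sigma> \<xi> * cos (\<xi> \<bullet> s)) = (\<sigma> * sqrt (2 * pi)) ^ 3 * gauss3 (1 / \<sigma>) s"
proof -
  define c where "c = (\<lambda>i t. exp (- (t / \<sigma>)\<^sup>2 / 2) * cos (s $ i * t))"
  define d where "d = (\<lambda>i t. exp (- (t / \<sigma>)\<^sup>2 / 2) * sin (s $ i * t))"
  have i: "integrable lborel (c i)" "integrable lborel (d i)" for i
    unfolding c_def d_def
    by (rule integrable_mult_bounded[OF integrable_gaussian[OF \<sigma>], where B = 1]; simp)+
  have c: "(LBINT t. c i t) = \<sigma> * sqrt (2 * pi) * exp (- (\<sigma> * s $ i)\<^sup>2 / 2)" for i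
    unfolding c_def by (rule integral_gaussian_cos[OF \<sigma>])
  have d: "(LBINT t. d i t) = 0" for i
    unfolding d_def by (rule integral_gaussian_sin[OF \<sigma>])
  have "gauss3 \<sigma> \<xi> * cos (\<xi> \<bullet> s) = c 3 (\<xi> $ 3) * (c 2 (\<xi> $ 2) * c 1 (\<xi> $ 1)) - c 3 (\<xi> $ 3) * (d 2 (\<xi> $ 2) * d 1 (\<xi> $ 1))
     - d 3 (\<xi> $ 3) * (c 2 (\<xi> $ 2) * d 1 (\<xi> $ 1)) - d 3 (\<xi> $ 3) * (d 2 (\<xi> $ 2) * c 1 (\<xi> $ 1))" for \<xi>
  proof -
    have "\<xi> \<bullet> s = s $ 1 * \<xi> $ 1 + s $ 2 * \<xi> $ 2 + s $ 3 * \<xi> $ 3"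
      by (simp add: inner_vec_def sum_3 mult.commute)
    then show ?thesis
      by (simp only: gauss3_def c_def d_def cos_add sin_add) (simp add: algebra_simps)
  qed
  then have "(LBINT \<xi>. gauss3 \<sigma> \<xi> * cos (\<xi> \<bullet> s)) = (LBINT \<xi>::real^3. c 3 (\<xi> $ 3) * (c 2 (\<xi> $ 2) * c 1 (\<xi> $ 1)) - c 3 (\<xi> $ 3) * (d 2 (\<xi> $ 2) * d 1 (\<xi> $ 1))
     - d 3 (\<xi> $ 3) * (c 2 (\<xi> $ 2) * d 1 (\<xi> $ 1)) - d 3 (\<xi> $ 3) * (d 2 (\<xi> $ 2) * c 1 (\<xi> $ 1)))"
    by (simp only:)
  also have "\<dots> = (LBINT t. c 3 t) * ((LBINT t. c 2 t) * (LBINT t. c 1 t))"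
    by (simp only: Bochner_Integration.integral_diff Bochner_Integration.integrable_diff integral_real3_product i d
        mult_zero_left mult_zero_right diff_zero)
  also have "\<dots> = (\<sigma> * sqrt (2 * pi)) ^ 3 * gauss3 (1 / \<sigma>) s"
    using \<sigma> by (simp only: c gauss3_def) (simp add: power3_eq_cube mult_ac)
  finally show ?thesis .
qed

section \<open>Autocorrelations and their spectral densities\<close>

definition autocorr :: "(real^3 \<Rightarrow> real) \<Rightarrow> real^3 \<Rightarrow> real" where
  "autocorr \<eta> z = (LBINT v. \<eta> v * \<eta> (v + z))"

lemma borel_measurable_autocorr [measurable]:
  assumes [measurable]: "\<eta> \<in> borel_measurable borel"
  shows "autocorr \<eta> \<in> borel_measurable borel"
  unfolding autocorr_def by measurable

context
  fixes \<eta> :: "real^3 \<Rightarrow> real"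
  assumes \<eta>m [measurable]: "\<eta> \<in> borel_measurable borel"
    and \<eta>2: "integrable lborel (\<lambda>v. (\<eta> v)\<^sup>2)"
begin

lemma translate_L2:
  "integrable lborel (\<lambda>v. (\<eta> (v + z))\<^sup>2)" "(LBINT v. (\<eta> (v + z))\<^sup>2) = (LBINT v. (\<eta> v)\<^sup>2)"
  using lborel_integrable_translate[of "\<lambda>v. (\<eta> v)\<^sup>2" z] lborel_integral_translate[of "\<lambda>v. (\<eta> v)\<^sup>2" z] \<eta>2
  by (simp_all add: add.commute)

lemma integrable_autocorr: "integrable lborel (\<lambda>v. \<eta> v * \<eta> (v + z))"
  using \<eta>2 translate_L2 by (intro integrable_mult_L2) auto

lemma integral_abs_autocorr_le: "(LBINT v. \<bar>\<eta> v * \<eta> (v + z)\<bar>) \<le> (LBINT v. (\<eta> v)\<^sup>2)"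
proof -
  have "(LBINT v. \<bar>\<eta> v * \<eta> (v + z)\<bar>) \<le> (LBINT v. ((\<eta> v)\<^sup>2 + (\<eta> (v + z))\<^sup>2) / 2)"
  proof (rule integral_mono)
    fix v
    show "\<bar>\<eta> v * \<eta> (v + z)\<bar> \<le> ((\<eta> v)\<^sup>2 + (\<eta> (v + z))\<^sup>2) / 2"
      using sum_squares_bound[of "\<bar>\<eta> v\<bar>" "\<bar>\<eta> (v + z)\<bar>"] by (simp add: abs_mult)
  qed (use integrable_autocorr translate_L2 \<eta>2 in auto)
  also have "\<dots> = (LBINT v. (\<eta> v)\<^sup>2)"
    using translate_L2[of z] \<eta>2 by simp
  finally show ?thesis .
qed

lemma abs_autocorr_le: "\<bar>autocorr \<eta> z\<bar> \<le> (LBINT v. (\<eta> v)\<^sup>2)"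
  unfolding autocorr_def
  using integral_abs_autocorr_le[of z] integral_abs_bound[of lborel "\<lambda>v. \<eta> v * \<eta> (v + z)"] by linarith

text \<open>By Cauchy-Schwarz the increment is controlled by the mean-square distance between a
  function and its translate by \<open>s n\<close>.\<close>

lemma autocorr_tendsto:
  assumes s: "s \<longlonglongrightarrow> 0"
  shows "(\<lambda>n. autocorr \<eta> (z + s n)) \<longlonglongrightarrow> autocorr \<eta> z"
proof -
  define T where "T = (\<lambda>n. LBINT p. (\<eta> (p + s n) - \<eta> p)\<^sup>2)"
  have T: "T \<longlonglongrightarrow> 0"
    unfolding T_def using \<eta>m \<eta>2 s by (rule L2_translation_tendsto)
  have le: "(autocorr \<eta> (z + s n) - autocorr \<eta> z)\<^sup>2 \<le> (LBINT v. (\<eta> v)\<^sup>2) * T n" for n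
  proof -
    have d: "integrable lborel (\<lambda>v. (\<eta> (v + s n) - \<eta> v)\<^sup>2)"
      using \<eta>2 translate_L2 by (intro integrable_diff_L2) auto
    have d': "integrable lborel (\<lambda>v. (\<eta> (v + (z + s n)) - \<eta> (v + z))\<^sup>2)" "(LBINT v. (\<eta> (v + (z + s n)) - \<eta> (v + z))\<^sup>2) = T n"
      using lborel_integrable_translate[of "\<lambda>v. (\<eta> (v + s n) - \<eta> v)\<^sup>2" z] lborel_integral_translate[of "\<lambda>v. (\<eta> (v + s n) - \<eta> v)\<^sup>2" z] d
      by (simp_all add: T_def add_ac)
    have "autocorr \<eta> (z + s n) - autocorr \<eta> z = (LBINT v. \<eta> v * (\<eta> (v + (z + s n)) - \<eta> (v + z)))"
      unfolding autocorr_def right_diff_distrib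
      by (rule Bochner_Integration.integral_diff[symmetric]) (rule integrable_autocorr)+
    then show ?thesis
      using integral_mult_L2_le[of \<eta> lborel "\<lambda>v. \<eta> (v + (z + s n)) - \<eta> (v + z)"] \<eta>2 d' by simp
  qed
  have "(\<lambda>n. (LBINT v. (\<eta> v)\<^sup>2) * T n) \<longlonglongrightarrow> (LBINT v. (\<eta> v)\<^sup>2) * 0"
    by (intro tendsto_intros T)
  then have "(\<lambda>n. (autocorr \<eta> (z + s n) - autocorr \<eta> z)\<^sup>2) \<longlonglongrightarrow> 0"
    using le by (intro tendsto_sandwich[of "\<lambda>_. 0" "\<lambda>n. (autocorr \<eta> (z + s n) - autocorr \<eta> z)\<^sup>2"]) auto
  then have "(\<lambda>n. sqrt ((autocorr \<eta> (z + s n) - autocorr \<eta> z)\<^sup>2)) \<longlonglongrightarrow> sqrt 0"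
    by (intro tendsto_real_sqrt)
  then have "(\<lambda>n. autocorr \<eta> (z + s n) - autocorr \<eta> z) \<longlonglongrightarrow> 0"
    by (simp add: tendsto_rabs_zero_iff)
  then show ?thesis by (rule LIM_zero_cancel)
qed

lemma isCont_autocorr: "isCont (autocorr \<eta>) z"
  unfolding continuous_at_sequentially comp_def
proof (intro allI impI)
  fix u assume "u \<longlonglongrightarrow> z"
  then have "(\<lambda>n. u n - z) \<longlonglongrightarrow> 0" by (simp add: LIM_zero)
  from autocorr_tendsto[OF this, of z] show "(\<lambda>n. autocorr \<eta> (u n)) \<longlonglongrightarrow> autocorr \<eta> z" by simp
qed

text \<open>The squared modulus of the Fourier integral of \<open>\<eta>\<close>, written with real
  integrals. For integrable \<open>\<eta>\<close> the Fourier integral is bounded, and the Gaussian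
  then makes the density integrable.\<close>

definition spectral_density :: "nat \<Rightarrow> real^3 \<Rightarrow> real" where
  "spectral_density n \<xi> = gauss3 (real (Suc n)) \<xi> * ((LBINT v. \<eta> v * cos (\<xi> \<bullet> v))\<^sup>2 + (LBINT v. \<eta> v * sin (\<xi> \<bullet> v))\<^sup>2)"

text \<open>The prefactor is what the Fourier transform of the Gaussian leaves behind. The Gaussian
  average is not normalised; its mass supplies the other half of the factor
  \<open>(2 * pi) ^ 3\<close> in the limit.\<close>

definition smoothed_autocorr :: "nat \<Rightarrow> real^3 \<Rightarrow> real" where
  "smoothed_autocorr n z = (sqrt (2 * pi)) ^ 3 * (LBINT t. gauss3 1 t * autocorr \<eta> (z + (1 / real (Suc n)) *\<^sub>R t))"

lemma integral_gauss3_1: "(LBINT t. gauss3 1 t) = (sqrt (2 * pi)) ^ 3"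
  using integral_gauss3_cos[of 1 0] by (simp add: gauss3_def)

lemma integrable_gauss3_autocorr: "integrable lborel (\<lambda>t. gauss3 1 t * autocorr \<eta> (z + c *\<^sub>R t))"
  by (rule integrable_mult_bounded[OF integrable_gauss3 _ abs_autocorr_le]) auto

text \<open>The bound is uniform in \<open>n\<close>. At \<open>z = 0\<close> it will bound the
  total mass of the spectral density.\<close>

lemma abs_smoothed_autocorr_le: "\<bar>smoothed_autocorr n z\<bar> \<le> (2 * pi) ^ 3 * (LBINT v. (\<eta> v)\<^sup>2)"
proof -
  have "\<bar>LBINT t. gauss3 1 t * autocorr \<eta> (z + (1 / real (Suc n)) *\<^sub>R t)\<bar> \<le> (LBINT t. gauss3 1 t * (LBINT v. (\<eta> v)\<^sup>2))"
    using abs_autocorr_le integrable_gauss3[of 1]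
    by (intro integral_abs_bound[THEN order.trans] integral_mono integrable_abs integrable_gauss3_autocorr)
      (auto simp: abs_mult gauss3_nonneg intro!: mult_left_mono)
  also have "\<dots> = (sqrt (2 * pi)) ^ 3 * (LBINT v. (\<eta> v)\<^sup>2)"
    by (simp add: integral_gauss3_1)
  finally have "\<bar>smoothed_autocorr n z\<bar> \<le> (sqrt (2 * pi)) ^ 3 * ((sqrt (2 * pi)) ^ 3 * (LBINT v. (\<eta> v)\<^sup>2))"
    unfolding smoothed_autocorr_def abs_mult by (intro mult_mono) auto
  also have "\<dots> = (sqrt (2 * pi) * sqrt (2 * pi)) ^ 3 * (LBINT v. (\<eta> v)\<^sup>2)"
    by (simp only: power_mult_distrib mult.assoc)
  finally show ?thesis by simp
qed

lemma smoothed_autocorr_tendsto: "(\<lambda>n. smoothed_autocorr n z) \<longlonglongrightarrow> (2 * pi) ^ 3 * autocorr \<eta> z"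
proof -
  have "(\<lambda>n. LBINT t. gauss3 1 t * autocorr \<eta> (z + (1 / real (Suc n)) *\<^sub>R t)) \<longlonglongrightarrow> (LBINT t. gauss3 1 t * autocorr \<eta> z)"
  proof (rule integral_dominated_convergence)
    show "integrable lborel (\<lambda>t. gauss3 1 t * (LBINT v. (\<eta> v)\<^sup>2))"
      using integrable_gauss3[of 1] by simp
    show "AE t in lborel. (\<lambda>n. gauss3 1 t * autocorr \<eta> (z + (1 / real (Suc n)) *\<^sub>R t)) \<longlonglongrightarrow> gauss3 1 t * autocorr \<eta> z"
    proof (intro AE_I2 tendsto_mult tendsto_const autocorr_tendsto)
      fix t :: "real^3"
      have "(\<lambda>n. (1 / real (Suc n)) *\<^sub>R t) \<longlonglongrightarrow> 0 *\<^sub>R t"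
        by (intro tendsto_scaleR tendsto_const LIMSEQ_Suc[OF lim_1_over_n])
      then show "(\<lambda>n. (1 / real (Suc n)) *\<^sub>R t) \<longlonglongrightarrow> 0" by simp
    qed
    show "AE t in lborel. norm (gauss3 1 t * autocorr \<eta> (z + (1 / real (Suc n)) *\<^sub>R t)) \<le> gauss3 1 t * (LBINT v. (\<eta> v)\<^sup>2)" for n
      using abs_autocorr_le by (intro AE_I2) (auto simp: abs_mult gauss3_nonneg intro!: mult_left_mono)
  qed measurable
  then have "(\<lambda>n. smoothed_autocorr n z) \<longlonglongrightarrow> (sqrt (2 * pi)) ^ 3 * (LBINT t. gauss3 1 t * autocorr \<eta> z)"
    unfolding smoothed_autocorr_def by (intro tendsto_intros)
  also have "(sqrt (2 * pi)) ^ 3 * (LBINT t. gauss3 1 t * autocorr \<eta> z) = (sqrt (2 * pi) * sqrt (2 * pi)) ^ 3 * autocorr \<eta> z"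
    by (simp only: integral_mult_left_zero integral_gauss3_1 power_mult_distrib mult.assoc)
  finally show ?thesis by simp
qed

context
  assumes \<eta>1: "integrable lborel \<eta>"
begin

lemma integrable_times_trig:
  "integrable lborel (\<lambda>v. \<eta> v * cos (\<xi> \<bullet> v))" "integrable lborel (\<lambda>v. \<eta> v * sin (\<xi> \<bullet> v))"
  by (rule integrable_mult_bounded[OF \<eta>1, where B = 1]; simp)+

lemma spectral_density_nonneg: "0 \<le> spectral_density n \<xi>"
  by (simp add: spectral_density_def gauss3_nonneg)

lemma integrable_spectral_density: "integrable lborel (spectral_density n)"
  unfolding spectral_density_def[abs_def]
proof (rule integrable_mult_bounded[OF integrable_gauss3])
  let ?N = "LBINT v. \<bar>\<eta> v\<bar>"
  have "\<bar>LBINT v. \<eta> v * cos (\<xi> \<bullet> v)\<bar> \<le> ?N" for \<xi>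
    using \<eta>1
    by (intro integral_abs_bound[THEN order.trans] integral_mono integrable_abs integrable_times_trig) (auto simp: abs_mult intro!: mult_left_le)
  moreover have "\<bar>LBINT v. \<eta> v * sin (\<xi> \<bullet> v)\<bar> \<le> ?N" for \<xi>
    using \<eta>1
    by (intro integral_abs_bound[THEN order.trans] integral_mono integrable_abs integrable_times_trig) (auto simp: abs_mult intro!: mult_left_le)
  ultimately have "(LBINT v. \<eta> v * cos (\<xi> \<bullet> v))\<^sup>2 + (LBINT v. \<eta> v * sin (\<xi> \<bullet> v))\<^sup>2 \<le> ?N\<^sup>2 + ?N\<^sup>2" for \<xi>
    by (intro add_mono abs_le_square_iff[THEN iffD1]) auto
  then show "\<bar>(LBINT v. \<eta> v * cos (\<xi> \<bullet> v))\<^sup>2 + (LBINT v. \<eta> v * sin (\<xi> \<bullet> v))\<^sup>2\<bar> \<le> ?N\<^sup>2 + ?N\<^sup>2" for \<xi>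
    by simp
qed auto

text \<open>A Wiener--Khinchin identity: the Gaussian-damped power spectrum is a nonnegative density
  whose cosine transform is a smoothed autocorrelation.\<close>

lemma integral_spectral_density_cos:
  "(LBINT \<xi>. spectral_density n \<xi> * cos (\<xi> \<bullet> z)) = smoothed_autocorr n z"
proof -
  define \<sigma> where "\<sigma> = real (Suc n)"
  have \<sigma>: "\<sigma> > 0" by (simp add: \<sigma>_def)
  let ?K = "\<lambda>v t. (sqrt (2 * pi)) ^ 3 * (gauss3 1 t * (\<eta> v * \<eta> (v + (z + (1 / \<sigma>) *\<^sub>R t))))"
  define C D where "C = (\<lambda>\<xi>. LBINT v. \<eta> v * cos (\<xi> \<bullet> v))" and "D = (\<lambda>\<xi>. LBINT v. \<eta> v * sin (\<xi> \<bullet> v))"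
  \<comment> \<open>The squares become a double integral over \<open>v\<close> and
    \<open>v'\<close>; the terms with the sine of \<open>\<xi> \<bullet> z\<close> cancel by the
    symmetry between the two variables.\<close>
  have double: "((C \<xi>)\<^sup>2 + (D \<xi>)\<^sup>2) * cos (\<xi> \<bullet> z) = (LBINT v. \<eta> v * (LBINT v'. \<eta> v' * cos (\<xi> \<bullet> (v' - v - z))))" for \<xi>
  proof -
    let ?c = "cos (\<xi> \<bullet> z)" and ?s = "sin (\<xi> \<bullet> z)"
    have inner: "(LBINT v'. \<eta> v' * cos (\<xi> \<bullet> (v' - v - z))) = C \<xi> * (cos (\<xi> \<bullet> v) * ?c - sin (\<xi> \<bullet> v) * ?s) + D \<xi> * (sin (\<xi> \<bullet> v) * ?c + cos (\<xi> \<bullet> v) * ?s)" for v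
    proof -
      have "\<eta> v' * cos (\<xi> \<bullet> (v' - v - z)) = (\<eta> v' * cos (\<xi> \<bullet> v')) * (cos (\<xi> \<bullet> v) * ?c - sin (\<xi> \<bullet> v) * ?s) +
        (\<eta> v' * sin (\<xi> \<bullet> v')) * (sin (\<xi> \<bullet> v) * ?c + cos (\<xi> \<bullet> v) * ?s)" for v'
        by (simp add: inner_diff_right cos_diff sin_diff) (simp add: algebra_simps)
      then show ?thesis
        using integrable_times_trig by (simp add: C_def D_def)
    qed
    have "\<eta> v * (C \<xi> * (cos (\<xi> \<bullet> v) * ?c - sin (\<xi> \<bullet> v) * ?s) + D \<xi> * (sin (\<xi> \<bullet> v) * ?c + cos (\<xi> \<bullet> v) * ?s)) =
      (\<eta> v * cos (\<xi> \<bullet> v)) * (C \<xi> * ?c + D \<xi> * ?s) + (\<eta> v * sin (\<xi> \<bullet> v)) * (D \<xi> * ?c - C \<xi> * ?s)" for v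
      by (simp add: algebra_simps)
    then have "(LBINT v. \<eta> v * (LBINT v'. \<eta> v' * cos (\<xi> \<bullet> (v' - v - z)))) = C \<xi> * (C \<xi> * ?c + D \<xi> * ?s) + D \<xi> * (D \<xi> * ?c - C \<xi> * ?s)"
      unfolding inner using integrable_times_trig by (simp add: C_def D_def)
    then show ?thesis by (simp add: power2_eq_square algebra_simps)
  qed
  have \<eta>\<eta>: "integrable lborel (\<lambda>p. \<eta> (fst p) * \<eta> (snd p))"
    using lborel_pair.integrable_times[OF \<eta>1 \<eta>1] by (simp add: lborel_prod)
  have [measurable]: "(\<lambda>p. \<eta> (fst p) * \<eta> (snd p)) \<in> borel_measurable borel"
    "(\<lambda>q::(real^3) \<times> (real^3) \<times> (real^3). cos (fst q \<bullet> (snd (snd q) - fst (snd q) - z))) \<in> borel_measurable (lborel \<Otimes>\<^sub>M lborel)"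
    using \<eta>\<eta> by (auto simp: lborel_prod intro!: borel_measurable_continuous_onI continuous_intros)
  have "(LBINT \<xi>. spectral_density n \<xi> * cos (\<xi> \<bullet> z)) = (LBINT \<xi>. LBINT p. gauss3 \<sigma> \<xi> * (\<eta> (fst p) * \<eta> (snd p)) * cos (\<xi> \<bullet> (snd p - fst p - z)))"
  proof (rule Bochner_Integration.integral_cong[OF refl])
    fix \<xi>
    have i: "integrable (lborel \<Otimes>\<^sub>M lborel) (\<lambda>(v, v'). (\<eta> v * \<eta> v') * cos (\<xi> \<bullet> (v' - v - z)))"
      using integrable_mult_bounded[OF \<eta>\<eta>, of "\<lambda>p. cos (\<xi> \<bullet> (snd p - fst p - z))" 1]
      by (simp add: lborel_prod split_beta' borel_measurable_continuous_onI continuous_intros)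
    have "spectral_density n \<xi> * cos (\<xi> \<bullet> z) = gauss3 \<sigma> \<xi> * (LBINT v. LBINT v'. (\<eta> v * \<eta> v') * cos (\<xi> \<bullet> (v' - v - z)))"
      using double[of \<xi>] by (simp add: spectral_density_def C_def D_def \<sigma>_def mult.assoc)
    also have "(LBINT v. LBINT v'. (\<eta> v * \<eta> v') * cos (\<xi> \<bullet> (v' - v - z))) = (LBINT p. (\<eta> (fst p) * \<eta> (snd p)) * cos (\<xi> \<bullet> (snd p - fst p - z)))"
      using lborel_pair.integral_fst[OF i] by (simp add: lborel_prod split_beta')
    finally show "spectral_density n \<xi> * cos (\<xi> \<bullet> z) = (LBINT p. gauss3 \<sigma> \<xi> * (\<eta> (fst p) * \<eta> (snd p)) * cos (\<xi> \<bullet> (snd p - fst p - z)))"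
      by (simp add: mult.assoc)
  qed
  also have "\<dots> = (LBINT p. LBINT \<xi>. gauss3 \<sigma> \<xi> * (\<eta> (fst p) * \<eta> (snd p)) * cos (\<xi> \<bullet> (snd p - fst p - z)))"
  proof (rule lborel_pair.Fubini_integral[symmetric])
    have "integrable (lborel \<Otimes>\<^sub>M lborel) (\<lambda>q::(real^3) \<times> (real^3) \<times> (real^3). (gauss3 \<sigma> (fst q) * (\<eta> (fst (snd q)) * \<eta> (snd (snd q)))) * cos (fst q \<bullet> (snd (snd q) - fst (snd q) - z)))"
      by (rule integrable_mult_bounded[OF lborel_pair.integrable_times[OF integrable_gauss3[OF \<sigma>] \<eta>\<eta>], where B = 1]) auto
    then show "integrable (lborel \<Otimes>\<^sub>M lborel) (\<lambda>(\<xi>, p). gauss3 \<sigma> \<xi> * (\<eta> (fst p) * \<eta> (snd p)) * cos (\<xi> \<bullet> (snd p - fst p - z)))"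
      by (simp add: split_beta')
  qed
  also have "\<dots> = (LBINT p. (\<eta> (fst p) * \<eta> (snd p)) * ((\<sigma> * sqrt (2 * pi)) ^ 3 * gauss3 (1 / \<sigma>) (snd p - fst p - z)))"
  proof (rule Bochner_Integration.integral_cong[OF refl])
    fix p :: "(real^3) \<times> (real^3)"
    have "(LBINT \<xi>. gauss3 \<sigma> \<xi> * (\<eta> (fst p) * \<eta> (snd p)) * cos (\<xi> \<bullet> (snd p - fst p - z))) =
      (LBINT \<xi>. (\<eta> (fst p) * \<eta> (snd p)) * (gauss3 \<sigma> \<xi> * cos (\<xi> \<bullet> (snd p - fst p - z))))"
      by (simp add: mult_ac)
    also have "\<dots> = (\<eta> (fst p) * \<eta> (snd p)) * ((\<sigma> * sqrt (2 * pi)) ^ 3 * gauss3 (1 / \<sigma>) (snd p - fst p - z))"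
      by (simp only: integral_mult_right_zero integral_gauss3_cos[OF \<sigma>])
    finally show "(LBINT \<xi>. gauss3 \<sigma> \<xi> * (\<eta> (fst p) * \<eta> (snd p)) * cos (\<xi> \<bullet> (snd p - fst p - z))) =
       (\<eta> (fst p) * \<eta> (snd p)) * ((\<sigma> * sqrt (2 * pi)) ^ 3 * gauss3 (1 / \<sigma>) (snd p - fst p - z))" .
  qed
  also have "\<dots> = (LBINT v. LBINT v'. (\<eta> v * \<eta> v') * ((\<sigma> * sqrt (2 * pi)) ^ 3 * gauss3 (1 / \<sigma>) (v' - v - z)))"
  proof -
    have "gauss3 \<tau> s \<le> 1" for \<tau> s
      unfolding gauss3_def by (intro mult_le_one) auto
    then have "\<bar>(\<sigma> * sqrt (2 * pi)) ^ 3 * gauss3 (1 / \<sigma>) s\<bar> \<le> (\<sigma> * sqrt (2 * pi)) ^ 3" for s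
      using \<sigma> gauss3_nonneg[of "1 / \<sigma>" s] by (simp add: abs_mult mult_left_le)
    moreover have "(\<lambda>p. (\<sigma> * sqrt (2 * pi)) ^ 3 * gauss3 (1 / \<sigma>) (snd p - fst p - z)) \<in> borel_measurable lborel"
      using measurable_compose[of "\<lambda>p. snd p - fst p - z" borel borel "gauss3 (1 / \<sigma>)"]
      by (simp add: borel_measurable_continuous_onI continuous_intros)
    ultimately have "integrable lborel (\<lambda>p. (\<eta> (fst p) * \<eta> (snd p)) * ((\<sigma> * sqrt (2 * pi)) ^ 3 * gauss3 (1 / \<sigma>) (snd p - fst p - z)))"
      by (intro integrable_mult_bounded[OF \<eta>\<eta>])
    then show ?thesis
      using lborel_pair.integral_fst[of "\<lambda>v v'. (\<eta> v * \<eta> v') * ((\<sigma> * sqrt (2 * pi)) ^ 3 * gauss3 (1 / \<sigma>) (v' - v - z))"]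
      by (simp add: lborel_prod split_beta')
  qed
  also have "\<dots> = (LBINT v. LBINT t. ?K v t)"
  proof (rule Bochner_Integration.integral_cong[OF refl])
    fix v
    let ?F = "\<lambda>v'. (\<eta> v * \<eta> v') * ((\<sigma> * sqrt (2 * pi)) ^ 3 * gauss3 (1 / \<sigma>) (v' - v - z))"
    have F: "?F \<in> borel_measurable borel" by measurable
    \<comment> \<open>The substitution \<open>v' = v + z + t / \<sigma>\<close> turns the Gaussian
      into one of unit scale, and its Jacobian cancels the cube of \<open>\<sigma>\<close> from
      \<open>integral_gauss3_cos\<close>.\<close>
    have "(LBINT v'. ?F v') = (\<integral>v'. ?F v' \<partial>(density (distr lborel borel (\<lambda>t. (v + z) + (1 / \<sigma>) *\<^sub>R t)) (\<lambda>_. \<bar>1 / \<sigma>\<bar> ^ DIM(real^3))))"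
      using \<sigma> by (subst lborel_affine[of "1 / \<sigma>" "v + z"]) auto
    also have "\<dots> = (LBINT t. \<bar>1 / \<sigma>\<bar> ^ 3 *\<^sub>R ?F ((v + z) + (1 / \<sigma>) *\<^sub>R t))"
      using F by (subst integral_density) (auto simp: integral_distr)
    also have "\<dots> = (LBINT t. ?K v t)"
    proof (rule Bochner_Integration.integral_cong[OF refl])
      fix t :: "real^3"
      have "gauss3 (1 / \<sigma>) ((v + z) + (1 / \<sigma>) *\<^sub>R t - v - z) = gauss3 1 t"
        using \<sigma> by (simp add: gauss3_def)
      moreover have "\<bar>1 / \<sigma>\<bar> ^ 3 * (\<sigma> * sqrt (2 * pi)) ^ 3 = (sqrt (2 * pi)) ^ 3"
        using \<sigma> by (simp add: power_mult_distrib[symmetric])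
      ultimately show "\<bar>1 / \<sigma>\<bar> ^ 3 *\<^sub>R ?F ((v + z) + (1 / \<sigma>) *\<^sub>R t) = ?K v t"
        by (simp add: add.assoc)
    qed
    finally show "(LBINT v'. ?F v') = (LBINT t. ?K v t)" .
  qed
  also have "\<dots> = (LBINT t. LBINT v. ?K v t)"
  proof (rule lborel_pair.Fubini_integral, rule lborel_pair.Fubini_integrable)
    show "(\<lambda>(t, v). ?K v t) \<in> borel_measurable (lborel \<Otimes>\<^sub>M lborel)"
      by measurable
    show "AE t in lborel. integrable lborel (\<lambda>v. case (t, v) of (t, v) \<Rightarrow> ?K v t)"
      using integrable_autocorr by (intro AE_I2) simp
    have eq: "(LBINT v. norm (case (t, v) of (t, v) \<Rightarrow> ?K v t)) =
      (sqrt (2 * pi)) ^ 3 * (gauss3 1 t * (LBINT v. \<bar>\<eta> v * \<eta> (v + (z + (1 / \<sigma>) *\<^sub>R t))\<bar>))" for t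
      by (simp add: abs_mult gauss3_nonneg)
    show "integrable lborel (\<lambda>t. LBINT v. norm (case (t, v) of (t, v) \<Rightarrow> ?K v t))"
      unfolding eq
    proof (intro integrable_mult_right integrable_mult_bounded[OF integrable_gauss3])
      show "\<bar>LBINT v. \<bar>\<eta> v * \<eta> (v + (z + (1 / \<sigma>) *\<^sub>R t))\<bar>\<bar> \<le> (LBINT v. (\<eta> v)\<^sup>2)" for t
        using integral_abs_autocorr_le[of "z + (1 / \<sigma>) *\<^sub>R t"] by (subst abs_of_nonneg) auto
    qed (auto, measurable)
  qed
  also have "\<dots> = smoothed_autocorr n z"
    unfolding smoothed_autocorr_def autocorr_def \<sigma>_def integral_mult_right_zero ..
  finally show ?thesis .
qed

text \<open>The smoothed autocorrelations are superpositions of cosines, and the mass of their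
  density is the value at the origin, at most \<open>(2 * pi) ^ 3\<close> times the squared L2 norm
  for every \<open>n\<close>. The limit lemma then removes the smoothing, and the constant does not
  involve the L1 norm of \<open>\<eta>\<close>.\<close>

lemma nn_integral_transform_autocorr_le:
  assumes b: "A1 $ 1 $ 2 \<noteq> 0" "A2 $ 1 $ 2 \<noteq> 0" "A3 $ 1 $ 2 \<noteq> 0" and f: "integrable lborel f"
  shows "(transform_mass A1 A2 A3 (\<lambda>y. f y * ((2 * pi) ^ 3 * autocorr \<eta> (y - x)))) \<le>
    ennreal ((2 * pi) ^ 3 * (LBINT v. (\<eta> v)\<^sup>2)) * (32 * (transform_mass A1 A2 A3 f))"
proof (rule nn_integral_transform_limit_le[OF f])
  show "(\<lambda>n. smoothed_autocorr n (y - x)) \<longlonglongrightarrow> (2 * pi) ^ 3 * autocorr \<eta> (y - x)" for y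
    by (rule smoothed_autocorr_tendsto)
  show "(\<lambda>y. smoothed_autocorr n (y - x)) \<in> borel_measurable borel" for n
    unfolding smoothed_autocorr_def by measurable
  show "\<bar>smoothed_autocorr n (y - x)\<bar> \<le> (2 * pi) ^ 3 * (LBINT v. (\<eta> v)\<^sup>2)" for n y
    by (rule abs_smoothed_autocorr_le)
  fix n
  have "(LBINT \<xi>. spectral_density n \<xi>) = smoothed_autocorr n 0"
    using integral_spectral_density_cos[of n 0] by simp
  then have "(LBINT \<xi>. spectral_density n \<xi>) \<le> (2 * pi) ^ 3 * (LBINT v. (\<eta> v)\<^sup>2)"
    using abs_smoothed_autocorr_le[of n 0] by simp
  then have "ennreal (LBINT \<xi>. spectral_density n \<xi>) * (32 * (transform_mass A1 A2 A3 f)) \<le>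
    ennreal ((2 * pi) ^ 3 * (LBINT v. (\<eta> v)\<^sup>2)) * (32 * (transform_mass A1 A2 A3 f))"
    by (intro mult_right_mono ennreal_leI) auto
  with nn_integral_transform_cos_superposition_le[OF b f integrable_spectral_density spectral_density_nonneg, of n x]
  show "(transform_mass A1 A2 A3 (\<lambda>y. f y * smoothed_autocorr n (y - x))) \<le>
    ennreal ((2 * pi) ^ 3 * (LBINT v. (\<eta> v)\<^sup>2)) * (32 * (transform_mass A1 A2 A3 f))"
    unfolding integral_spectral_density_cos by (rule order.trans)
qed

end

end

text \<open>Truncating the window in value and in space makes it integrable without increasing its
  L2 norm. The preceding bound therefore holds uniformly for the truncations, and a second use of
  the limit lemma gives it for the window itself.\<close>

lemma integrable_transform_autocorr:
  fixes \<phi> :: "real^3 \<Rightarrow> real"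
  assumes b: "A1 $ 1 $ 2 \<noteq> 0" "A2 $ 1 $ 2 \<noteq> 0" "A3 $ 1 $ 2 \<noteq> 0" and f: "integrable lborel f"
    and H: "integrable lborel (oct_transform A1 A2 A3 f)"
    and \<phi> [measurable]: "\<phi> \<in> borel_measurable borel" and \<phi>2: "integrable lborel (\<lambda>v. (\<phi> v)\<^sup>2)"
  shows "integrable lborel (oct_transform A1 A2 A3 (\<lambda>y. f y * autocorr \<phi> (y - x)))"
proof -
  have [measurable]: "f \<in> borel_measurable borel" using f by auto
  define g where "g = (\<lambda>n v. if \<bar>\<phi> v\<bar> \<le> real n \<and> norm v \<le> real n then \<phi> v else 0)"
  have [measurable]: "g n \<in> borel_measurable borel" for n
    unfolding g_def by measurable
  have g_le: "\<bar>g n v\<bar> \<le> \<bar>\<phi> v\<bar>" for n v by (simp add: g_def)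
  have g2: "integrable lborel (\<lambda>v. (g n v)\<^sup>2)" "(LBINT v. (g n v)\<^sup>2) \<le> (LBINT v. (\<phi> v)\<^sup>2)" for n
  proof -
    have le: "(g n v)\<^sup>2 \<le> (\<phi> v)\<^sup>2" for v
      using g_le by (simp add: abs_le_square_iff)
    show "integrable lborel (\<lambda>v. (g n v)\<^sup>2)"
      by (rule Bochner_Integration.integrable_bound[OF \<phi>2]) (use le in auto)
    then show "(LBINT v. (g n v)\<^sup>2) \<le> (LBINT v. (\<phi> v)\<^sup>2)"
      using \<phi>2 le by (intro integral_mono) auto
  qed
  have g1: "integrable lborel (g n)" for n
  proof (rule Bochner_Integration.integrable_bound)
    show "integrable lborel (\<lambda>v::real^3. real n * indicat_real (cball 0 (real n)) v)"
      using emeasure_lborel_cball_finite by (intro integrable_mult_right) (auto simp: integrable_indicator_iff)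
  qed (auto simp: g_def indicator_def)
  define K where "K = (2 * pi) ^ 3 * (LBINT v. (\<phi> v)\<^sup>2)"
  define N where "N = (transform_mass A1 A2 A3 f)"
  have "(transform_mass A1 A2 A3 (\<lambda>y. f y * ((2 * pi) ^ 3 * autocorr \<phi> (y - x)))) \<le> ennreal K * (32 * N)"
  proof (rule nn_integral_transform_limit_le[OF f])
    fix n
    show "(\<lambda>y. (2 * pi) ^ 3 * autocorr (g n) (y - x)) \<in> borel_measurable borel" by measurable
    show "\<bar>(2 * pi) ^ 3 * autocorr (g n) (y - x)\<bar> \<le> K" for y
      using abs_autocorr_le[of "g n" "y - x"] g2[of n] unfolding K_def abs_mult by (intro mult_mono) auto
    have "(transform_mass A1 A2 A3 (\<lambda>y. f y * ((2 * pi) ^ 3 * autocorr (g n) (y - x)))) \<le>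
      ennreal ((2 * pi) ^ 3 * (LBINT v. (g n v)\<^sup>2)) * (32 * N)"
      unfolding N_def by (rule nn_integral_transform_autocorr_le[OF _ g2(1) g1 b f]) measurable
    also have "\<dots> \<le> ennreal K * (32 * N)"
      unfolding K_def using g2(2)[of n] by (intro mult_right_mono ennreal_leI mult_left_mono) auto
    finally show "(transform_mass A1 A2 A3 (\<lambda>y. f y * ((2 * pi) ^ 3 * autocorr (g n) (y - x)))) \<le> ennreal K * (32 * N)" .
  next
    fix y
    have "(\<lambda>n. autocorr (g n) z) \<longlonglongrightarrow> autocorr \<phi> z" for z
      unfolding autocorr_def
    proof (rule integral_dominated_convergence)
      show "integrable lborel (\<lambda>v. \<bar>\<phi> v * \<phi> (v + z)\<bar>)"
        using integrable_autocorr[OF \<phi> \<phi>2] by simp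
      have ev: "(\<lambda>n. g n v) \<longlonglongrightarrow> \<phi> v" for v
      proof (rule tendsto_eventually)
        have "\<forall>\<^sub>F n in sequentially. max \<bar>\<phi> v\<bar> (norm v) \<le> real n"
          using filterlim_real_sequentially unfolding filterlim_at_top by blast
        then show "\<forall>\<^sub>F n in sequentially. g n v = \<phi> v"
          by eventually_elim (simp add: g_def)
      qed
      show "AE v in lborel. (\<lambda>n. g n v * g n (v + z)) \<longlonglongrightarrow> \<phi> v * \<phi> (v + z)"
        by (intro AE_I2 tendsto_mult ev)
      show "AE v in lborel. norm (g n v * g n (v + z)) \<le> \<bar>\<phi> v * \<phi> (v + z)\<bar>" for n
        using g_le by (intro AE_I2) (simp add: abs_mult mult_mono)
    qed measurable
    then show "(\<lambda>n. (2 * pi) ^ 3 * autocorr (g n) (y - x)) \<longlonglongrightarrow> (2 * pi) ^ 3 * autocorr \<phi> (y - x)"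
      by (intro tendsto_intros)
  qed
  also have "\<dots> < \<infinity>"
  proof -
    have "N < \<infinity>" using H unfolding N_def integrable_iff_bounded by simp
    then show ?thesis by (simp add: ennreal_mult_less_top)
  qed
  finally have "integrable lborel (oct_transform A1 A2 A3 (\<lambda>y. f y * ((2 * pi) ^ 3 * autocorr \<phi> (y - x))))"
    by (intro integrableI_bounded) auto
  then have "integrable lborel (\<lambda>w. (1 / (2 * pi) ^ 3) *\<^sub>R oct_transform A1 A2 A3 (\<lambda>y. f y * ((2 * pi) ^ 3 * autocorr \<phi> (y - x))) w)"
    by (rule integrable_scaleR_right)
  also have "(\<lambda>w. (1 / (2 * pi) ^ 3) *\<^sub>R oct_transform A1 A2 A3 (\<lambda>y. f y * ((2 * pi) ^ 3 * autocorr \<phi> (y - x))) w) = oct_transform A1 A2 A3 (\<lambda>y. f y * autocorr \<phi> (y - x))"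
    by (rule ext) (simp add: oct_transform_def flip: Bochner_Integration.integral_scaleR_right)
  finally show ?thesis .
qed

section \<open>Reconstruction\<close>

text \<open>This connects the statement, which integrates over the completed measure, with the
  proof, which works with Borel representatives where product measurability is available.\<close>

lemma lebesgue_integral_AE_eq:
  fixes f g :: "'a::euclidean_space \<Rightarrow> 'b::euclidean_space"
  assumes g [measurable]: "g \<in> borel_measurable borel" and eq: "AE x in lborel. f x = g x"
  shows "integrable lebesgue f \<longleftrightarrow> integrable lborel g"
    and "(LINT x|lebesgue. f x) = (LBINT x. g x)"
proof -
  have gl: "g \<in> borel_measurable lebesgue" by (rule measurable_completion) simp
  have eq': "AE x in lebesgue. g x = f x" using eq by (simp add: AE_completion_iff eq_commute)
  have fl: "f \<in> borel_measurable lebesgue" by (rule borel_measurable_AE[OF gl eq'])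
  have "integrable lebesgue f \<longleftrightarrow> integrable lebesgue g"
    using gl fl eq' by (intro integrable_cong_AE) auto
  then show "integrable lebesgue f \<longleftrightarrow> integrable lborel g"
    by (simp add: integrable_completion)
  have "(LINT x|lebesgue. f x) = (LINT x|lebesgue. g x)"
    using gl fl eq' by (intro integral_cong_AE) auto
  then show "(LINT x|lebesgue. f x) = (LBINT x. g x)"
    by (simp add: integral_completion)
qed

lemma AE_lborel_affine:
  fixes c :: "'a::euclidean_space"
  assumes k: "k \<noteq> 0" and P: "AE x in lborel. P x"
  shows "AE x in lborel. P (c + k *\<^sub>R x)"
proof -
  obtain N where N: "N \<in> null_sets lborel" "{x. \<not> P x} \<subseteq> N"
    using P by (auto simp: eventually_ae_filter)
  then have [measurable]: "N \<in> sets borel" by auto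
  have "AE x in lborel. x \<notin> N" using N(1) by (rule AE_not_in)
  then have "AE x in density (distr lborel borel (\<lambda>x. c + k *\<^sub>R x)) (\<lambda>_. \<bar>k\<bar> ^ DIM('a)). x \<notin> N"
    by (subst lborel_affine[OF k, of c, symmetric])
  then have "AE x in distr lborel borel (\<lambda>x. c + k *\<^sub>R x). x \<notin> N"
    using k by (subst (asm) AE_density) (auto simp: ennreal_zero_less_mult_iff)
  then have "AE x in lborel. c + k *\<^sub>R x \<notin> N"
    by (subst (asm) AE_distr_iff) auto
  then show ?thesis
    using N(2) by (auto elim!: eventually_mono)
qed

lemma lborel_integral_reflect:
  fixes F :: "'a::euclidean_space \<Rightarrow> 'b::{banach, second_countable_topology}"
  assumes [measurable]: "F \<in> borel_measurable borel"
  shows "(LBINT u. F (x - u)) = (LBINT v. F v)" "integrable lborel (\<lambda>u. F (x - u)) \<longleftrightarrow> integrable lborel F"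
proof -
  have l: "lborel = distr lborel borel (\<lambda>u::'a. x - u)"
    using lborel_affine[of "-1" x] by (simp add: density_1)
  show "(LBINT u. F (x - u)) = (LBINT v. F v)"
    using integral_distr[of "\<lambda>u. x - u" lborel borel F] by (simp flip: l)
  show "integrable lborel (\<lambda>u. F (x - u)) \<longleftrightarrow> integrable lborel F"
    using integrable_distr_eq[of "\<lambda>u. x - u" lborel borel F] by (simp flip: l)
qed

lemma integral_translation_sq:
  assumes [measurable]: "p \<in> borel_measurable borel" and p2: "integrable lborel (\<lambda>v. (p v)\<^sup>2)"
  shows "integrable lborel (\<lambda>q. (p (q + s) - p q)\<^sup>2)"
    and "(LBINT q. (p (q + s) - p q)\<^sup>2) = 2 * ((LBINT v. (p v)\<^sup>2) - autocorr p s)"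
proof -
  note t = translate_L2[OF assms, of s] and a = integrable_autocorr[OF assms, of s]
  have e: "(p (q + s) - p q)\<^sup>2 = (p (q + s))\<^sup>2 + (p q)\<^sup>2 - 2 * (p q * p (q + s))" for q
    by (simp add: power2_diff mult_ac)
  show "integrable lborel (\<lambda>q. (p (q + s) - p q)\<^sup>2)"
    unfolding e using t a p2 by simp
  show "(LBINT q. (p (q + s) - p q)\<^sup>2) = 2 * ((LBINT v. (p v)\<^sup>2) - autocorr p s)"
    unfolding e using t a p2 by (simp add: autocorr_def)
qed

text \<open>A substitute for the Lebesgue differentiation theorem: along a suitable sequence of radii,
  almost every point is an \<open>L\<^sup>2\<close> Lebesgue point.\<close>

lemma AE_mollified_deviation_tendsto:
  assumes p [measurable]: "p \<in> borel_measurable borel" and p2: "integrable lborel (\<lambda>v. (p v)\<^sup>2)"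
  shows "\<exists>r. (\<forall>n. r n > 0) \<and> r \<longlonglongrightarrow> 0 \<and>
    (AE q in lborel. (\<lambda>n. LBINT s. mollifier (r n) s * (p (q + s) - p q)\<^sup>2) \<longlonglongrightarrow> 0)"
proof -
  define r where "r = (\<lambda>n. 1 / real (Suc n))"
  have r: "r n > 0" for n by (simp add: r_def)
  have r0: "r \<longlonglongrightarrow> 0" unfolding r_def by (rule LIMSEQ_Suc[OF lim_1_over_n])
  let ?N = "LBINT v. (p v)\<^sup>2"
  define T where "T = (\<lambda>s. LBINT q. (p (q + s) - p q)\<^sup>2)"
  have T: "T s = 2 * (?N - autocorr p s)" for s
    unfolding T_def by (rule integral_translation_sq(2)[OF assms])
  have T_cont: "isCont T 0"
    unfolding T[abs_def] by (intro continuous_intros isCont_autocorr[OF assms])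
  have T_le: "\<bar>T s\<bar> \<le> 4 * ?N" for s
  proof -
    have "\<bar>a\<bar> \<le> c \<Longrightarrow> \<bar>2 * (c - a)\<bar> \<le> 4 * c" for a c :: real by (auto simp: abs_le_iff)
    from this[OF abs_autocorr_le[OF assms, of s]] show ?thesis unfolding T .
  qed
  have [measurable]: "T \<in> borel_measurable borel"
    unfolding T[abs_def] by measurable
  have T0: "T 0 = 0" by (simp add: T_def)
  define D where "D = (\<lambda>n q. LBINT s. mollifier (r n) s * (p (q + s) - p q)\<^sup>2)"
  have joint: "integrable (lborel \<Otimes>\<^sub>M lborel) (\<lambda>(s, q). mollifier (r n) s * (p (q + s) - p q)\<^sup>2)" for n
  proof (rule lborel_pair.Fubini_integrable)
    show "AE s in lborel. integrable lborel (\<lambda>q. case (s, q) of (s, q) \<Rightarrow> mollifier (r n) s * (p (q + s) - p q)\<^sup>2)"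
      using integral_translation_sq(1)[OF assms] by simp
    have "(LBINT q. norm (case (s, q) of (s, q) \<Rightarrow> mollifier (r n) s * (p (q + s) - p q)\<^sup>2)) = mollifier (r n) s * T s" for s
      using mollifier_nonneg[OF r, of n s] by (simp add: T_def abs_mult)
    then show "integrable lborel (\<lambda>s. LBINT q. norm (case (s, q) of (s, q) \<Rightarrow> mollifier (r n) s * (p (q + s) - p q)\<^sup>2))"
      using integrable_mult_bounded[OF integrable_mollifier[OF r], of T "4 * ?N" n] T_le by simp
  qed measurable
  have D_int: "integrable lborel (D n)" for n
    unfolding D_def by (rule lborel_pair.integrable_snd[OF joint])
  \<comment> \<open>By Fubini the L1 norm of the deviation is the average of \<open>T\<close> at
    scale \<open>r n\<close>. As \<open>T\<close> is continuous and vanishes at 0, the deviations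
    tend to 0 in L1, hence almost everywhere along a subsequence.\<close>
  have D_eq: "(LBINT q. norm (D n q)) = (LBINT s. mollifier (r n) s *\<^sub>R T (0 + s))" for n
  proof -
    have "D n q \<ge> 0" for q
      unfolding D_def using mollifier_nonneg[OF r] by (intro integral_nonneg_AE) auto
    then have "(LBINT q. norm (D n q)) = (LBINT q. D n q)" by simp
    also have "\<dots> = (LBINT s. LBINT q. mollifier (r n) s * (p (q + s) - p q)\<^sup>2)"
      unfolding D_def by (rule lborel_pair.Fubini_integral[OF joint])
    finally show ?thesis by (simp add: T_def)
  qed
  have "(\<lambda>n. LBINT s. mollifier (r n) s *\<^sub>R T (0 + s)) \<longlonglongrightarrow> T 0"
  proof (rule mollifier_tendsto[OF T_cont r r0])
    show "integrable lborel (\<lambda>s. mollifier (r n) s *\<^sub>R T (0 + s))" for n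
      using integrable_mult_bounded[OF integrable_mollifier[OF r], of T "4 * ?N" n] T_le by simp
  qed
  then have "(\<lambda>n. LBINT q. norm (D n q)) \<longlonglongrightarrow> 0"
    unfolding D_eq T0 .
  from tendsto_L1_AE_subseq[OF D_int this] obtain k where k: "strict_mono k" "AE q in lborel. (\<lambda>n. D (k n) q) \<longlonglongrightarrow> 0"
    by blast
  have "(\<lambda>n. r (k n)) \<longlonglongrightarrow> 0"
    using LIMSEQ_subseq_LIMSEQ[OF r0 k(1)] by (simp add: comp_def)
  then show ?thesis
    using k(2) r unfolding D_def by (intro exI[of _ "\<lambda>n. r (k n)"]) simp
qed

text \<open>The difference splits into \<open>f\<close> times the increment of \<open>p\<close> and
  the increment of \<open>f\<close> times \<open>p q\<close>. Continuity of \<open>f\<close>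
  controls the second; in the first, the increment of \<open>p\<close> is split by the weighted
  arithmetic-geometric inequality, because only its mean square is known to vanish.\<close>

lemma mollified_product_tendsto:
  assumes f: "isCont f x" and p [measurable]: "p \<in> borel_measurable borel" and p2: "integrable lborel (\<lambda>v. (p v)\<^sup>2)"
    and r: "\<And>n. r n > 0" "r \<longlonglongrightarrow> 0"
    and int: "\<And>n. integrable lborel (\<lambda>s. mollifier (r n) s * (f (x + s) * p (q + s)))"
    and D: "(\<lambda>n. LBINT s. mollifier (r n) s * (p (q + s) - p q)\<^sup>2) \<longlonglongrightarrow> 0"
  shows "(\<lambda>n. LBINT s. mollifier (r n) s * (f (x + s) * p (q + s))) \<longlonglongrightarrow> f x * p q"
proof (rule LIMSEQ_I)
  fix \<epsilon> :: real assume \<epsilon>: "\<epsilon> > 0"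
  \<comment> \<open>\<open>A\<close> bounds \<open>f\<close> near \<open>x\<close>, as
    \<open>\<eta>\<close> is at most 1. The first summand contributes at most
    \<open>A * e = \<epsilon> / 4\<close> in the end and the second at most
    \<open>\<epsilon> / 4\<close>.\<close>
  define A where "A = \<bar>f x\<bar> + 1"
  define e where "e = \<epsilon> / (4 * A)"
  define \<eta> where "\<eta> = min 1 (\<epsilon> / (4 * (\<bar>p q\<bar> + 1)))"
  have A: "A > 0" by (simp add: A_def)
  have e: "e > 0" "A * e = \<epsilon> / 4" using \<epsilon> A by (simp_all add: e_def)
  have \<eta>: "\<eta> > 0" "\<eta> \<le> 1" "\<eta> * \<bar>p q\<bar> \<le> \<epsilon> / 4"
  proof -
    show "\<eta> > 0" "\<eta> \<le> 1" using \<epsilon> by (simp_all add: \<eta>_def)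
    have "\<eta> * \<bar>p q\<bar> \<le> \<epsilon> / (4 * (\<bar>p q\<bar> + 1)) * (\<bar>p q\<bar> + 1)"
      using \<epsilon> by (intro mult_mono) (auto simp: \<eta>_def)
    also have "\<dots> = \<epsilon> / 4" by (simp add: field_simps)
    finally show "\<eta> * \<bar>p q\<bar> \<le> \<epsilon> / 4" .
  qed
  obtain d where d: "d > 0" "\<And>y. dist y x < d \<Longrightarrow> dist (f y) (f x) < \<eta>"
    using f \<eta>(1) unfolding continuous_at_eps_delta by metis
  have "\<forall>\<^sub>F n in sequentially. r n < d / 3"
    using order_tendstoD(2)[OF r(2), of "d / 3"] d(1) by simp
  moreover have "\<forall>\<^sub>F n in sequentially. (LBINT s. mollifier (r n) s * (p (q + s) - p q)\<^sup>2) < e\<^sup>2"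
    using order_tendstoD(2)[OF D, of "e\<^sup>2"] e(1) by simp
  ultimately have "\<forall>\<^sub>F n in sequentially. norm ((LBINT s. mollifier (r n) s * (f (x + s) * p (q + s))) - f x * p q) < \<epsilon>"
  proof eventually_elim
    case (elim n)
    let ?m = "mollifier (r n)" and ?\<Delta> = "\<lambda>s. p (q + s) - p q"
    have m: "integrable lborel ?m" "(LBINT s. ?m s) = 1" "0 \<le> ?m s" for s
      using integrable_mollifier[OF r(1)] integral_mollifier[OF r(1)] mollifier_nonneg[OF r(1)] by auto
    have m\<Delta>: "integrable lborel (\<lambda>s. ?m s * (?\<Delta> s)\<^sup>2)"
    proof (rule Bochner_Integration.integrable_bound)
      have "integrable lborel (\<lambda>s. ?m s *\<^sub>R (p (q + s))\<^sup>2)"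
        using integrable_mollifier_scaleR[OF r(1) p2] by simp
      then show "integrable lborel (\<lambda>s. 2 * (?m s * (p (q + s))\<^sup>2) + 2 * (p q)\<^sup>2 * ?m s)"
        using m by simp
      show "AE s in lborel. norm (?m s * (?\<Delta> s)\<^sup>2) \<le> norm (2 * (?m s * (p (q + s))\<^sup>2) + 2 * (p q)\<^sup>2 * ?m s)"
      proof (intro AE_I2)
        fix s
        have "(?\<Delta> s)\<^sup>2 \<le> 2 * (p (q + s))\<^sup>2 + 2 * (p q)\<^sup>2"
          using zero_le_power2[of "p (q + s) + p q"] by (simp add: power2_eq_square algebra_simps)
        from mult_left_mono[OF this m(3)[of s]]
        show "norm (?m s * (?\<Delta> s)\<^sup>2) \<le> norm (2 * (?m s * (p (q + s))\<^sup>2) + 2 * (p q)\<^sup>2 * ?m s)"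
          using m(3)[of s] by (simp add: algebra_simps)
      qed
    qed measurable
    have le: "norm (?m s * (f (x + s) * p (q + s) - f x * p q)) \<le> A / (2 * e) * (?m s * (?\<Delta> s)\<^sup>2) + (A * e / 2 + \<eta> * \<bar>p q\<bar>) * ?m s" for s
    proof (cases "norm s > 3 * r n")
      case False
      then have "dist (f (x + s)) (f x) < \<eta>"
        using elim(1) by (intro d(2)) (simp add: dist_norm)
      then have fs: "\<bar>f (x + s) - f x\<bar> \<le> \<eta>" by (simp add: dist_norm)
      have "\<bar>f (x + s) * p (q + s) - f x * p q\<bar> = \<bar>f (x + s) * ?\<Delta> s + (f (x + s) - f x) * p q\<bar>"
        by (simp add: algebra_simps)
      also have "\<dots> \<le> \<bar>f (x + s)\<bar> * \<bar>?\<Delta> s\<bar> + \<bar>f (x + s) - f x\<bar> * \<bar>p q\<bar>"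
        by (rule order.trans[OF abs_triangle_ineq]) (simp add: abs_mult)
      also have "\<dots> \<le> A * (e / 2 + (?\<Delta> s)\<^sup>2 / (2 * e)) + \<eta> * \<bar>p q\<bar>"
      proof (intro add_mono mult_mono fs)
        show "\<bar>f (x + s)\<bar> \<le> A" using fs \<eta>(2) by (simp add: A_def)
        have "2 * \<bar>?\<Delta> s\<bar> * e \<le> (?\<Delta> s)\<^sup>2 + e\<^sup>2"
          using sum_squares_bound[of "\<bar>?\<Delta> s\<bar>" e] by simp
        then show "\<bar>?\<Delta> s\<bar> \<le> e / 2 + (?\<Delta> s)\<^sup>2 / (2 * e)"
          using e(1) by (simp add: field_simps power2_eq_square)
      qed (use A \<eta> in auto)
      finally have "\<bar>f (x + s) * p (q + s) - f x * p q\<bar> \<le> A * (e / 2 + (?\<Delta> s)\<^sup>2 / (2 * e)) + \<eta> * \<bar>p q\<bar>" .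
      from mult_left_mono[OF this m(3)[of s]] show ?thesis
        using m(3)[of s] by (simp add: abs_mult) (simp add: algebra_simps)
    qed (simp add: mollifier_eq_0 r)
    have diff: "(LBINT s. ?m s * (f (x + s) * p (q + s))) - f x * p q = (LBINT s. ?m s * (f (x + s) * p (q + s) - f x * p q))"
      using int[of n] m(1,2) by (simp add: right_diff_distrib)
    have "norm ((LBINT s. ?m s * (f (x + s) * p (q + s))) - f x * p q) \<le> (LBINT s. A / (2 * e) * (?m s * (?\<Delta> s)\<^sup>2) + (A * e / 2 + \<eta> * \<bar>p q\<bar>) * ?m s)"
      unfolding diff using int[of n] m(1) m\<Delta> le
      by (intro Bochner_Integration.integral_norm_bound_integral) (auto simp: right_diff_distrib)
    also have "\<dots> = A / (2 * e) * (LBINT s. ?m s * (?\<Delta> s)\<^sup>2) + (A * e / 2 + \<eta> * \<bar>p q\<bar>)"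
      unfolding Bochner_Integration.integral_add[OF integrable_mult_right[OF m\<Delta>] integrable_mult_right[OF m(1)]]
        integral_mult_right_zero m(2) mult_1_right ..
    also have "\<dots> \<le> A / (2 * e) * e\<^sup>2 + (A * e / 2 + \<epsilon> / 4)"
      using elim(2) A e(1) \<eta>(3) by (intro add_mono mult_left_mono) auto
    also have "\<dots> = A * e + \<epsilon> / 4"
      using e(1) by (simp add: power2_eq_square field_simps)
    also have "\<dots> < \<epsilon>"
      using e(2) \<epsilon> by simp
    finally show ?case .
  qed
  then show "\<exists>N. \<forall>n\<ge>N. norm ((LBINT s. mollifier (r n) s * (f (x + s) * p (q + s))) - f x * p q) < \<epsilon>"
    unfolding eventually_sequentially .
qed

text \<open>The rotations are invertible and their inverses are rotations, so the norm bound also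
  holds in the reverse direction.\<close>

lemma integrable_oct_unkernelD:
  assumes [measurable]: "H \<in> borel_measurable borel"
    and int: "integrable lborel (\<lambda>w. oct_unkernel A1 A2 A3 x w (H w))"
  shows "integrable lborel H"
proof (rule Bochner_Integration.integrable_bound)
  show "integrable lborel (\<lambda>w. rot_bound * norm (oct_unkernel A1 A2 A3 x w (H w)))"
    using int by simp
  have "norm z \<le> rot_bound * norm (oct_unkernel A1 A2 A3 x w z)" for w z
  proof -
    let ?U = "oct_unkernel A1 A2 A3 x w z"
    have "z = rot (rmul mu4) (lct_phase A3 (x $ 3) (w $ 3)) (rot (rmul mu2) (lct_phase A2 (x $ 2) (w $ 2)) (rot (rmul mu1) (lct_phase A1 (x $ 1) (w $ 1)) ?U))"
      by (simp add: oct_unkernel_def complex_structure_rmul[THEN complex_structure.rot_rot])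
    also have "norm \<dots> \<le> (1 + onorm (rmul mu4)) * ((1 + onorm (rmul mu2)) * ((1 + onorm (rmul mu1)) * norm ?U))"
      by (intro rmul_rot_le_imp rmul_rot_le)
    finally show ?thesis by (simp add: rot_bound_def mult_ac)
  qed
  then show "AE w in lborel. norm (H w) \<le> norm (rot_bound * norm (oct_unkernel A1 A2 A3 x w (H w)))"
    using rot_bound_pos by (intro AE_I2) simp
qed measurable

lemma lct_scale_pos: "A $ 1 $ 2 \<noteq> 0 \<Longrightarrow> 0 < lct_scale A"
  by (simp add: lct_scale_def)

lemma stolct_eq:
  assumes [measurable]: "f \<in> borel_measurable borel" "p \<in> borel_measurable borel"
    and eq: "AE v in lborel. \<phi> v = p v"
  shows "stolct A1 A2 A3 \<phi> f w u =
    (1 / sqrt (lct_scale A1 * lct_scale A2 * lct_scale A3)) *\<^sub>R oct_transform A1 A2 A3 (\<lambda>y. f y * p (y - u)) w"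
proof -
  have "AE y in lborel. \<phi> (y - u) = p (y - u)"
    using AE_lborel_affine[OF _ eq, of 1 "- u"] by simp
  then have "AE y in lborel. (1 / sqrt (lct_scale A1 * lct_scale A2 * lct_scale A3)) *\<^sub>R ((f y * \<phi> (y - u)) *\<^sub>R oct_kernel A1 A2 A3 y w) =
    (1 / sqrt (lct_scale A1 * lct_scale A2 * lct_scale A3)) *\<^sub>R ((f y * p (y - u)) *\<^sub>R oct_kernel A1 A2 A3 y w)"
    by eventually_elim simp
  from lebesgue_integral_AE_eq(2)[OF _ this] show ?thesis
    unfolding stolct_def olct_kernel_product oct_transform_def
    by (simp only: Bochner_Integration.integral_scaleR_right) measurable
qed

text \<open>For fixed \<open>y\<close> the integral over \<open>u\<close> of the modulus of the two
  window factors is at most the squared L2 norm of \<open>p\<close>. Integrability of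
  \<open>f\<close> then makes the integrand jointly integrable in \<open>y\<close> and
  \<open>u\<close>, and Fubini applies at every frequency \<open>w\<close>.\<close>

lemma integral_window_transform:
  assumes f: "integrable lborel f" and p [measurable]: "p \<in> borel_measurable borel" and p2: "integrable lborel (\<lambda>v. (p v)\<^sup>2)"
  shows "integrable lborel (\<lambda>u. p (x - u) *\<^sub>R oct_transform A1 A2 A3 (\<lambda>y. f y * p (y - u)) w)"
    and "(LBINT u. p (x - u) *\<^sub>R oct_transform A1 A2 A3 (\<lambda>y. f y * p (y - u)) w) = oct_transform A1 A2 A3 (\<lambda>y. f y * autocorr p (y - x)) w"
proof -
  have [measurable]: "f \<in> borel_measurable borel" using f by auto
  let ?k = "\<lambda>y. oct_kernel A1 A2 A3 y w"
  have reflect: "(LBINT u. h (p (x - u) * p (y - u))) = (LBINT v. h (p v * p (v + (y - x))))" if [measurable]: "h \<in> borel_measurable borel" for h :: "real \<Rightarrow> real" and y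
    using lborel_integral_reflect(1)[of "\<lambda>v. h (p v * p (v + (y - x)))" x] by (simp add: algebra_simps)
  have refl_int: "integrable lborel (\<lambda>u. p (x - u) * p (y - u))" for y
    using lborel_integral_reflect(2)[of "\<lambda>v. p v * p (v + (y - x))" x] integrable_autocorr[OF p p2, of "y - x"] by (simp add: algebra_simps)
  have joint: "integrable (lborel \<Otimes>\<^sub>M lborel) (\<lambda>(y, u). (f y * (p (x - u) * p (y - u))) *\<^sub>R ?k y)"
  proof (rule lborel_pair.Fubini_integrable)
    show "AE y in lborel. integrable lborel (\<lambda>u. case (y, u) of (y, u) \<Rightarrow> (f y * (p (x - u) * p (y - u))) *\<^sub>R ?k y)"
      using refl_int by simp
    have "(LBINT u. norm (case (y, u) of (y, u) \<Rightarrow> (f y * (p (x - u) * p (y - u))) *\<^sub>R ?k y)) = \<bar>f y\<bar> * (LBINT v. \<bar>p v * p (v + (y - x))\<bar>)" for y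
      using reflect[of abs y] by (simp add: norm_oct_kernel abs_mult)
    moreover have "integrable lborel (\<lambda>y. \<bar>f y\<bar> * (LBINT v. \<bar>p v * p (v + (y - x))\<bar>))"
    proof (rule integrable_mult_bounded)
      show "integrable lborel (\<lambda>y. \<bar>f y\<bar>)" using f by simp
      show "\<bar>LBINT v. \<bar>p v * p (v + (y - x))\<bar>\<bar> \<le> (LBINT v. (p v)\<^sup>2)" for y
        using integral_abs_autocorr_le[OF p p2, of "y - x"] by (subst abs_of_nonneg) auto
    qed measurable
    ultimately show "integrable lborel (\<lambda>y. LBINT u. norm (case (y, u) of (y, u) \<Rightarrow> (f y * (p (x - u) * p (y - u))) *\<^sub>R ?k y))"
      by (simp only:)
  qed measurable
  have inner: "p (x - u) *\<^sub>R oct_transform A1 A2 A3 (\<lambda>y. f y * p (y - u)) w = (LBINT y. (f y * (p (x - u) * p (y - u))) *\<^sub>R ?k y)" for u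
    unfolding oct_transform_def Bochner_Integration.integral_scaleR_right[symmetric] by (simp add: mult_ac)
  show "integrable lborel (\<lambda>u. p (x - u) *\<^sub>R oct_transform A1 A2 A3 (\<lambda>y. f y * p (y - u)) w)"
    unfolding inner by (rule lborel_pair.integrable_snd[OF joint])
  have "(LBINT u. p (x - u) *\<^sub>R oct_transform A1 A2 A3 (\<lambda>y. f y * p (y - u)) w) = (LBINT y. LBINT u. (f y * (p (x - u) * p (y - u))) *\<^sub>R ?k y)"
    unfolding inner by (rule lborel_pair.Fubini_integral[OF joint])
  also have "\<dots> = (LBINT y. (f y * autocorr p (y - x)) *\<^sub>R ?k y)"
  proof (rule Bochner_Integration.integral_cong[OF refl])
    fix y
    show "(LBINT u. (f y * (p (x - u) * p (y - u))) *\<^sub>R ?k y) = (f y * autocorr p (y - x)) *\<^sub>R ?k y"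
      using refl_int[of y] reflect[of "\<lambda>t. t" y] by (simp add: autocorr_def)
  qed
  finally show "(LBINT u. p (x - u) *\<^sub>R oct_transform A1 A2 A3 (\<lambda>y. f y * p (y - u)) w) = oct_transform A1 A2 A3 (\<lambda>y. f y * autocorr p (y - x)) w"
    unfolding oct_transform_def .
qed

text \<open>The double integral is read as an iterated integral in either order. With
  \<open>u\<close> inside, both integrations are proved to converge. With \<open>w\<close> inside,
  the inner integrand is a rotated transform of the windowed signal, which need not be integrable
  for a rough window, so its integrability for almost every \<open>u\<close> is a premise of that
  half.\<close>

theorem theorem4p4:
  fixes A1 A2 A3 :: "real^2^2" and \<phi> f :: "real^3 \<Rightarrow> real"
  assumes "det A1 = 1" and "A1 $ 1 $ 2 \<noteq> 0"
    and "det A2 = 1" and "A2 $ 1 $ 2 \<noteq> 0"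
    and "det A3 = 1" and "A3 $ 1 $ 2 \<noteq> 0"
    and "in_L2 \<phi>" and "\<not> (AE x in lebesgue. \<phi> x = 0)"
    and "in_L2 f" and "continuous_on UNIV f"
    and "integrable lebesgue f" and "integrable lebesgue (olct A1 A2 A3 f)"
  shows "\<forall>x :: real^3.
    ((\<forall>w. integrable lebesgue (\<lambda>u. stolct_inv_integrand A1 A2 A3 \<phi> f x w u)) \<and>
     integrable lebesgue (\<lambda>w. LINT u|lebesgue. stolct_inv_integrand A1 A2 A3 \<phi> f x w u) \<and>
     oreal (f x) = (1 / (L2_norm_fun \<phi>)\<^sup>2) *\<^sub>R
       (LINT w|lebesgue. LINT u|lebesgue. stolct_inv_integrand A1 A2 A3 \<phi> f x w u)) \<and>
    ((AE u in lebesgue. integrable lebesgue (\<lambda>w. stolct_inv_integrand A1 A2 A3 \<phi> f x w u)) \<longrightarrow>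
     integrable lebesgue (\<lambda>u. LINT w|lebesgue. stolct_inv_integrand A1 A2 A3 \<phi> f x w u) \<and>
     oreal (f x) = (1 / (L2_norm_fun \<phi>)\<^sup>2) *\<^sub>R
       (LINT u|lebesgue. LINT w|lebesgue. stolct_inv_integrand A1 A2 A3 \<phi> f x w u))"
proof (intro allI)
  fix x :: "real^3"
  let ?S = "stolct_inv_integrand A1 A2 A3 \<phi> f x"
  note b = assms(2,4,6)
  define C where "C = lct_scale A1 * lct_scale A2 * lct_scale A3"
  have C: "C > 0" unfolding C_def using b by (intro mult_pos_pos lct_scale_pos)
  have fm [measurable]: "f \<in> borel_measurable borel"
    using assms(10) by (rule borel_measurable_continuous_onI)
  have f_cont: "isCont f y" for y
    using assms(10) by (simp add: continuous_on_eq_continuous_at)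
  have f: "integrable lborel f"
    using assms(11) by (simp add: integrable_completion)
  have f2: "integrable lborel (\<lambda>v. (f v)\<^sup>2)"
    using assms(9) by (simp add: in_L2_def integrable_completion)
  have "olct A1 A2 A3 f = (\<lambda>w. (1 / sqrt C) *\<^sub>R oct_transform A1 A2 A3 f w)"
  proof
    fix w
    have "olct A1 A2 A3 f w = (LINT y|lebesgue. (1 / sqrt C) *\<^sub>R (f y *\<^sub>R oct_kernel A1 A2 A3 y w))"
      unfolding olct_def olct_kernel_product C_def ..
    also have "\<dots> = (LBINT y. (1 / sqrt C) *\<^sub>R (f y *\<^sub>R oct_kernel A1 A2 A3 y w))"
      by (rule integral_completion) measurable
    finally show "olct A1 A2 A3 f w = (1 / sqrt C) *\<^sub>R oct_transform A1 A2 A3 f w"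
      unfolding oct_transform_def Bochner_Integration.integral_scaleR_right .
  qed
  then have "integrable lborel (\<lambda>w. (1 / sqrt C) *\<^sub>R oct_transform A1 A2 A3 f w)"
    using assms(12) by (simp add: integrable_completion)
  then have "integrable lborel (\<lambda>w. sqrt C *\<^sub>R ((1 / sqrt C) *\<^sub>R oct_transform A1 A2 A3 f w))"
    by (rule integrable_scaleR_right)
  then have H: "integrable lborel (oct_transform A1 A2 A3 f)"
    using C by simp
  \<comment> \<open>The window is only Lebesgue measurable. A Borel representative replaces it, and
    the equality almost everywhere passes to its reflected translates.\<close>
  obtain p where p [measurable]: "p \<in> borel_measurable borel" and \<phi>p: "AE v in lborel. \<phi> v = p v"
    using completion_ex_borel_measurable_real[of \<phi> lborel] assms(7) by (auto simp: in_L2_def)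
  have sq: "AE v in lborel. (\<phi> v)\<^sup>2 = (p v)\<^sup>2"
    using \<phi>p by eventually_elim simp
  have p2: "integrable lborel (\<lambda>v. (p v)\<^sup>2)"
    using lebesgue_integral_AE_eq(1)[OF _ sq] assms(7) by (simp add: in_L2_def)
  define N where "N = (LBINT v. (p v)\<^sup>2)"
  have norm_eq: "(L2_norm_fun \<phi>)\<^sup>2 = N"
    using lebesgue_integral_AE_eq(2)[OF _ sq] by (simp add: L2_norm_fun_def N_def)
  have N: "N > 0"
  proof -
    have "N \<noteq> 0"
    proof
      assume "N = 0"
      then have "AE v in lborel. (p v)\<^sup>2 = 0"
        unfolding N_def using p2 by (subst (asm) integral_nonneg_eq_0_iff_AE) auto
      then have "AE v in lborel. \<phi> v = 0"
        using \<phi>p by eventually_elim simp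
      then show False using assms(8) by (simp add: AE_completion_iff)
    qed
    moreover have "N \<ge> 0" by (simp add: N_def)
    ultimately show ?thesis by simp
  qed
  have f_eq: "oreal (f x) = (1 / (L2_norm_fun \<phi>)\<^sup>2) *\<^sub>R ((f x * N) *\<^sub>R oreal 1)"
    unfolding norm_eq using N by (simp add: oreal_def)
  let ?T = "\<lambda>u. oct_transform A1 A2 A3 (\<lambda>y. f y * p (y - u))"
  let ?U = "oct_unkernel A1 A2 A3 x"
  \<comment> \<open>The forward and the inverse kernels contribute \<open>1 / sqrt C\<close>
    each.\<close>
  have integrand: "?S w u = (1 / C) *\<^sub>R (\<phi> (x - u) *\<^sub>R ?U w (?T u w))" for w u
  proof -
    have "?U w ((1 / sqrt C) *\<^sub>R z) = (1 / sqrt C) *\<^sub>R ?U w z" for z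
      by (rule linear_scale[OF bounded_linear.linear[OF bounded_linear_oct_unkernel]])
    moreover have "1 / sqrt C * (1 / sqrt C) = 1 / C" using C by simp
    ultimately show ?thesis
      unfolding stolct_inv_integrand_def stolct_inv_kernel_product stolct_eq[OF fm p \<phi>p] C_def[symmetric]
      by (simp add: mult.left_commute)
  qed
  have \<phi>xu: "AE u in lborel. \<phi> (x - u) = p (x - u)"
    using AE_lborel_affine[OF _ \<phi>p, of "-1" x] by simp
  define G where "G = oct_transform A1 A2 A3 (\<lambda>y. f y * autocorr p (y - x))"
  have G: "integrable lborel G"
    unfolding G_def by (rule integrable_transform_autocorr[OF b f H p p2])
  then have [measurable]: "G \<in> borel_measurable borel" by auto
  have u_integral: "integrable lebesgue (\<lambda>u. ?S w u) \<and>
      (LINT u|lebesgue. ?S w u) = (1 / C) *\<^sub>R ?U w (G w)" for w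
  proof -
    note window = integral_window_transform[OF f p p2, of x A1 A2 A3 w]
    have lin: "p (x - u) *\<^sub>R ?U w (?T u w) = ?U w (p (x - u) *\<^sub>R ?T u w)" for u
      by (rule linear_scale[OF bounded_linear.linear[OF bounded_linear_oct_unkernel], symmetric])
    have int: "integrable lborel (\<lambda>u. (1 / C) *\<^sub>R (p (x - u) *\<^sub>R ?U w (?T u w)))"
      unfolding lin by (intro integrable_scaleR_right integrable_bounded_linear[OF bounded_linear_oct_unkernel] window(1))
    have "(LBINT u. (1 / C) *\<^sub>R (p (x - u) *\<^sub>R ?U w (?T u w))) = (1 / C) *\<^sub>R ?U w (G w)"
      unfolding lin Bochner_Integration.integral_scaleR_right integral_bounded_linear[OF bounded_linear_oct_unkernel window(1)]
        window(2) G_def ..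
    moreover have "AE u in lborel. ?S w u = (1 / C) *\<^sub>R (p (x - u) *\<^sub>R ?U w (?T u w))"
      using \<phi>xu by eventually_elim (simp add: integrand)
    ultimately show ?thesis
      using lebesgue_integral_AE_eq[of "\<lambda>u. (1 / C) *\<^sub>R (p (x - u) *\<^sub>R ?U w (?T u w))"] int by auto
  qed
  have acorr_cont: "isCont (\<lambda>y. autocorr p (y - x)) x"
    using isCont_o2[of x "\<lambda>y. y - x" "autocorr p"] isCont_autocorr[OF p p2] by simp
  \<comment> \<open>At \<open>x\<close> the autocorrelation is taken at displacement 0, where it
    equals \<open>N\<close>. The product with \<open>f\<close> is continuous there, so any null
    sequence of radii serves.\<close>
  have "(LBINT w. ?U w (G w)) = (C * (f x * N)) *\<^sub>R oreal 1"
    unfolding G_def C_def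
  proof (rule oct_transform_inversion_pointwise[OF b])
    define r where "r = (\<lambda>n. 1 / real (Suc n))"
    show r: "r n > 0" for n by (simp add: r_def)
    show r0: "r \<longlonglongrightarrow> 0" unfolding r_def by (rule LIMSEQ_Suc[OF lim_1_over_n])
    show g: "integrable lborel (\<lambda>y. f y * autocorr p (y - x))"
      by (rule integrable_mult_bounded[OF f _ abs_autocorr_le[OF p p2]]) measurable
    have "(\<lambda>n. LBINT s. mollifier (r n) s *\<^sub>R (f (x + s) * autocorr p ((x + s) - x))) \<longlonglongrightarrow> f x * autocorr p (x - x)"
      by (rule mollifier_tendsto[where h = "\<lambda>y. f y * autocorr p (y - x)"])
        (intro continuous_intros f_cont acorr_cont r r0 integrable_mollifier_scaleR g)+
    then show "(\<lambda>n. LBINT s. mollifier (r n) s * (f (x + s) * autocorr p (x + s - x))) \<longlonglongrightarrow> f x * N"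
      by (simp add: autocorr_def N_def power2_eq_square)
  qed (fold G_def, rule G)
  then have w_integral: "(LBINT w. (1 / C) *\<^sub>R ?U w (G w)) = (f x * N) *\<^sub>R oreal 1"
    using C by simp
  have w_integrable: "integrable lborel (\<lambda>w. (1 / C) *\<^sub>R ?U w (G w))"
    by (intro integrable_scaleR_right integrable_oct_unkernel G)
  have A: "(\<forall>w. integrable lebesgue (\<lambda>u. ?S w u)) \<and>
     integrable lebesgue (\<lambda>w. LINT u|lebesgue. ?S w u) \<and>
     oreal (f x) = (1 / (L2_norm_fun \<phi>)\<^sup>2) *\<^sub>R
       (LINT w|lebesgue. LINT u|lebesgue. ?S w u)"
    using u_integral w_integrable w_integral f_eq by (simp add: integrable_completion integral_completion)
  have B: "integrable lebesgue (\<lambda>u. LINT w|lebesgue. ?S w u) \<and>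
     oreal (f x) = (1 / (L2_norm_fun \<phi>)\<^sup>2) *\<^sub>R
       (LINT u|lebesgue. LINT w|lebesgue. ?S w u)"
    if ae: "AE u in lebesgue. integrable lebesgue (\<lambda>w. ?S w u)"
  proof -
    obtain r where r: "\<And>n. r n > 0" "r \<longlonglongrightarrow> 0"
      and D: "AE q in lborel. (\<lambda>n. LBINT s. mollifier (r n) s * (p (q + s) - p q)\<^sup>2) \<longlonglongrightarrow> 0"
      using AE_mollified_deviation_tendsto[OF p p2] by blast
    have D': "AE u in lborel. (\<lambda>n. LBINT s. mollifier (r n) s * (p ((x - u) + s) - p (x - u))\<^sup>2) \<longlonglongrightarrow> 0"
      using AE_lborel_affine[OF _ D, of "-1" x] by simp
    have ae': "AE u in lborel. integrable lebesgue (\<lambda>w. ?S w u)"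
      using ae by (simp add: AE_completion_iff)
    have inner: "AE u in lborel. (LINT w|lebesgue. ?S w u) = (f x * (p (x - u))\<^sup>2) *\<^sub>R oreal 1"
      using D' ae' \<phi>xu
    proof eventually_elim
      case (elim u)
      have Tm [measurable]: "?T u \<in> borel_measurable borel" by measurable
      show ?case
      \<comment> \<open>The premise concerns the transform multiplied by \<open>p (x - u)\<close>;
        integrability of the transform itself follows by division when this factor is nonzero, and
        otherwise both sides vanish.\<close>
      proof (cases "p (x - u) = 0")
        case True
        then show ?thesis using elim(3) by (simp add: integrand)
      next
        case False
        have "integrable lborel (\<lambda>w. (1 / C) *\<^sub>R (p (x - u) *\<^sub>R ?U w (?T u w)))"
          using elim(2) unfolding integrand elim(3) by (subst (asm) integrable_completion) auto
        then have "integrable lborel (\<lambda>w. (C / p (x - u)) *\<^sub>R ((1 / C) *\<^sub>R (p (x - u) *\<^sub>R ?U w (?T u w))))"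
          by (rule integrable_scaleR_right)
        then have "integrable lborel (\<lambda>w. ?U w (?T u w))"
          using C False by simp
        then have T: "integrable lborel (?T u)"
          by (rule integrable_oct_unkernelD[OF Tm])
        have g: "integrable lborel (\<lambda>y. f y * p (y - u))"
          using translate_L2[OF p p2, of "- u"] f2 by (intro integrable_mult_L2) auto
        have m: "integrable lborel (\<lambda>s. mollifier (r n) s * (f (x + s) * p ((x - u) + s)))" for n
          using integrable_mollifier_scaleR[OF r(1) g, of n x] by (simp add: algebra_simps)
        have "(\<lambda>n. LBINT s. mollifier (r n) s * (f (x + s) * p ((x - u) + s))) \<longlonglongrightarrow> f x * p (x - u)"
          by (rule mollified_product_tendsto[OF f_cont p p2 r m elim(1)])
        then have lim: "(\<lambda>n. LBINT s. mollifier (r n) s * (f (x + s) * p (x + s - u))) \<longlonglongrightarrow> f x * p (x - u)"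
          by (simp add: algebra_simps)
        have "(LBINT w. ?U w (?T u w)) = (C * (f x * p (x - u))) *\<^sub>R oreal 1"
          unfolding C_def by (rule oct_transform_inversion_pointwise[OF b g T r lim])
        then show ?thesis
          using C unfolding integrand elim(3)
          by (simp add: integral_completion power2_eq_square)
      qed
    qed
    \<comment> \<open>The window entered once in the transform and once as a factor, so the integral
      over \<open>u\<close> yields the squared norm that the normalisation divides out.\<close>
    have pr: "integrable lborel (\<lambda>u. (p (x - u))\<^sup>2)" "(LBINT u. (p (x - u))\<^sup>2) = N"
      using lborel_integral_reflect[of "\<lambda>v. (p v)\<^sup>2" x] p2 by (simp_all add: N_def)
    have "integrable lborel (\<lambda>u. (f x * (p (x - u))\<^sup>2) *\<^sub>R oreal 1)" "(LBINT u. (f x * (p (x - u))\<^sup>2) *\<^sub>R oreal 1) = (f x * N) *\<^sub>R oreal 1"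
      using pr by simp_all
    then show ?thesis
      using lebesgue_integral_AE_eq[OF _ inner] f_eq by simp
  qed
  show "((\<forall>w. integrable lebesgue (?S w)) \<and> integrable lebesgue (\<lambda>w. LINT u|lebesgue. ?S w u) \<and>
     oreal (f x) = (1 / (L2_norm_fun \<phi>)\<^sup>2) *\<^sub>R (LINT w|lebesgue. LINT u|lebesgue. ?S w u)) \<and>
    ((AE u in lebesgue. integrable lebesgue (\<lambda>w. ?S w u)) \<longrightarrow>
     integrable lebesgue (\<lambda>u. LINT w|lebesgue. ?S w u) \<and>
     oreal (f x) = (1 / (L2_norm_fun \<phi>)\<^sup>2) *\<^sub>R (LINT u|lebesgue. LINT w|lebesgue. ?S w u))"
    using A B by blast
qed

end
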